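(* Let $A_+,A_->0$, $t_+,t_->0$ and $B\in\mathbb{R}$ satisfy $A_+A_--B^2>0$, and let $n_+,n_-\in\mathbb{Z}$ be given. Then there exists a unique solution $[f_+(r),f_-(r)]$, $r\in[0,\infty)$, of the radial problem (R) with degree pair $[n_+,n_-]$ stated in the context. Moreover, \begin{gather*} f_\pm\in C^\infty((0,\infty)),\\ f_\pm(r)>0\quad\text{for all } r>0,\\ f_\pm(r)\sim r^{|n_\pm|}\quad\text{for } r\sim 0,\\ \int_0^\infty (f_\pm')^2\,r\,dr<\infty,\\ \int_0^\infty\left[A_+(f_+^2-t_+^2)^2+2B(f_+^2-t_+^2)(f_-^2-t_-^2)+A_-(f_-^2-t_-^2)^2\right]r\,dr=n_+^2t_+^2+n_-^2t_-^2. \end{gather*} In particular, in polar coordinates $(r,\theta)$ on $\mathbb{R}^2$, $\Psi(x)=[f_+(r)e^{in_+\theta},f_-(r)e^{in_-\theta}]$ is an entire solution in $\mathbb{R}^2$ of the system (S) stated in the context.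
   Context: The system (S), for $\Psi=(\psi_+,\psi_-):\mathbb{R}^2\to\mathbb{C}^2$, is \begin{align*} -\Delta\psi_++[A_+(|\psi_+|^2-t_+^2)+B(|\psi_-|^2-t_-^2)]\psi_+&=0,\\ -\Delta\psi_-+[A_-(|\psi_-|^2-t_-^2)+B(|\psi_+|^2-t_+^2)]\psi_-&=0. \end{align*} The radial problem (R) with degree pair $[n_+,n_-]$, for real-valued functions $f_+,f_-$ on $[0,\infty)$, is \begin{gather*} -f_+''-\tfrac1r f_+'+\tfrac{n_+^2}{r^2}f_++[A_+(f_+^2-t_+^2)+B(f_-^2-t_-^2)]f_+=0,\quad r\in(0,\infty),\\ -f_-''-\tfrac1r f_-'+\tfrac{n_-^2}{r^2}f_-+[A_-(f_-^2-t_-^2)+B(f_+^2-t_+^2)]f_-=0,\quad r\in(0,\infty),\\ f_\pm(r)\ge0\ \text{for all } r\in[0,\infty),\qquad f_\pm(r)\to t_\pm\ \text{as } r\to\infty,\\ f_\pm(0)=0\ \text{if } n_\pm\ne0,\qquad f_\pm'(0)=0\ \text{if } n_\pm=0. \end{gather*} Solutions are classical: continuous on $[0,\infty)$ and twice continuously differentiable on $(0,\infty)$ (and differentiable at $0$, one-sidedly, for a component with $n_\pm=0$). The notation $f_\pm(r)\sim r^{|n_\pm|}$ for $r\sim0$ means that $f_\pm$ vanishes exactly to order $|n_\pm|$ at $r=0$, i.e. $f_\pm(r)/r^{|n_\pm|}$ has a finite, strictly positive limit as $r\to0^+$. Each statement with $\pm$ holds for both signs. *)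

theory Defs
  imports "HOL-Analysis.Analysis"
begin

text \<open>Profiles are total functions on the reals of which only the restriction to
  \<open>{0..}\<close> matters: interior derivatives are taken only at points \<open>r > 0\<close>, and everything
  at the origin is one-sided.\<close>

definition C2_pos :: "(real \<Rightarrow> real) \<Rightarrow> bool" where
  "C2_pos f \<longleftrightarrow>
     (\<forall>r>0. f differentiable (at r)) \<and>
     (\<forall>r>0. deriv f differentiable (at r)) \<and>
     continuous_on {0<..} (deriv (deriv f))"

definition smooth_pos :: "(real \<Rightarrow> real) \<Rightarrow> bool" where
  "smooth_pos f \<longleftrightarrow> (\<forall>k. \<forall>r>0. (deriv ^^ k) f differentiable (at r))"

text \<open>The conditions on one component \<open>f\<close> of a solution of the radial problem, with \<open>g\<close> the other component;
  \<open>A\<close>, \<open>t\<close>, \<open>n\<close> belong to \<open>f\<close> and \<open>s\<close> is the limit of \<open>g\<close>.\<close>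

definition radial_component ::
  "real \<Rightarrow> real \<Rightarrow> real \<Rightarrow> real \<Rightarrow> int \<Rightarrow> (real \<Rightarrow> real) \<Rightarrow> (real \<Rightarrow> real) \<Rightarrow> bool" where
  "radial_component A B t s n f g \<longleftrightarrow>
     continuous_on {0..} f \<and> C2_pos f \<and>
     (\<forall>r>0. - deriv (deriv f) r - 1 / r * deriv f r + (of_int n)\<^sup>2 / r\<^sup>2 * f r
            + (A * ((f r)\<^sup>2 - t\<^sup>2) + B * ((g r)\<^sup>2 - s\<^sup>2)) * f r = 0) \<and>
     (\<forall>r\<ge>0. f r \<ge> 0) \<and>
     (f \<longlongrightarrow> t) at_top \<and>
     (n \<noteq> 0 \<longrightarrow> f 0 = 0) \<and>
     (n = 0 \<longrightarrow> (f has_real_derivative 0) (at 0 within {0..}))"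

definition radial_solution ::
  "real \<Rightarrow> real \<Rightarrow> real \<Rightarrow> real \<Rightarrow> real \<Rightarrow> int \<Rightarrow> int
    \<Rightarrow> (real \<Rightarrow> real) \<Rightarrow> (real \<Rightarrow> real) \<Rightarrow> bool" where
  "radial_solution Ap Am B tp tm np nm fp fm \<longleftrightarrow>
     radial_component Ap B tp tm np fp fm \<and> radial_component Am B tm tp nm fm fp"

definition vanishes_to_order :: "(real \<Rightarrow> real) \<Rightarrow> nat \<Rightarrow> bool" where
  "vanishes_to_order f m \<longleftrightarrow> (\<exists>c>0. ((\<lambda>r. f r / r ^ m) \<longlongrightarrow> c) (at_right 0))"

definition partial_deriv :: "2 \<Rightarrow> (real^2 \<Rightarrow> complex) \<Rightarrow> real^2 \<Rightarrow> complex" where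
  "partial_deriv i u x = frechet_derivative u (at x) (axis i 1)"

definition C1_plane :: "(real^2 \<Rightarrow> complex) \<Rightarrow> bool" where
  "C1_plane u \<longleftrightarrow> (\<forall>x. u differentiable (at x)) \<and> (\<forall>i. continuous_on UNIV (partial_deriv i u))"

definition C2_plane :: "(real^2 \<Rightarrow> complex) \<Rightarrow> bool" where
  "C2_plane u \<longleftrightarrow> C1_plane u \<and> (\<forall>i. C1_plane (partial_deriv i u))"

definition laplacian :: "(real^2 \<Rightarrow> complex) \<Rightarrow> real^2 \<Rightarrow> complex" where
  "laplacian u x = (\<Sum>i\<in>UNIV. partial_deriv i (partial_deriv i u) x)"

text \<open>Classical solutions of the Ginzburg-Landau system on the whole plane, the origin included.\<close>

definition entire_solution ::
  "real \<Rightarrow> real \<Rightarrow> real \<Rightarrow> real \<Rightarrow> real \<Rightarrow> (real^2 \<Rightarrow> complex \<times> complex) \<Rightarrow> bool" where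
  "entire_solution Ap Am B tp tm \<Psi> \<longleftrightarrow>
     (let u = (\<lambda>x. fst (\<Psi> x)); v = (\<lambda>x. snd (\<Psi> x)) in
       C2_plane u \<and> C2_plane v \<and>
       (\<forall>x. - laplacian u x
            + of_real (Ap * ((cmod (u x))\<^sup>2 - tp\<^sup>2) + B * ((cmod (v x))\<^sup>2 - tm\<^sup>2)) * u x = 0) \<and>
       (\<forall>x. - laplacian v x
            + of_real (Am * ((cmod (v x))\<^sup>2 - tm\<^sup>2) + B * ((cmod (u x))\<^sup>2 - tp\<^sup>2)) * v x = 0))"

text \<open>The function \<open>f(r) e\<^sup>i\<^sup>n\<^sup>\<theta>\<close>, with \<open>\<theta>\<close> the principal argument. The choice of branch is
  irrelevant since \<open>n\<close> is an integer, and so is the value of \<open>Arg\<close> at the origin when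
  \<open>n = 0\<close> or \<open>f 0 = 0\<close>; see the lemma below.\<close>

definition polar_field :: "(real \<Rightarrow> real) \<Rightarrow> int \<Rightarrow> real^2 \<Rightarrow> complex" where
  "polar_field f n x =
     of_real (f (norm x)) * exp (\<i> * of_int n * of_real (Arg (Complex (x $ 1) (x $ 2))))"

lemma polar_field_polar:
  assumes "r \<ge> 0" and "n \<noteq> 0 \<Longrightarrow> f 0 = 0"
  shows "polar_field f n (vector [r * cos \<theta>, r * sin \<theta>])
           = of_real (f r) * exp (\<i> * of_int n * of_real \<theta>)"
proof -
  let ?x = "vector [r * cos \<theta>, r * sin \<theta>] :: real^2"
  have e: "exp (\<i> * of_int n * of_real a) = cis a powi n" for a
    by (simp only: cis_power_int) (simp add: cis_conv_exp mult_ac)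
  have "norm ?x = sqrt (r\<^sup>2 * ((cos \<theta>)\<^sup>2 + (sin \<theta>)\<^sup>2))"
    unfolding norm_vec_def L2_set_def by (simp only: sum_2 vector_2 real_norm_def power2_abs power_mult_distrib distrib_left)
  then have nx: "norm ?x = r" using assms(1) by simp
  have z: "Complex (?x $ 1) (?x $ 2) = rcis r \<theta>"
    by (simp add: complex_eq_iff)
  show ?thesis
  proof (cases "r = 0")
    case True
    then show ?thesis
      using assms(2) nx by (cases "n = 0") (auto simp: polar_field_def)
  next
    case False
    then have "cis (Arg (rcis r \<theta>)) = cis \<theta>"
      using assms(1) by (subst cis_Arg) (auto simp: sgn_div_norm rcis_def scaleR_conv_of_real norm_mult)
    then show ?thesis unfolding polar_field_def z nx e by simp
  qed
qed

end

theory Submission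
  imports Defs
begin

text \<open>With \<open>x = ln r\<close> the radial problem becomes a regular system
  \<open>p'' = (m\<^sup>2 + e\<^bsup>2x\<^esup> V) p\<close> on the whole line. It is cooperative for \<open>B \<le> 0\<close>, and for \<open>B \<ge> 0\<close> after
  replacing \<open>q\<close> by \<open>-q\<close>, so an explicit ordered pair of sub- and supersolutions and monotone iteration
  give a positive bounded solution that stays away from \<open>0\<close> at \<open>+\<infinity>\<close>.
  A barrier for \<open>max (\<bar>p\<^sup>2 - s\<^sup>2\<bar> / \<surd>A', \<bar>q\<^sup>2 - t\<^sup>2\<bar> / \<surd>A)\<close> yields \<open>p\<^sup>2 - s\<^sup>2 = O(e\<^bsup>-2x\<^esup>)\<close>, and the Riccati
  equation for \<open>p' / p\<close> yields \<open>p' / p = m + O(e\<^bsup>2x\<^esup>)\<close> at \<open>-\<infinity>\<close>. For two solutions the Picone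
  quantity \<open>(p\<^sub>1'/p\<^sub>1 - p\<^sub>2'/p\<^sub>2) (p\<^sub>1\<^sup>2 - p\<^sub>2\<^sup>2)\<close>, added to its analogue for \<open>q\<close>, is nondecreasing, vanishes at
  \<open>-\<infinity>\<close> and would have to grow faster than the solutions allow unless it is identically \<open>0\<close>, which forces
  equality. The integral identity is the Pohozaev identity.\<close>

section \<open>Comparison and linear boundary value problems\<close>

text \<open>The singular point r = 0 sits at minus infinity in x, where of the two behaviours exp (m
  x) and exp (-m x) (1 and x when m = 0) boundedness keeps only the first. The conditions at both
  ends can therefore be relaxed to the class \<open>profile_pair\<close>: positive, bounded, bounded
  away from 0 at plus infinity. The iteration yields exactly these properties, uniqueness holds in
  this class, and the limits s and t come out as a consequence. The obstacle in the iteration is a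
  subsolution that does not decay: the explicit profiles are tuned so that A A' > B^2 leaves a
  negative coefficient near plus infinity under the least favourable value the other component can
  take there. The same condition, as positive definiteness of the potential, gives the interaction
  term in the derivative of the Picone quantity its sign, whatever the sign of B. On the plane only
  the origin is delicate. There f(r) e^(i n \<theta>) is rewritten as W(\<sigma>) times a power of z
  or of its conjugate, with \<sigma> = |x|^2, and C^2 regularity reduces to the limits of W, W' and
  \<sigma> W'' at 0.\<close>

definition has_second_deriv :: "(real \<Rightarrow> real) \<Rightarrow> (real \<Rightarrow> real) \<Rightarrow> real set \<Rightarrow> bool" where
  "has_second_deriv w w2 S \<longleftrightarrow> (\<exists>w'. \<forall>x\<in>S. (w has_real_derivative w' x) (at x) \<and> (w' has_real_derivative w2 x) (at x))"

lemma has_second_derivI: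
  assumes "\<And>x. x \<in> S \<Longrightarrow> (w has_real_derivative w' x) (at x)"
    and "\<And>x. x \<in> S \<Longrightarrow> (w' has_real_derivative w2 x) (at x)"
  shows "has_second_deriv w w2 S"
  using assms unfolding has_second_deriv_def by blast

lemma has_second_deriv_subset:
  "has_second_deriv w w2 S \<Longrightarrow> T \<subseteq> S \<Longrightarrow> has_second_deriv w w2 T"
  unfolding has_second_deriv_def by blast

lemma has_second_deriv_diff:
  assumes "has_second_deriv u u2 S" "has_second_deriv w w2 S"
  shows "has_second_deriv (\<lambda>x. u x - w x) (\<lambda>x. u2 x - w2 x) S"
proof -
  from assms obtain u' w' where
    "\<forall>x\<in>S. (u has_real_derivative u' x) (at x) \<and> (u' has_real_derivative u2 x) (at x)"
    "\<forall>x\<in>S. (w has_real_derivative w' x) (at x) \<and> (w' has_real_derivative w2 x) (at x)"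
    unfolding has_second_deriv_def by blast
  then show ?thesis
    by (intro has_second_derivI[where w'="\<lambda>x. u' x - w' x"]) (auto intro: DERIV_diff)
qed

lemma has_second_deriv_cong:
  assumes "has_second_deriv w w2 S" "open S" "\<And>x. x \<in> S \<Longrightarrow> w x = v x" "\<And>x. x \<in> S \<Longrightarrow> w2 x = v2 x"
  shows "has_second_deriv v v2 S"
proof -
  from assms(1) obtain w' where
    w: "\<forall>x\<in>S. (w has_real_derivative w' x) (at x) \<and> (w' has_real_derivative w2 x) (at x)"
    unfolding has_second_deriv_def by blast
  show ?thesis
  proof (intro has_second_derivI[where w'=w'])
    fix x assume x: "x \<in> S"
    show "(v has_real_derivative w' x) (at x)"
      using w x assms(2,3) by (blast intro: has_field_derivative_transform_within_open)
    show "(w' has_real_derivative v2 x) (at x)" using w x assms(4) by metis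
  qed
qed

text \<open>\<open>w'\<close> is assumed differentiable at the single point \<open>x\<close> only,
  so the second-order test is done by hand: with \<open>c > 0\<close> the derivative, zero at
  \<open>x\<close>, is positive just to the right, and the mean value theorem lifts \<open>w\<close>
  above its maximum.\<close>

lemma interior_max_derivs:
  fixes w w' :: "real \<Rightarrow> real"
  assumes ax: "a < x" and xb: "x < b"
    and w: "\<And>y. a < y \<Longrightarrow> y < b \<Longrightarrow> (w has_real_derivative w' y) (at y)"
    and w2: "(w' has_real_derivative c) (at x)"
    and max: "\<And>y. a < y \<Longrightarrow> y < b \<Longrightarrow> w y \<le> w x"
  shows "w' x = 0" and "c \<le> 0"
proof -
  have d: "0 < min (x - a) (b - x)" using ax xb by simp
  show z: "w' x = 0"
  proof (rule DERIV_local_max[OF w[OF ax xb] d], intro allI impI)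
    fix y assume "\<bar>x - y\<bar> < min (x - a) (b - x)"
    then show "w y \<le> w x" by (intro max) linarith+
  qed
  show "c \<le> 0"
  proof (rule ccontr)
    assume "\<not> c \<le> 0"
    then obtain d where d: "d > 0" "\<And>h. h > 0 \<Longrightarrow> h < d \<Longrightarrow> w' x < w' (x + h)"
      using DERIV_pos_inc_right[OF w2] by auto
    define h where "h = min d (b - x) / 2"
    have h: "h > 0" "h < d" "x + h < b" using d(1) xb by (auto simp: h_def min_def field_simps)
    have "\<exists>z>x. z < x + h \<and> w (x + h) - w x = (x + h - x) * w' z"
      using h ax by (intro MVT2 w) auto
    then obtain z where z': "z > x" "z < x + h" "w (x + h) - w x = h * w' z" by auto
    have "w' z > 0" using d(2)[of "z - x"] z' h z by auto
    then have "w (x + h) > w x" using z' h(1) by (metis diff_gt_0_iff_gt mult_pos_pos)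
    moreover have "w (x + h) \<le> w x" using h ax by (intro max) auto
    ultimately show False by simp
  qed
qed

text \<open>At a positive interior maximum the second derivative would be at most 0, against the
  strict sign in \<open>pos\<close>. Strictness spares the usual perturbation of
  \<open>w\<close>.\<close>

lemma weak_max_principle:
  assumes cont: "continuous_on {a..b} w"
    and w2: "has_second_deriv w w2 {a<..<b}"
    and bd: "w a \<le> 0" "w b \<le> 0"
    and pos: "\<And>x. a < x \<Longrightarrow> x < b \<Longrightarrow> w x > 0 \<Longrightarrow> w2 x > 0"
    and x: "a \<le> x" "x \<le> b"
  shows "w x \<le> 0"
proof -
  from w2 obtain w' where w': "\<And>x. x \<in> {a<..<b} \<Longrightarrow> (w has_real_derivative w' x) (at x)"
    "\<And>x. x \<in> {a<..<b} \<Longrightarrow> (w' has_real_derivative w2 x) (at x)"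
    unfolding has_second_deriv_def by blast
  obtain z where z: "z \<in> {a..b}" "\<And>y. y \<in> {a..b} \<Longrightarrow> w y \<le> w z"
    using continuous_attains_sup[OF _ _ cont] x by auto
  have "w z \<le> 0"
  proof (rule ccontr)
    assume n: "\<not> w z \<le> 0"
    then have az: "a < z" "z < b" using bd z(1) by (auto simp: less_le)
    have "w2 z \<le> 0"
      by (rule interior_max_derivs(2)[OF az, of w w']) (use w' az z(2) in auto)
    with pos[OF az] n show False by simp
  qed
  with z(2)[of x] x show ?thesis by simp
qed

text \<open>The margin 1 on both sides makes every point of {a..b} interior to the interval of
  integration, so the derivative is two-sided also at a and b.\<close>

lemma antiderivative_on_interval:
  fixes f :: "real \<Rightarrow> real"
  assumes "continuous_on {a-1..b+1} f"
  shows "\<exists>g. \<forall>x\<in>{a..b}. (g has_real_derivative f x) (at x)"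
proof -
  obtain g where g: "\<And>x. x \<in> {a-1..b+1} \<Longrightarrow> (g has_vector_derivative f x) (at x within {a-1..b+1})"
    using antiderivative_continuous[OF assms] by blast
  have "(g has_real_derivative f x) (at x)" if "x \<in> {a..b}" for x
  proof -
    have "x \<in> interior {a-1..b+1}" using that by simp
    then have "at x within {a-1..b+1} = at x" by (rule at_within_interior)
    then show ?thesis
      using g[of x] that by (simp add: has_real_derivative_iff_has_vector_derivative)
  qed
  then show ?thesis by blast
qed

text \<open>Reduction of order: with \<open>w = \<phi> \<omega>\<close> the equation \<open>w'' = K w - h\<close> becomes
  \<open>(\<phi>\<^sup>2 \<omega>')' = - \<phi> h\<close>, which is solved by two quadratures.\<close>

lemma linear_bvp:
  fixes \<phi> \<phi>' K h :: "real \<Rightarrow> real"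
  assumes ab: "a < b" and pos: "\<And>x. \<phi> x > 0"
    and d1: "\<And>x. (\<phi> has_real_derivative \<phi>' x) (at x)"
    and d2: "\<And>x. (\<phi>' has_real_derivative K x * \<phi> x) (at x)"
    and h: "continuous_on UNIV h"
  shows "\<exists>w. continuous_on {a..b} w \<and> w a = \<alpha> \<and> w b = \<beta> \<and>
      has_second_deriv w (\<lambda>x. K x * w x - h x) {a<..<b}"
proof -
  have c\<phi>: "continuous_on S \<phi>" for S
    using d1 by (meson DERIV_isCont continuous_at_imp_continuous_on)
  have nz: "\<phi> x \<noteq> 0" for x using pos[of x] by simp
  \<comment> \<open>Each quadrature costs a margin of one. The second needs the first antiderivative
    \<open>g\<close> continuous on {a-1..b+1}, so \<open>g\<close> is built on the larger interval
    {a-2..b+2}.\<close>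
  have c\<phi>h: "continuous_on {a-2-1..b+2+1} (\<lambda>x. \<phi> x * h x)"
    by (intro continuous_intros c\<phi> continuous_on_subset[OF h]) auto
  obtain g where g: "\<And>x. x \<in> {a-2..b+2} \<Longrightarrow> (g has_real_derivative \<phi> x * h x) (at x)"
    using antiderivative_on_interval[OF c\<phi>h] by blast
  have cg: "continuous_on {a-1..b+1} g"
  proof (intro continuous_at_imp_continuous_on ballI)
    fix x assume "x \<in> {a-1..b+1}"
    then have "x \<in> {a-2..b+2}" by auto
    then show "isCont g x" using g DERIV_isCont by blast
  qed
  obtain g2 where g2: "\<And>x. x \<in> {a..b} \<Longrightarrow> (g2 has_real_derivative 1 / (\<phi> x)\<^sup>2) (at x)"
  proof -
    have "continuous_on {a-1..b+1} (\<lambda>x. 1 / (\<phi> x)\<^sup>2)"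
      using nz by (intro continuous_intros c\<phi>) auto
    from antiderivative_on_interval[OF this] that show ?thesis by blast
  qed
  obtain g3 where g3: "\<And>x. x \<in> {a..b} \<Longrightarrow> (g3 has_real_derivative g x / (\<phi> x)\<^sup>2) (at x)"
  proof -
    have "continuous_on {a-1..b+1} (\<lambda>x. g x / (\<phi> x)\<^sup>2)"
      using nz by (intro continuous_intros c\<phi> cg) auto
    from antiderivative_on_interval[OF this] that show ?thesis by blast
  qed
  have "g2 a < g2 b"
  proof (rule DERIV_pos_imp_increasing[OF ab])
    fix x assume "a \<le> x" "x \<le> b"
    then show "\<exists>y. (g2 has_real_derivative y) (at x) \<and> y > 0"
      using g2[of x] pos[of x] by (intro exI[of _ "1 / (\<phi> x)\<^sup>2"]) auto
  qed
  \<comment> \<open>The first quadrature gives \<phi>^2 \<omega>' = c - g, the second \<omega> = d +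
    c g2 - g3. The constants \<open>c\<close> and \<open>d\<close> solve the two boundary
    conditions, which is possible because \<open>g2\<close> is strictly increasing.\<close>
  define c where "c = (\<beta> / \<phi> b - \<alpha> / \<phi> a + g3 b - g3 a) / (g2 b - g2 a)"
  define d where "d = \<alpha> / \<phi> a - c * g2 a + g3 a"
  define \<omega> where "\<omega> x = d + c * g2 x - g3 x" for x
  have c: "c * (g2 b - g2 a) = \<beta> / \<phi> b - \<alpha> / \<phi> a + g3 b - g3 a"
    using \<open>g2 a < g2 b\<close> by (simp add: c_def)
  have \<omega>a: "\<omega> a = \<alpha> / \<phi> a" by (simp add: \<omega>_def d_def)
  have \<omega>b: "\<omega> b = \<beta> / \<phi> b" using c by (simp add: \<omega>_def d_def algebra_simps)
  have \<omega>': "(\<omega> has_real_derivative (c - g x) / (\<phi> x)\<^sup>2) (at x)" if "x \<in> {a..b}" for x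
    unfolding \<omega>_def by (rule derivative_eq_intros g2 g3 that refl)+ (simp add: diff_divide_distrib)
  define w where "w x = \<phi> x * \<omega> x" for x
  define w' where "w' x = \<phi>' x * \<omega> x + (c - g x) / \<phi> x" for x
  have w1: "(w has_real_derivative w' x) (at x)" if "x \<in> {a..b}" for x
  proof -
    have "(w has_real_derivative \<phi>' x * \<omega> x + (c - g x) / (\<phi> x)\<^sup>2 * \<phi> x) (at x)"
      unfolding w_def by (rule DERIV_mult[OF d1 \<omega>'[OF that]])
    then show ?thesis using nz[of x] by (simp add: w'_def power2_eq_square)
  qed
  have w2: "(w' has_real_derivative K x * w x - h x) (at x)" if "x \<in> {a..b}" for x
  proof -
    have g': "(g has_real_derivative \<phi> x * h x) (at x)" using that by (intro g) auto
    have "(w' has_real_derivative (K x * \<phi> x) * \<omega> x + (c - g x) / (\<phi> x)\<^sup>2 * \<phi>' x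
        + ((0 - \<phi> x * h x) * \<phi> x - (c - g x) * \<phi>' x) / (\<phi> x * \<phi> x)) (at x)"
      unfolding w'_def
      by (intro DERIV_add DERIV_mult DERIV_divide DERIV_diff DERIV_const d1 d2 g' \<omega>'[OF that] nz)
    moreover have "(K x * \<phi> x) * \<omega> x + (c - g x) / (\<phi> x)\<^sup>2 * \<phi>' x
        + ((0 - \<phi> x * h x) * \<phi> x - (c - g x) * \<phi>' x) / (\<phi> x * \<phi> x) = K x * w x - h x"
      using nz[of x] by (simp add: w_def field_simps power2_eq_square)
    ultimately show ?thesis by simp
  qed
  have "continuous_on {a..b} w"
    using w1 by (meson DERIV_isCont continuous_at_imp_continuous_on)
  moreover have "w a = \<alpha>" "w b = \<beta>" using \<omega>a \<omega>b pos[of a] pos[of b] by (auto simp: w_def)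
  moreover have "has_second_deriv w (\<lambda>x. K x * w x - h x) {a<..<b}"
    using w1 w2 by (intro has_second_derivI[where w'=w']) auto
  ultimately show ?thesis by blast
qed

text \<open>Integrating twice writes \<open>u k\<close> through \<open>u k a\<close>, the slope
  \<open>u' k a\<close> and a double integral of \<open>h k\<close>, which converges by dominated
  convergence. The slopes get no bound of their own: the values at both endpoints determine them, so
  they converge too, and the limit formula can be differentiated twice.\<close>

lemma second_deriv_limit:
  fixes u h :: "nat \<Rightarrow> real \<Rightarrow> real"
  assumes ab: "a < b"
    and u: "\<And>k x. x \<in> {a..b} \<Longrightarrow> (u k has_real_derivative u' k x) (at x)"
    and u': "\<And>k x. x \<in> {a..b} \<Longrightarrow> (u' k has_real_derivative h k x) (at x)"
    and ch: "\<And>k. continuous_on {a..b} (h k)" and bh: "\<And>k x. x \<in> {a..b} \<Longrightarrow> \<bar>h k x\<bar> \<le> M"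
    and lu: "\<And>x. x \<in> {a..b} \<Longrightarrow> (\<lambda>k. u k x) \<longlonglongrightarrow> U x"
    and lh: "\<And>x. x \<in> {a..b} \<Longrightarrow> (\<lambda>k. h k x) \<longlonglongrightarrow> H x"
    and cH: "continuous_on {a..b} H"
  shows "has_second_deriv U H {a<..<b}"
proof -
  have M: "M \<ge> 0" using bh[of a 0] ab by (auto intro: order.trans[OF abs_ge_zero])
  define I where "I k x = integral {a..x} (h k)" for k x
  define J where "J x = integral {a..x} H" for x
  have ih: "h k integrable_on {a..x}" if "x \<in> {a..b}" for k x
    using that by (intro integrable_continuous_real continuous_on_subset[OF ch]) auto
  have IJ: "(\<lambda>k. I k x) \<longlonglongrightarrow> J x" if x: "x \<in> {a..b}" for x
    unfolding I_def J_def
  proof (rule dominated_convergence(2)[where h="\<lambda>_. M"])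
    show "h k integrable_on {a..x}" for k by (rule ih[OF x])
    show "(\<lambda>_. M) integrable_on {a..x}" by (rule integrable_const_ivl)
    show "norm (h k y) \<le> M" if "y \<in> {a..x}" for k y using bh[of y k] that x by auto
    show "(\<lambda>k. h k y) \<longlonglongrightarrow> H y" if "y \<in> {a..x}" for y using lh[of y] that x by auto
  qed
  have I: "u' k x = u' k a + I k x" if x: "x \<in> {a..b}" for k x
  proof -
    have "(h k has_integral (u' k x - u' k a)) {a..x}"
      using x u' by (intro fundamental_theorem_of_calculus)
        (auto simp: has_real_derivative_iff_has_vector_derivative[symmetric] intro: has_field_derivative_at_within)
    then show ?thesis unfolding I_def by (simp add: integral_unique)
  qed
  have Ib: "\<bar>I k x\<bar> \<le> M * (b - a)" if x: "x \<in> {a..b}" for k x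
  proof -
    have "norm (I k x) \<le> M * (x - a)"
      unfolding I_def using x bh ih by (intro integral_bound continuous_on_subset[OF ch]) auto
    also have "\<dots> \<le> M * (b - a)" using x M by (intro mult_left_mono) auto
    finally show ?thesis by simp
  qed
  have cJ: "continuous_on {a..b} J"
    unfolding J_def by (intro indefinite_integral_continuous_1 integrable_continuous_real cH)
  have cI: "continuous_on {a..b} (I k)" for k
    unfolding I_def by (intro indefinite_integral_continuous_1 integrable_continuous_real ch)
  have uI: "u k x = u k a + (x - a) * u' k a + integral {a..x} (I k)" if x: "x \<in> {a..b}" for k x
  proof -
    have "(u' k has_integral (u k x - u k a)) {a..x}"
      using x u by (intro fundamental_theorem_of_calculus)
        (auto simp: has_real_derivative_iff_has_vector_derivative[symmetric] intro: has_field_derivative_at_within)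
    then have "integral {a..x} (u' k) = u k x - u k a" by (simp add: integral_unique)
    moreover have "integral {a..x} (u' k) = integral {a..x} (\<lambda>y. u' k a + I k y)"
    proof (rule integral_cong)
      fix y assume "y \<in> {a..x}"
      then show "u' k y = u' k a + I k y" using x by (intro I) auto
    qed
    moreover have "\<dots> = (x - a) * u' k a + integral {a..x} (I k)"
      using x by (subst integral_add) (auto intro!: integrable_continuous_real continuous_on_subset[OF cI])
    ultimately show ?thesis by simp
  qed
  have IJ2: "(\<lambda>k. integral {a..x} (I k)) \<longlonglongrightarrow> integral {a..x} J" if x: "x \<in> {a..b}" for x
  proof (rule dominated_convergence(2)[where h="\<lambda>_. M * (b - a)"])
    show "I k integrable_on {a..x}" for k
      using x by (intro integrable_continuous_real continuous_on_subset[OF cI]) auto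
    show "(\<lambda>_. M * (b - a)) integrable_on {a..x}" by (rule integrable_const_ivl)
    show "norm (I k y) \<le> M * (b - a)" if "y \<in> {a..x}" for k y using Ib[of y k] that x by auto
    show "(\<lambda>k. I k y) \<longlonglongrightarrow> J y" if "y \<in> {a..x}" for y using IJ[of y] that x by auto
  qed
  define d where "d = (U b - U a - integral {a..b} J) / (b - a)"
  have u'a: "u' k a = (u k b - u k a - integral {a..b} (I k)) / (b - a)" for k
    using uI[of b k] ab by (simp add: field_simps)
  have d: "(\<lambda>k. u' k a) \<longlonglongrightarrow> d"
    unfolding u'a d_def using ab by (intro tendsto_intros lu IJ2) auto
  have U: "U x = U a + (x - a) * d + integral {a..x} J" if x: "x \<in> {a..b}" for x
  proof -
    have "(\<lambda>k. u k a + (x - a) * u' k a + integral {a..x} (I k)) \<longlonglongrightarrow> U a + (x - a) * d + integral {a..x} J"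
      using ab x by (intro tendsto_intros lu d IJ2) auto
    moreover have "(\<lambda>k. u k a + (x - a) * u' k a + integral {a..x} (I k)) = (\<lambda>k. u k x)"
      by (rule ext) (rule uI[OF x, symmetric])
    ultimately show ?thesis using lu[OF x] LIMSEQ_unique by metis
  qed
  have ftc: "((\<lambda>x. integral {a..x} f) has_real_derivative f x) (at x)"
    if "continuous_on {a..b} f" "x \<in> {a<..<b}" for f x
  proof -
    have "((\<lambda>x. integral {a..x} f) has_real_derivative f x) (at x within {a..b})"
      using that by (intro integral_has_real_derivative) auto
    moreover have "at x within {a..b} = at x"
      using that(2) by (intro at_within_interior) simp
    ultimately show ?thesis by simp
  qed
  have "has_second_deriv (\<lambda>x. U a + (x - a) * d + integral {a..x} J) H {a<..<b}"
  proof (rule has_second_derivI[where w'="\<lambda>x. d + J x"])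
    fix x assume x: "x \<in> {a<..<b}"
    show "((\<lambda>x. U a + (x - a) * d + integral {a..x} J) has_real_derivative d + J x) (at x)"
      by (rule derivative_eq_intros ftc[OF cJ x] refl)+ simp
    show "((\<lambda>x. d + J x) has_real_derivative H x) (at x)"
      using ftc[OF cH x] unfolding J_def by (auto intro!: derivative_eq_intros)
  qed
  then show ?thesis
    by (rule has_second_deriv_cong) (auto intro: U[symmetric])
qed

section \<open>Monotone iteration on the line\<close>

text \<open>Some slope of \<open>u k\<close> is at most 2R/(b-a) by the mean value theorem, and the
  bound on the second derivative spreads this to a Lipschitz constant \<open>L\<close> common to all
  k, which survives the pointwise limit. Continuity of the limit makes the limiting right-hand side
  continuous, as \<open>has_second_deriv_limit\<close> requires.\<close>

lemma has_second_deriv_limit_continuous: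
  fixes u h :: "nat \<Rightarrow> real \<Rightarrow> real"
  assumes ab: "a < b" and u: "\<And>k. has_second_deriv (u k) (h k) {a..b}"
    and bu: "\<And>k x. x \<in> {a..b} \<Longrightarrow> \<bar>u k x\<bar> \<le> R"
    and bh: "\<And>k x. x \<in> {a..b} \<Longrightarrow> \<bar>h k x\<bar> \<le> M"
    and lu: "\<And>x. x \<in> {a..b} \<Longrightarrow> (\<lambda>k. u k x) \<longlonglongrightarrow> U x"
  shows "continuous_on {a..b} U"
proof -
  have "\<exists>w'. (\<forall>x\<in>{a..b}. (u k has_real_derivative w' x) (at x) \<and> (w' has_real_derivative h k x) (at x))" for k
    using u[of k] unfolding has_second_deriv_def by blast
  then obtain u' where u': "\<And>k x. x \<in> {a..b} \<Longrightarrow> (u k has_real_derivative u' k x) (at x)"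
    "\<And>k x. x \<in> {a..b} \<Longrightarrow> (u' k has_real_derivative h k x) (at x)" by metis
  define L where "L = 2 * R / (b - a) + M * (b - a)"
  have u'L: "\<bar>u' k x\<bar> \<le> L" if x: "x \<in> {a..b}" for k x
  proof -
    have "\<exists>z>a. z < b \<and> u k b - u k a = (b - a) * u' k z"
      using ab by (intro MVT2 u') auto
    then obtain z where z: "a < z" "z < b" "u k b - u k a = (b - a) * u' k z" by auto
    have "\<bar>(b - a) * u' k z\<bar> \<le> 2 * R"
      using bu[of a k] bu[of b k] ab z(3) by auto
    then have 1: "\<bar>u' k z\<bar> \<le> 2 * R / (b - a)" using ab by (simp add: abs_mult field_simps)
    have "norm (u' k x - u' k z) \<le> M * norm (x - z)"
      using x z by (intro field_differentiable_bound[of "{a..b}" "u' k" "h k"])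
        (auto intro!: has_field_derivative_at_within[OF u'(2)] bh)
    also have "\<dots> \<le> M * (b - a)"
    proof (rule mult_left_mono)
      show "norm (x - z) \<le> b - a" using x z by auto
      show "0 \<le> M" using bh[OF x, of k] by (auto intro: order.trans[OF abs_ge_zero])
    qed
    finally show ?thesis using 1 unfolding L_def by simp
  qed
  have lip: "\<bar>u k x - u k y\<bar> \<le> L * \<bar>x - y\<bar>" if "x \<in> {a..b}" "y \<in> {a..b}" for k x y
  proof -
    have "norm (u k x - u k y) \<le> L * norm (x - y)"
      by (rule field_differentiable_bound[of "{a..b}" "u k" "u' k"])
        (use that in \<open>auto intro!: has_field_derivative_at_within[OF u'(1)] u'L\<close>)
    then show ?thesis by simp
  qed
  have "\<bar>U x - U y\<bar> \<le> L * \<bar>x - y\<bar>" if "x \<in> {a..b}" "y \<in> {a..b}" for x y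
  proof (rule LIMSEQ_le_const2)
    show "(\<lambda>k. \<bar>u k x - u k y\<bar>) \<longlonglongrightarrow> \<bar>U x - U y\<bar>" using that by (intro tendsto_intros lu)
    show "\<exists>N. \<forall>n\<ge>N. \<bar>u n x - u n y\<bar> \<le> L * \<bar>x - y\<bar>" using lip that by blast
  qed
  moreover have "L \<ge> 0" using u'L[of a 0] ab by (auto intro: order.trans[OF abs_ge_zero])
  ultimately have "L-lipschitz_on {a..b} U" by (intro lipschitz_onI) (auto simp: dist_real_def)
  then show ?thesis by (rule lipschitz_on_continuous_on)
qed

lemma has_second_deriv_limit:
  fixes u h :: "nat \<Rightarrow> real \<Rightarrow> real"
  assumes ab: "a < b" and u: "\<And>k. has_second_deriv (u k) (h k) {a..b}"
    and ch: "\<And>k. continuous_on {a..b} (h k)" and bh: "\<And>k x. x \<in> {a..b} \<Longrightarrow> \<bar>h k x\<bar> \<le> M"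
    and lu: "\<And>x. x \<in> {a..b} \<Longrightarrow> (\<lambda>k. u k x) \<longlonglongrightarrow> U x"
    and lh: "\<And>x. x \<in> {a..b} \<Longrightarrow> (\<lambda>k. h k x) \<longlonglongrightarrow> H x"
    and cH: "continuous_on {a..b} H"
  shows "has_second_deriv U H {a<..<b}"
proof -
  have "\<exists>w'. (\<forall>x\<in>{a..b}. (u k has_real_derivative w' x) (at x) \<and> (w' has_real_derivative h k x) (at x))" for k
    using u[of k] unfolding has_second_deriv_def by blast
  then obtain u' where u': "\<And>k x. x \<in> {a..b} \<Longrightarrow> (u k has_real_derivative u' k x) (at x)"
    "\<And>k x. x \<in> {a..b} \<Longrightarrow> (u' k has_real_derivative h k x) (at x)" by metis
  show ?thesis
    by (rule second_deriv_limit[OF ab u' ch bh lu lh cH])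
qed

text \<open>Where \<open>u > w\<close>, the term K (u - w) is positive, and the inequality gives u -
  w the positive second derivative demanded by the weak maximum principle.\<close>

lemma comparison_principle:
  assumes "continuous_on {a..b} u" "continuous_on {a..b} w"
    and d: "has_second_deriv u u2 {a<..<b}" "has_second_deriv w w2 {a<..<b}"
    and bd: "u a \<le> w a" "u b \<le> w b"
    and K: "\<And>x. a < x \<Longrightarrow> x < b \<Longrightarrow> K x > 0"
    and ineq: "\<And>x. a < x \<Longrightarrow> x < b \<Longrightarrow> w2 x - K x * w x \<le> u2 x - K x * u x"
    and x: "a \<le> x" "x \<le> b"
  shows "u x \<le> (w x :: real)"
proof -
  have "u x - w x \<le> 0"
  proof (rule weak_max_principle[where w="\<lambda>x. u x - w x"])
    show "continuous_on {a..b} (\<lambda>x. u x - w x)" by (intro continuous_intros assms)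
    show "has_second_deriv (\<lambda>x. u x - w x) (\<lambda>x. u2 x - w2 x) {a<..<b}"
      by (rule has_second_deriv_diff[OF d])
    fix y assume y: "a < y" "y < b" "u y - w y > 0"
    then have "K y * (u y - w y) > 0" using K[of y] by simp
    then show "u2 y - w2 y > 0" using ineq[OF y(1,2)] by (simp add: algebra_simps)
  qed (use bd x in auto)
  then show ?thesis by simp
qed

lemma has_second_deriv_continuous:
  "has_second_deriv w w2 S \<Longrightarrow> T \<subseteq> S \<Longrightarrow> continuous_on T w"
  unfolding has_second_deriv_def by (meson DERIV_isCont continuous_at_imp_continuous_on subsetD)

text \<open>The intervals grow with the iteration: the linear problem for \<open>H\<close> (later K
  times the old iterate minus the nonlinearity) is solved on [-(k+1), k+1] with the supersolution
  \<beta> as boundary value, and continued by \<beta> outside. The result lies below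
  \<open>u\<close>: on [-k, k] by comparison, elsewhere because \<open>u\<close> equals \<beta>
  there. A single sequence thus exhausts the whole line.\<close>

lemma monotone_step:
  fixes \<phi> \<phi>' K H \<alpha> \<beta> u :: "real \<Rightarrow> real" and k :: nat
  assumes pos: "\<And>x. \<phi> x > 0"
    and d1: "\<And>x. (\<phi> has_real_derivative \<phi>' x) (at x)"
    and d2: "\<And>x. (\<phi>' has_real_derivative K x * \<phi> x) (at x)"
    and K: "\<And>x. K x > 0" and H: "continuous_on UNIV H"
    and \<alpha>: "has_second_deriv \<alpha> \<alpha>2 UNIV" "\<And>x. K x * \<alpha> x - H x \<le> \<alpha>2 x"
    and \<beta>: "has_second_deriv \<beta> \<beta>2 UNIV" "\<And>x. \<beta>2 x \<le> K x * \<beta> x - H x"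
    and \<alpha>\<beta>: "\<And>x. \<alpha> x \<le> \<beta> x"
    and u: "continuous_on UNIV u" "\<And>x. real k \<le> \<bar>x\<bar> \<Longrightarrow> u x = \<beta> x"
      "has_second_deriv u u2 {-real k<..<real k}"
      "\<And>x. x \<in> {-real k<..<real k} \<Longrightarrow> u2 x \<le> K x * u x - H x"
  shows "\<exists>w. continuous_on UNIV w \<and> (\<forall>x. real (Suc k) \<le> \<bar>x\<bar> \<longrightarrow> w x = \<beta> x) \<and>
      (\<forall>x. \<alpha> x \<le> w x \<and> w x \<le> u x) \<and>
      has_second_deriv w (\<lambda>x. K x * w x - H x) {-real (Suc k)<..<real (Suc k)}"
proof -
  define R where "R = real (Suc k)"
  have R: "-R < R" "R > real k" by (auto simp: R_def)
  note c = has_second_deriv_continuous[OF \<alpha>(1)] has_second_deriv_continuous[OF \<beta>(1)]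
  obtain w where w: "continuous_on {-R..R} w" "w (-R) = \<beta> (-R)" "w R = \<beta> R"
    "has_second_deriv w (\<lambda>x. K x * w x - H x) {-R<..<R}"
    using linear_bvp[OF R(1) pos d1 d2 H] by metis
  have \<alpha>w: "\<alpha> x \<le> w x" if "x \<in> {-R..R}" for x
    by (rule comparison_principle[OF c(1) w(1) has_second_deriv_subset[OF \<alpha>(1)] w(4), where K=K])
      (use that w(2,3) \<alpha>\<beta> K \<alpha>(2) in \<open>auto simp: algebra_simps\<close>)
  have w\<beta>: "w x \<le> \<beta> x" if "x \<in> {-R..R}" for x
    by (rule comparison_principle[OF w(1) c(2) w(4) has_second_deriv_subset[OF \<beta>(1)], where K=K])
      (use that w(2,3) \<alpha>\<beta> K \<beta>(2) in \<open>auto simp: algebra_simps\<close>)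
  have wu: "w x \<le> u x" if "x \<in> {-R..R}" for x
  proof (cases "\<bar>x\<bar> \<le> real k")
    case True
    show ?thesis
    proof (rule comparison_principle[OF _ _ _ u(3), where K=K and u=w])
      show "continuous_on {-real k..real k} w" using w(1) by (rule continuous_on_subset) (use R in auto)
      show "continuous_on {-real k..real k} u" using u(1) by (rule continuous_on_subset) auto
      show "has_second_deriv w (\<lambda>x. K x * w x - H x) {-real k<..<real k}"
        using w(4) by (rule has_second_deriv_subset) (use R in auto)
      show "w (- real k) \<le> u (- real k)" "w (real k) \<le> u (real k)" using u(2) w\<beta> R by auto
    qed (use True K u(4) in \<open>auto simp: algebra_simps\<close>)
  next
    case False
    then show ?thesis using u(2)[of x] w\<beta>[OF that] by simp
  qed
  define v where "v x = (if \<bar>x\<bar> \<le> R then w x else \<beta> x)" for x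
  have "continuous_on ({-R..R} \<union> {x. \<bar>x\<bar> \<ge> R}) v"
    unfolding v_def
  proof (rule continuous_on_cases)
    show "closed {x. R \<le> \<bar>x\<bar>}" by (intro closed_Collect_le continuous_intros)
    show "\<forall>x. x \<in> {- R..R} \<and> \<not> \<bar>x\<bar> \<le> R \<or> x \<in> {x. R \<le> \<bar>x\<bar>} \<and> \<bar>x\<bar> \<le> R \<longrightarrow> w x = \<beta> x"
      using w(2,3) by (auto simp: abs_le_iff abs_if split: if_splits)
  qed (use w(1) c(2) in auto)
  moreover have "{-R..R} \<union> {x. \<bar>x\<bar> \<ge> R} = UNIV" by auto
  ultimately have "continuous_on UNIV v" by simp
  moreover have "v x = \<beta> x" if "R \<le> \<bar>x\<bar>" for x
    using that w(2,3) by (auto simp: v_def abs_if split: if_splits)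
  moreover have "\<alpha> x \<le> v x \<and> v x \<le> u x" for x
    using \<alpha>w[of x] wu[of x] \<alpha>\<beta>[of x] u(2)[of x] R by (auto simp: v_def abs_le_iff)
  moreover have "has_second_deriv v (\<lambda>x. K x * v x - H x) {-R<..<R}"
    by (rule has_second_deriv_cong[OF w(4)]) (auto simp: v_def)
  ultimately show ?thesis unfolding R_def by blast
qed

text \<open>\<open>K\<close> is so large that K u - F and K v - G are nondecreasing in (u, v) on the
  order interval. The iterates then decrease from (b1, b2) and remain supersolutions on growing
  intervals; their pointwise limit solves the system because the two terms with \<open>K\<close>
  cancel.\<close>

theorem sub_super_solution:
  fixes F G :: "real \<Rightarrow> real \<Rightarrow> real \<Rightarrow> real" and \<phi> \<phi>' K a1 a2 b1 b2 :: "real \<Rightarrow> real"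
  assumes pos: "\<And>x. \<phi> x > 0"
    and d1: "\<And>x. (\<phi> has_real_derivative \<phi>' x) (at x)"
    and d2: "\<And>x. (\<phi>' has_real_derivative K x * \<phi> x) (at x)"
    and K: "\<And>x. K x > 0" "continuous_on UNIV K"
    and contF: "continuous_on UNIV (\<lambda>(x, u, v). F x u v)"
    and contG: "continuous_on UNIV (\<lambda>(x, u, v). G x u v)"
    and ord: "\<And>x. a1 x \<le> b1 x" "\<And>x. a2 x \<le> b2 x"
    and monF: "\<And>x u1 u2 v1 v2. a1 x \<le> u1 \<Longrightarrow> u1 \<le> u2 \<Longrightarrow> u2 \<le> b1 x \<Longrightarrow>
       a2 x \<le> v1 \<Longrightarrow> v1 \<le> v2 \<Longrightarrow> v2 \<le> b2 x \<Longrightarrow> K x * u1 - F x u1 v1 \<le> K x * u2 - F x u2 v2"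
    and monG: "\<And>x u1 u2 v1 v2. a1 x \<le> u1 \<Longrightarrow> u1 \<le> u2 \<Longrightarrow> u2 \<le> b1 x \<Longrightarrow>
       a2 x \<le> v1 \<Longrightarrow> v1 \<le> v2 \<Longrightarrow> v2 \<le> b2 x \<Longrightarrow> K x * v1 - G x u1 v1 \<le> K x * v2 - G x u2 v2"
    and a1: "has_second_deriv a1 a1'' UNIV" "\<And>x. F x (a1 x) (a2 x) \<le> a1'' x"
    and a2: "has_second_deriv a2 a2'' UNIV" "\<And>x. G x (a1 x) (a2 x) \<le> a2'' x"
    and b1: "has_second_deriv b1 b1'' UNIV" "\<And>x. b1'' x \<le> F x (b1 x) (b2 x)"
    and b2: "has_second_deriv b2 b2'' UNIV" "\<And>x. b2'' x \<le> G x (b1 x) (b2 x)"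
  shows "\<exists>u v. (\<forall>x. a1 x \<le> u x \<and> u x \<le> b1 x \<and> a2 x \<le> v x \<and> v x \<le> b2 x) \<and>
      has_second_deriv u (\<lambda>x. F x (u x) (v x)) UNIV \<and> has_second_deriv v (\<lambda>x. G x (u x) (v x)) UNIV"
proof -
  have cF: "continuous_on S (\<lambda>x. F x (u x) (v x))" if "continuous_on S u" "continuous_on S v" for S u v
    using continuous_on_compose2[OF contF, of S "\<lambda>x. (x, u x, v x)"] that by (simp add: continuous_on_Pair continuous_on_id)
  have cG: "continuous_on S (\<lambda>x. G x (u x) (v x))" if "continuous_on S u" "continuous_on S v" for S u v
    using continuous_on_compose2[OF contG, of S "\<lambda>x. (x, u x, v x)"] that by (simp add: continuous_on_Pair continuous_on_id)
  have cb: "continuous_on S a1" "continuous_on S a2" "continuous_on S b1" "continuous_on S b2" for S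
    using has_second_deriv_continuous a1(1) a2(1) b1(1) b2(1) by blast+
  define box where "box = (\<lambda>(u::real\<Rightarrow>real, v::real\<Rightarrow>real). continuous_on UNIV u \<and> continuous_on UNIV v \<and>
     (\<forall>x. a1 x \<le> u x \<and> u x \<le> b1 x \<and> a2 x \<le> v x \<and> v x \<le> b2 x))"
  \<comment> \<open>State after step k: between the barriers, a supersolution inside (-k, k), equal
    to (b1, b2) outside. \<open>Q\<close> records the decrease and the linear equation that links
    consecutive iterates.\<close>
  define P where "P = (\<lambda>k::nat. \<lambda>(u, v). box (u, v) \<and> (\<forall>x. real k \<le> \<bar>x\<bar> \<longrightarrow> u x = b1 x \<and> v x = b2 x) \<and>
     (\<exists>u2. has_second_deriv u u2 {-real k<..<real k} \<and> (\<forall>x\<in>{-real k<..<real k}. u2 x \<le> F x (u x) (v x))) \<and>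
     (\<exists>v2. has_second_deriv v v2 {-real k<..<real k} \<and> (\<forall>x\<in>{-real k<..<real k}. v2 x \<le> G x (u x) (v x))))"
  define Q where "Q = (\<lambda>k::nat. \<lambda>(u, v) (u1, v1). (\<forall>x. u1 x \<le> u x \<and> v1 x \<le> v x) \<and>
     has_second_deriv u1 (\<lambda>x. K x * u1 x - (K x * u x - F x (u x) (v x))) {-real (Suc k)<..<real (Suc k)} \<and>
     has_second_deriv v1 (\<lambda>x. K x * v1 x - (K x * v x - G x (u x) (v x))) {-real (Suc k)<..<real (Suc k)})"
  \<comment> \<open>For k = 0 the interval (-k, k) is empty, so the differential inequalities hold
    vacuously for the start (b1, b2).\<close>
  have P0: "\<exists>z. P 0 z"
    by (rule exI[of _ "(b1, b2)"]) (auto simp: P_def box_def ord cb has_second_deriv_def)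
  have step: "\<exists>y. P (Suc k) y \<and> Q k z y" if Pz: "P k z" for k z
  proof -
    obtain u v where z: "z = (u, v)" by fastforce
    from Pz have cu: "continuous_on UNIV u" "continuous_on UNIV v"
      and bx: "\<And>x. a1 x \<le> u x" "\<And>x. u x \<le> b1 x" "\<And>x. a2 x \<le> v x" "\<And>x. v x \<le> b2 x"
      and out: "\<And>x. real k \<le> \<bar>x\<bar> \<Longrightarrow> u x = b1 x" "\<And>x. real k \<le> \<bar>x\<bar> \<Longrightarrow> v x = b2 x"
      by (auto simp: z P_def box_def)
    from Pz obtain u2 v2 where
      u2: "has_second_deriv u u2 {-real k<..<real k}" "\<And>x. x \<in> {-real k<..<real k} \<Longrightarrow> u2 x \<le> F x (u x) (v x)"
      and v2: "has_second_deriv v v2 {-real k<..<real k}" "\<And>x. x \<in> {-real k<..<real k} \<Longrightarrow> v2 x \<le> G x (u x) (v x)"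
      by (auto simp: z P_def)
    define H1 where "H1 x = K x * u x - F x (u x) (v x)" for x
    define H2 where "H2 x = K x * v x - G x (u x) (v x)" for x
    have cH: "continuous_on UNIV H1" "continuous_on UNIV H2"
      unfolding H1_def H2_def by (intro continuous_intros K cu cF cG)+
    have "\<exists>w. continuous_on UNIV w \<and> (\<forall>x. real (Suc k) \<le> \<bar>x\<bar> \<longrightarrow> w x = b1 x) \<and>
      (\<forall>x. a1 x \<le> w x \<and> w x \<le> u x) \<and>
      has_second_deriv w (\<lambda>x. K x * w x - H1 x) {-real (Suc k)<..<real (Suc k)}"
    proof (rule monotone_step[OF pos d1 d2 K(1) cH(1) a1(1) _ b1(1) _ ord(1) cu(1) out(1) u2(1)])
      fix x
      show "K x * a1 x - H1 x \<le> a1'' x"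
        using monF[of x "a1 x" "u x" "a2 x" "v x"] bx[of x] a1(2)[of x] by (simp add: H1_def)
      show "b1'' x \<le> K x * b1 x - H1 x"
        using monF[of x "u x" "b1 x" "v x" "b2 x"] bx[of x] b1(2)[of x] by (simp add: H1_def)
      show "u2 x \<le> K x * u x - H1 x" if "x \<in> {-real k<..<real k}" using u2(2)[OF that] by (simp add: H1_def)
    qed
    then obtain u1 where u1: "continuous_on UNIV u1" "\<And>x. real (Suc k) \<le> \<bar>x\<bar> \<Longrightarrow> u1 x = b1 x"
      "\<And>x. a1 x \<le> u1 x" "\<And>x. u1 x \<le> u x"
      "has_second_deriv u1 (\<lambda>x. K x * u1 x - H1 x) {-real (Suc k)<..<real (Suc k)}" by blast
    have "\<exists>w. continuous_on UNIV w \<and> (\<forall>x. real (Suc k) \<le> \<bar>x\<bar> \<longrightarrow> w x = b2 x) \<and>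
      (\<forall>x. a2 x \<le> w x \<and> w x \<le> v x) \<and>
      has_second_deriv w (\<lambda>x. K x * w x - H2 x) {-real (Suc k)<..<real (Suc k)}"
    proof (rule monotone_step[OF pos d1 d2 K(1) cH(2) a2(1) _ b2(1) _ ord(2) cu(2) out(2) v2(1)])
      fix x
      show "K x * a2 x - H2 x \<le> a2'' x"
        using monG[of x "a1 x" "u x" "a2 x" "v x"] bx[of x] a2(2)[of x] by (simp add: H2_def)
      show "b2'' x \<le> K x * b2 x - H2 x"
        using monG[of x "u x" "b1 x" "v x" "b2 x"] bx[of x] b2(2)[of x] by (simp add: H2_def)
      show "v2 x \<le> K x * v x - H2 x" if "x \<in> {-real k<..<real k}" using v2(2)[OF that] by (simp add: H2_def)
    qed
    then obtain v1 where v1: "continuous_on UNIV v1" "\<And>x. real (Suc k) \<le> \<bar>x\<bar> \<Longrightarrow> v1 x = b2 x"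
      "\<And>x. a2 x \<le> v1 x" "\<And>x. v1 x \<le> v x"
      "has_second_deriv v1 (\<lambda>x. K x * v1 x - H2 x) {-real (Suc k)<..<real (Suc k)}" by blast
    have bd: "u1 x \<le> b1 x" "v1 x \<le> b2 x" for x
      using u1(4)[of x] v1(4)[of x] bx[of x] by auto
    \<comment> \<open>The new iterate is again a supersolution: its second derivative is K u1 - H1,
      and monotonicity of K u - F bounds this by F at (u1, v1), because the iterate has
      decreased.\<close>
    have F1: "K x * u1 x - H1 x \<le> F x (u1 x) (v1 x)" for x
      using monF[of x "u1 x" "u x" "v1 x" "v x"] bx[of x] u1(3,4)[of x] v1(3,4)[of x] by (simp add: H1_def)
    have G1: "K x * v1 x - H2 x \<le> G x (u1 x) (v1 x)" for x
      using monG[of x "u1 x" "u x" "v1 x" "v x"] bx[of x] u1(3,4)[of x] v1(3,4)[of x] by (simp add: H2_def)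
    have "P (Suc k) (u1, v1)"
      unfolding P_def box_def using u1 v1 bd F1 G1 by blast
    moreover have "Q k z (u1, v1)"
      unfolding Q_def z using u1(4,5) v1(4,5) unfolding H1_def H2_def by simp
    ultimately show ?thesis by blast
  qed
  obtain z where z: "\<And>k. P k (z k)" "\<And>k. Q k (z k) (z (Suc k))"
    using dependent_nat_choice[of P Q, OF P0 step] by blast
  define u where "u k = fst (z k)" for k
  define v where "v k = snd (z k)" for k
  have zuv: "z k = (u k, v k)" for k by (simp add: u_def v_def)
  have cu: "continuous_on UNIV (u k)" "continuous_on UNIV (v k)"
    and bx: "a1 x \<le> u k x" "u k x \<le> b1 x" "a2 x \<le> v k x" "v k x \<le> b2 x" for k x
    using z(1)[of k] by (auto simp: P_def box_def zuv)
  have dec: "u (Suc k) x \<le> u k x" "v (Suc k) x \<le> v k x"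
    and du: "has_second_deriv (u (Suc k)) (\<lambda>x. K x * u (Suc k) x - (K x * u k x - F x (u k x) (v k x))) {-real (Suc k)<..<real (Suc k)}"
    and dv: "has_second_deriv (v (Suc k)) (\<lambda>x. K x * v (Suc k) x - (K x * v k x - G x (u k x) (v k x))) {-real (Suc k)<..<real (Suc k)}"
    for k x
    using z(2)[of k] by (auto simp: Q_def zuv)
  have "\<exists>l. (\<lambda>k. u k x) \<longlonglongrightarrow> l" for x
    by (rule decseq_convergent[of "\<lambda>k. u k x" "a1 x"]) (auto simp: decseq_Suc_iff dec bx)
  then obtain U where U: "\<And>x. (\<lambda>k. u k x) \<longlonglongrightarrow> U x" by metis
  have "\<exists>l. (\<lambda>k. v k x) \<longlonglongrightarrow> l" for x
    by (rule decseq_convergent[of "\<lambda>k. v k x" "a2 x"]) (auto simp: decseq_Suc_iff dec bx)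
  then obtain V where V: "\<And>x. (\<lambda>k. v k x) \<longlonglongrightarrow> V x" by metis
  have UV: "a1 x \<le> U x" "U x \<le> b1 x" "a2 x \<le> V x" "V x \<le> b2 x" for x
    using bx U V by (blast intro: LIMSEQ_le_const LIMSEQ_le_const2)+
  have loc: "has_second_deriv U (\<lambda>x. F x (U x) (V x)) {-real N<..<real N} \<and>
      has_second_deriv V (\<lambda>x. G x (U x) (V x)) {-real N<..<real N}" if N: "N > 0" for N :: nat
  proof -
    let ?I = "{-real N..real N}"
    have I: "-real N < real N" using N by simp
    have bdd: "\<exists>R. \<forall>x\<in>?I. \<bar>f x\<bar> \<le> R" if "continuous_on ?I f" for f :: "real \<Rightarrow> real"
    proof -
      have "compact (f ` ?I)" by (intro compact_continuous_image that) auto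
      then have "bounded (f ` ?I)" by (rule compact_imp_bounded)
      then show ?thesis by (auto simp: bounded_iff)
    qed
    obtain R1 R2 R3 R4 RK where R: "\<And>x. x \<in> ?I \<Longrightarrow> \<bar>a1 x\<bar> \<le> R1" "\<And>x. x \<in> ?I \<Longrightarrow> \<bar>a2 x\<bar> \<le> R2"
      "\<And>x. x \<in> ?I \<Longrightarrow> \<bar>b1 x\<bar> \<le> R3" "\<And>x. x \<in> ?I \<Longrightarrow> \<bar>b2 x\<bar> \<le> R4" "\<And>x. x \<in> ?I \<Longrightarrow> \<bar>K x\<bar> \<le> RK"
      using bdd[OF cb(1)] bdd[OF cb(2)] bdd[OF cb(3)] bdd[OF cb(4)] bdd[OF continuous_on_subset[OF K(2) subset_UNIV]]
      by metis
    define R where "R = Max {R1, R2, R3, R4, RK}"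
    have R': "R1 \<le> R" "R2 \<le> R" "R3 \<le> R" "R4 \<le> R" "RK \<le> R" unfolding R_def by auto
    have uR: "\<bar>u k x\<bar> \<le> R" "\<bar>v k x\<bar> \<le> R" "\<bar>K x\<bar> \<le> R" if "x \<in> ?I" for k x
      using R[OF that] R' bx[where x=x and k=k] by auto
    have bddF: "\<exists>M. \<forall>x u v. x \<in> ?I \<longrightarrow> \<bar>u\<bar> \<le> R \<longrightarrow> \<bar>v\<bar> \<le> R \<longrightarrow> \<bar>f x u v\<bar> \<le> M"
      if "continuous_on UNIV (\<lambda>(x, u, v). f x u v)" for f :: "real \<Rightarrow> real \<Rightarrow> real \<Rightarrow> real"
    proof -
      let ?C = "?I \<times> {-R..R} \<times> {-R..R}"
      have "compact ((\<lambda>(x, u, v). f x u v) ` ?C)"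
        by (intro compact_continuous_image continuous_on_subset[OF that] compact_Times) auto
      then have "bounded ((\<lambda>(x, u, v). f x u v) ` ?C)" by (rule compact_imp_bounded)
      then obtain M where "\<forall>y\<in>(\<lambda>(x, u, v). f x u v) ` ?C. norm y \<le> M" by (auto simp: bounded_iff)
      then show ?thesis by (intro exI[of _ M]) (force simp: abs_le_iff)
    qed
    obtain M1 M2 where M: "\<And>x u v. x \<in> ?I \<Longrightarrow> \<bar>u\<bar> \<le> R \<Longrightarrow> \<bar>v\<bar> \<le> R \<Longrightarrow> \<bar>F x u v\<bar> \<le> M1"
      "\<And>x u v. x \<in> ?I \<Longrightarrow> \<bar>u\<bar> \<le> R \<Longrightarrow> \<bar>v\<bar> \<le> R \<Longrightarrow> \<bar>G x u v\<bar> \<le> M2"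
      using bddF[OF contF] bddF[OF contG] by metis
    \<comment> \<open>The index is shifted by N so that all iterates considered solve their
      equations on the closed interval [-N, N].\<close>
    define hF where "hF j x = K x * u (Suc (j + N)) x - (K x * u (j + N) x - F x (u (j + N) x) (v (j + N) x))" for j x
    define hG where "hG j x = K x * v (Suc (j + N)) x - (K x * v (j + N) x - G x (u (j + N) x) (v (j + N) x))" for j x
    have sub: "?I \<subseteq> {-real (Suc (j + N))<..<real (Suc (j + N))}" for j by auto
    have dF: "has_second_deriv (u (Suc (j + N))) (hF j) ?I" for j
      unfolding hF_def by (rule has_second_deriv_subset[OF du sub])
    have dG: "has_second_deriv (v (Suc (j + N))) (hG j) ?I" for j
      unfolding hG_def by (rule has_second_deriv_subset[OF dv sub])
    have Kb: "\<bar>K x * y\<bar> \<le> R * R" if "x \<in> ?I" "\<bar>y\<bar> \<le> R" for x y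
      using uR(3)[OF that(1)] that(2) by (auto simp: abs_mult intro!: mult_mono)
    have bF: "\<bar>hF j x\<bar> \<le> R * R + R * R + M1" if "x \<in> ?I" for j x
      using Kb[OF that uR(1)[OF that, of "Suc (j + N)"]] Kb[OF that uR(1)[OF that, of "j + N"]]
        M(1)[OF that uR(1)[OF that, of "j + N"] uR(2)[OF that, of "j + N"]] unfolding hF_def by linarith
    have bG: "\<bar>hG j x\<bar> \<le> R * R + R * R + M2" if "x \<in> ?I" for j x
      using Kb[OF that uR(2)[OF that, of "Suc (j + N)"]] Kb[OF that uR(2)[OF that, of "j + N"]]
        M(2)[OF that uR(1)[OF that, of "j + N"] uR(2)[OF that, of "j + N"]] unfolding hG_def by linarith
    have sh: "(\<lambda>j. u (Suc (j + N)) x) \<longlonglongrightarrow> U x" "(\<lambda>j. v (Suc (j + N)) x) \<longlonglongrightarrow> V x"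
       "(\<lambda>j. u (j + N) x) \<longlonglongrightarrow> U x" "(\<lambda>j. v (j + N) x) \<longlonglongrightarrow> V x" for x
      using LIMSEQ_ignore_initial_segment[OF U[of x], of "Suc N"] LIMSEQ_ignore_initial_segment[OF V[of x], of "Suc N"]
        LIMSEQ_ignore_initial_segment[OF U[of x], of N] LIMSEQ_ignore_initial_segment[OF V[of x], of N] by simp_all
    have cU: "continuous_on ?I U" by (rule has_second_deriv_limit_continuous[OF I dF uR(1) bF sh(1)])
    have cV: "continuous_on ?I V" by (rule has_second_deriv_limit_continuous[OF I dG uR(2) bG sh(2)])
    have limc: "(\<lambda>j. f x (u (j + N) x) (v (j + N) x)) \<longlonglongrightarrow> f x (U x) (V x)"
      if "continuous_on UNIV (\<lambda>(x, u, v). f x u v)" for x and f :: "real \<Rightarrow> real \<Rightarrow> real \<Rightarrow> real"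
    proof -
      have "isCont (\<lambda>(x, u, v). f x u v) (x, U x, V x)"
        using that by (simp add: continuous_on_eq_continuous_at)
      moreover have "(\<lambda>j. (x, u (j + N) x, v (j + N) x)) \<longlonglongrightarrow> (x, U x, V x)"
        by (intro tendsto_Pair tendsto_const sh)
      ultimately show ?thesis using isCont_tendsto_compose by fastforce
    qed
    have hF: "(\<lambda>j. hF j x) \<longlonglongrightarrow> F x (U x) (V x)" for x
    proof -
      have "(\<lambda>j. hF j x) \<longlonglongrightarrow> K x * U x - (K x * U x - F x (U x) (V x))"
        unfolding hF_def by (intro tendsto_intros sh limc contF)
      then show ?thesis by simp
    qed
    have hG: "(\<lambda>j. hG j x) \<longlonglongrightarrow> G x (U x) (V x)" for x
    proof -
      have "(\<lambda>j. hG j x) \<longlonglongrightarrow> K x * V x - (K x * V x - G x (U x) (V x))"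
        unfolding hG_def by (intro tendsto_intros sh limc contG)
      then show ?thesis by simp
    qed
    have cu': "continuous_on S (u k)" "continuous_on S (v k)" "continuous_on S K" for S k
      using cu K(2) continuous_on_subset by blast+
    have ch: "continuous_on ?I (hF j)" "continuous_on ?I (hG j)" for j
      unfolding hF_def hG_def by (intro continuous_intros cF cG cu')+
    show ?thesis
      using has_second_deriv_limit[OF I dF ch(1) bF sh(1) hF cF[OF cU cV]]
        has_second_deriv_limit[OF I dG ch(2) bG sh(2) hG cG[OF cU cV]] by blast
  qed
  \<comment> \<open>The first derivatives found on the intervals (-N, N) all agree with
    \<open>deriv f\<close>, which therefore serves as one derivative on the whole line.\<close>
  have glob: "has_second_deriv f f2 UNIV" if lc: "\<And>N. N > 0 \<Longrightarrow> has_second_deriv f f2 {-real N<..<real N}" for f f2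
  proof (rule has_second_derivI[where w'="deriv f"])
    fix x :: real
    obtain N :: nat where N: "\<bar>x\<bar> < real N" using reals_Archimedean2 by blast
    let ?J = "{-real N<..<real N}"
    have N0: "N > 0" using N by (cases N) auto
    obtain g where g: "\<And>y. y \<in> ?J \<Longrightarrow> (f has_real_derivative g y) (at y)"
      "\<And>y. y \<in> ?J \<Longrightarrow> (g has_real_derivative f2 y) (at y)"
      using lc[OF N0] unfolding has_second_deriv_def by blast
    have eq: "g y = deriv f y" if "y \<in> ?J" for y using DERIV_imp_deriv[OF g(1)[OF that]] by simp
    have x: "x \<in> ?J" using N by auto
    show "(f has_real_derivative deriv f x) (at x)" using g(1)[OF x] eq[OF x] by simp
    show "(deriv f has_real_derivative f2 x) (at x)"
      by (rule has_field_derivative_transform_within_open[OF g(2)[OF x] _ x eq]) auto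
  qed
  show ?thesis
    using UV glob[of U] glob[of V] loc by blast
qed

section \<open>Sub- and supersolutions of the radial system\<close>

text \<open>In the variable \<open>x = ln r\<close> the radial equation reads \<open>p'' = reaction A B s t m x p q\<close>,
  where \<open>m = \<bar>n\<bar>\<close>.\<close>

definition reaction :: "real \<Rightarrow> real \<Rightarrow> real \<Rightarrow> real \<Rightarrow> real \<Rightarrow> real \<Rightarrow> real \<Rightarrow> real \<Rightarrow> real" where
  "reaction A B s t m x u v = (m\<^sup>2 + exp (2 * x) * (A * (u\<^sup>2 - s\<^sup>2) + B * (v\<^sup>2 - t\<^sup>2))) * u"

lemma continuous_on_reaction: "continuous_on UNIV (\<lambda>(x, u, v). reaction A B s t m x u v)"
  unfolding reaction_def case_prod_unfold by (intro continuous_intros)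

lemma continuous_on_reaction_swap: "continuous_on UNIV (\<lambda>(x, u, v). reaction A B s t m x v u)"
  unfolding reaction_def case_prod_unfold by (intro continuous_intros)

text \<open>Two effects are separated. In the first argument, with \<open>v1\<close> fixed, the
  reactions differ by c (u2 - u1) with c <= K. In the second only B v^2 counts, and the hypothesis
  on it is phrased to cover both v^2 increasing with B <= 0 and v^2 decreasing with B >= 0.\<close>

lemma reaction_mono:
  assumes u: "0 \<le> u1" "u1 \<le> u2" "u2 \<le> R" and v: "\<bar>v1\<bar> \<le> R" "B * v2\<^sup>2 \<le> B * v1\<^sup>2" and A: "A \<ge> 0"
    and K: "m\<^sup>2 + exp (2 * x) * (3 * A * R\<^sup>2 + \<bar>B\<bar> * (R\<^sup>2 + t\<^sup>2)) \<le> K"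
  shows "K * u1 - reaction A B s t m x u1 v1 \<le> K * u2 - reaction A B s t m x u2 v2"
proof -
  define c where "c = m\<^sup>2 + exp (2 * x) * (A * (u2\<^sup>2 + u1 * u2 + u1\<^sup>2) - A * s\<^sup>2 + B * (v1\<^sup>2 - t\<^sup>2))"
  have sq: "u2\<^sup>2 \<le> R\<^sup>2" "u1\<^sup>2 \<le> R\<^sup>2" "v1\<^sup>2 \<le> R\<^sup>2" "u1 * u2 \<le> R\<^sup>2"
    using u v by (auto intro: power_mono mult_mono simp: power2_eq_square abs_le_square_iff[of v1 R, unfolded power2_eq_square, symmetric])
  have "A * (u2\<^sup>2 + u1 * u2 + u1\<^sup>2) \<le> A * (3 * R\<^sup>2)"
    using sq A by (intro mult_left_mono) auto
  moreover have "B * (v1\<^sup>2 - t\<^sup>2) \<le> \<bar>B\<bar> * (R\<^sup>2 + t\<^sup>2)"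
  proof -
    have "B * (v1\<^sup>2 - t\<^sup>2) \<le> \<bar>B\<bar> * \<bar>v1\<^sup>2 - t\<^sup>2\<bar>" by (metis abs_ge_self abs_mult)
    also have "\<dots> \<le> \<bar>B\<bar> * (R\<^sup>2 + t\<^sup>2)" using sq by (intro mult_left_mono) (auto simp: abs_le_iff add_increasing)
    finally show ?thesis .
  qed
  moreover have "A * s\<^sup>2 \<ge> 0" using A by simp
  ultimately have "A * (u2\<^sup>2 + u1 * u2 + u1\<^sup>2) - A * s\<^sup>2 + B * (v1\<^sup>2 - t\<^sup>2) \<le> 3 * A * R\<^sup>2 + \<bar>B\<bar> * (R\<^sup>2 + t\<^sup>2)"
    by linarith
  then have "c \<le> K" unfolding c_def using K by (smt (verit) exp_gt_zero mult_left_mono)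
  then have "0 \<le> (K - c) * (u2 - u1)" using u by simp
  moreover have "exp (2 * x) * (B * v2\<^sup>2) * u2 \<le> exp (2 * x) * (B * v1\<^sup>2) * u2"
    by (rule mult_right_mono[OF mult_left_mono[OF v(2)]]) (use u in auto)
  moreover have "(K - c) * (u2 - u1) = K * u2 - K * u1 + reaction A B s t m x u1 v1 - reaction A B s t m x u2 v2
      + exp (2 * x) * (B * v2\<^sup>2) * u2 - exp (2 * x) * (B * v1\<^sup>2) * u2"
    unfolding c_def reaction_def by (simp add: algebra_simps power2_eq_square)
  ultimately show ?thesis by linarith
qed

lemma reaction_minus: "reaction A B s t m x (-u) v = - reaction A B s t m x u v"
  "reaction A B s t m x u (-v) = reaction A B s t m x u v"
  by (simp_all add: reaction_def)

text \<open>The reduction of order in \<open>linear_bvp\<close> wants an explicit positive solution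
  of \<phi>'' = K \<phi> with \<open>K\<close> as large as monotonicity requires. Choosing \<phi>
  first and reading off K = ((ln \<phi>)')^2 + (ln \<phi>)'' achieves both; the double exponential
  produces the growth exp (2x).\<close>

lemma exponential_weight:
  fixes \<kappa> \<gamma> :: real
  assumes "\<kappa> > 0" "\<gamma> > 0"
  shows "\<exists>\<phi> \<phi>' K. (\<forall>x. \<phi> x > 0) \<and> (\<forall>x. (\<phi> has_real_derivative \<phi>' x) (at x)) \<and>
    (\<forall>x. (\<phi>' has_real_derivative K x * \<phi> x) (at x)) \<and> (\<forall>x. K x > 0) \<and> continuous_on UNIV K \<and>
    (\<forall>x. \<kappa>\<^sup>2 + exp (2 * x) * \<gamma>\<^sup>2 \<le> K x)"
proof -
  define \<phi> where "\<phi> x = exp (\<kappa> * x + \<gamma> * exp x)" for x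
  define \<phi>' where "\<phi>' x = (\<kappa> + \<gamma> * exp x) * \<phi> x" for x
  define K where "K x = (\<kappa> + \<gamma> * exp x)\<^sup>2 + \<gamma> * exp x" for x
  have d1: "(\<phi> has_real_derivative \<phi>' x) (at x)" for x
    unfolding \<phi>_def[abs_def] \<phi>'_def by (auto intro!: derivative_eq_intros simp: \<phi>_def)
  have d2: "(\<phi>' has_real_derivative K x * \<phi> x) (at x)" for x
    unfolding \<phi>'_def[abs_def] K_def
    by (auto intro!: derivative_eq_intros d1 simp: \<phi>'_def algebra_simps power2_eq_square)
  have K: "\<kappa>\<^sup>2 + exp (2 * x) * \<gamma>\<^sup>2 \<le> K x" for x
  proof -
    have "exp (2 * x) = (exp x)\<^sup>2" by (simp add: exp_double)
    moreover have "0 \<le> 2 * \<kappa> * \<gamma> * exp x + \<gamma> * exp x" using assms by simp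
    ultimately show ?thesis by (simp add: K_def power2_sum power_mult_distrib algebra_simps)
  qed
  have "K x > 0" for x
  proof -
    have "\<kappa>\<^sup>2 > 0" "exp (2 * x) * \<gamma>\<^sup>2 > 0" using assms by auto
    then show ?thesis using K[of x] by linarith
  qed
  moreover have "continuous_on UNIV K" unfolding K_def by (intro continuous_intros)
  moreover have "\<phi> x > 0" for x by (simp add: \<phi>_def)
  ultimately show ?thesis using d1 d2 K by blast
qed

text \<open>One weight serves both equations. The summands 1 in \<gamma>^2 and in \<kappa> = m + n +
  1 keep both positive in degenerate cases such as m = n = 0.\<close>

lemma reaction_weight:
  fixes A A' B R m n s t :: real
  assumes A: "A > 0" "A' > 0" and mn: "m \<ge> 0" "n \<ge> 0"
  shows "\<exists>\<phi> \<phi>' K. (\<forall>x. \<phi> x > 0) \<and> (\<forall>x. (\<phi> has_real_derivative \<phi>' x) (at x)) \<and>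
    (\<forall>x. (\<phi>' has_real_derivative K x * \<phi> x) (at x)) \<and> (\<forall>x. K x > 0) \<and> continuous_on UNIV K \<and>
    (\<forall>x. m\<^sup>2 + exp (2 * x) * (3 * A * R\<^sup>2 + \<bar>B\<bar> * (R\<^sup>2 + t\<^sup>2)) \<le> K x) \<and>
    (\<forall>x. n\<^sup>2 + exp (2 * x) * (3 * A' * R\<^sup>2 + \<bar>B\<bar> * (R\<^sup>2 + s\<^sup>2)) \<le> K x)"
proof -
  define \<gamma> where "\<gamma> = sqrt (1 + 3 * A * R\<^sup>2 + 3 * A' * R\<^sup>2 + \<bar>B\<bar> * (R\<^sup>2 + t\<^sup>2) + \<bar>B\<bar> * (R\<^sup>2 + s\<^sup>2))"
  have g0: "0 \<le> 3 * A * R\<^sup>2" "0 \<le> 3 * A' * R\<^sup>2" "0 \<le> \<bar>B\<bar> * (R\<^sup>2 + t\<^sup>2)" "0 \<le> \<bar>B\<bar> * (R\<^sup>2 + s\<^sup>2)" using A by auto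
  have \<gamma>: "\<gamma> > 0" "\<gamma>\<^sup>2 = 1 + 3 * A * R\<^sup>2 + 3 * A' * R\<^sup>2 + \<bar>B\<bar> * (R\<^sup>2 + t\<^sup>2) + \<bar>B\<bar> * (R\<^sup>2 + s\<^sup>2)"
  proof -
    have "0 < 1 + 3 * A * R\<^sup>2 + 3 * A' * R\<^sup>2 + \<bar>B\<bar> * (R\<^sup>2 + t\<^sup>2) + \<bar>B\<bar> * (R\<^sup>2 + s\<^sup>2)"
      using g0 by linarith
    then show "\<gamma> > 0" "\<gamma>\<^sup>2 = 1 + 3 * A * R\<^sup>2 + 3 * A' * R\<^sup>2 + \<bar>B\<bar> * (R\<^sup>2 + t\<^sup>2) + \<bar>B\<bar> * (R\<^sup>2 + s\<^sup>2)"
      unfolding \<gamma>_def by auto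
  qed
  have \<kappa>: "m + n + 1 > 0" "m\<^sup>2 \<le> (m + n + 1)\<^sup>2" "n\<^sup>2 \<le> (m + n + 1)\<^sup>2" using mn by (auto intro: power_mono)
  obtain \<phi> \<phi>' K where w: "\<And>x. \<phi> x > 0" "\<And>x. (\<phi> has_real_derivative \<phi>' x) (at x)"
    "\<And>x. (\<phi>' has_real_derivative K x * \<phi> x) (at x)" "\<And>x. K x > 0" "continuous_on UNIV K"
    "\<And>x. (m + n + 1)\<^sup>2 + exp (2 * x) * \<gamma>\<^sup>2 \<le> K x"
    using exponential_weight[OF \<kappa>(1) \<gamma>(1)] by metis
  have K1: "m\<^sup>2 + exp (2 * x) * (3 * A * R\<^sup>2 + \<bar>B\<bar> * (R\<^sup>2 + t\<^sup>2)) \<le> K x" for x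
  proof -
    have "exp (2 * x) * (3 * A * R\<^sup>2 + \<bar>B\<bar> * (R\<^sup>2 + t\<^sup>2)) \<le> exp (2 * x) * \<gamma>\<^sup>2"
      using \<gamma>(2) g0 by (intro mult_left_mono) auto
    then show ?thesis using w(6)[of x] \<kappa>(2) by linarith
  qed
  have K2: "n\<^sup>2 + exp (2 * x) * (3 * A' * R\<^sup>2 + \<bar>B\<bar> * (R\<^sup>2 + s\<^sup>2)) \<le> K x" for x
  proof -
    have "exp (2 * x) * (3 * A' * R\<^sup>2 + \<bar>B\<bar> * (R\<^sup>2 + s\<^sup>2)) \<le> exp (2 * x) * \<gamma>\<^sup>2"
      using \<gamma>(2) g0 by (intro mult_left_mono) auto
    then show ?thesis using w(6)[of x] \<kappa>(3) by linarith
  qed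
  show ?thesis using w K1 K2 by blast
qed

text \<open>In the variable \<open>r = exp x\<close> the witness is \<open>\<epsilon> (r\<^sup>2 / (r\<^sup>2 + 1 / D)) powr (M / 2)\<close>.\<close>

lemma power_profile:
  fixes M D \<epsilon> :: real
  assumes M: "M \<ge> 0" and D: "D > 0" and \<epsilon>: "\<epsilon> > 0"
  shows "\<exists>\<psi> \<psi>2. has_second_deriv \<psi> \<psi>2 UNIV \<and> (\<forall>x. 0 < \<psi> x \<and> \<psi> x \<le> \<epsilon>) \<and>
    (\<forall>x. (M\<^sup>2 - (2 * M\<^sup>2 + 2 * M) * D * exp (2 * x)) * \<psi> x \<le> \<psi>2 x) \<and> (\<psi> \<longlongrightarrow> \<epsilon>) at_top"
proof -
  define \<psi> where "\<psi> x = \<epsilon> * exp (-(M / 2) * ln (1 + exp (-2 * x) / D))" for x :: real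
  \<comment> \<open>\<open>L\<close> is the logarithmic derivative of \<psi>, so that \<psi>'' =
    (L^2 + L') \<psi>; the exponent M is its limit at minus infinity.\<close>
  define L where "L x = M / (1 + D * exp (2 * x))" for x
  define L' where "L' x = - (2 * M * D * exp (2 * x)) / (1 + D * exp (2 * x))\<^sup>2" for x
  have pos: "1 + exp (-2 * x) / D > 0" "1 + D * exp (2 * x) > 0" for x :: real
    using D by (auto intro: add_pos_pos)
  have e: "exp (-2 * x) / D / (1 + exp (-2 * x) / D) = 1 / (1 + D * exp (2 * x))" for x :: real
    using D pos[of x] by (simp add: exp_minus field_simps)
  have "((\<lambda>x. ln (1 + exp (-2 * x) / D)) has_real_derivative
      (1 / (1 + exp (-2 * x) / D)) * (-2 * exp (-2 * x) / D)) (at x)" for x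
    by (rule derivative_eq_intros refl | use pos[of x] D in simp)+
  moreover have "(1 / (1 + exp (-2 * x) / D)) * (-2 * exp (-2 * x) / D) = -2 / (1 + D * exp (2 * x))" for x :: real
  proof -
    have "(1 / (1 + exp (-2 * x) / D)) * (-2 * exp (-2 * x) / D) = -2 * (exp (-2 * x) / D / (1 + exp (-2 * x) / D))"
      by simp
    then show ?thesis unfolding e by simp
  qed
  ultimately have dln: "((\<lambda>x. ln (1 + exp (-2 * x) / D)) has_real_derivative -2 / (1 + D * exp (2 * x))) (at x)" for x
    by metis
  have d1: "(\<psi> has_real_derivative L x * \<psi> x) (at x)" for x
  proof -
    have "(\<psi> has_real_derivative \<epsilon> * (exp (-(M / 2) * ln (1 + exp (-2 * x) / D)) * (-(M / 2) * (-2 / (1 + D * exp (2 * x)))))) (at x)"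
      unfolding \<psi>_def[abs_def] by (intro DERIV_cmult DERIV_fun_exp dln)
    then show ?thesis by (simp add: L_def \<psi>_def mult_ac)
  qed
  have dL: "(L has_real_derivative L' x) (at x)" for x
    unfolding L_def[abs_def] L'_def using pos(2)[of x]
    by (auto intro!: derivative_eq_intros simp: power2_eq_square)
  have d2: "((\<lambda>x. L x * \<psi> x) has_real_derivative ((L x)\<^sup>2 + L' x) * \<psi> x) (at x)" for x
    by (auto intro!: derivative_eq_intros d1 dL simp: algebra_simps power2_eq_square)
  have "has_second_deriv \<psi> (\<lambda>x. ((L x)\<^sup>2 + L' x) * \<psi> x) UNIV"
    by (rule has_second_derivI[where w'="\<lambda>x. L x * \<psi> x"]) (auto intro: d1 d2)
  moreover have p0: "\<psi> x > 0" for x using \<epsilon> by (simp add: \<psi>_def)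
  moreover have "\<psi> x \<le> \<epsilon>" for x
  proof -
    have "ln (1 + exp (-2 * x) / D) \<ge> 0" using D by simp
    then have "(M / 2) * ln (1 + exp (-2 * x) / D) \<ge> 0" using M by (intro mult_nonneg_nonneg) auto
    then show ?thesis using \<epsilon> by (simp add: \<psi>_def)
  qed
  moreover have "(M\<^sup>2 - (2 * M\<^sup>2 + 2 * M) * D * exp (2 * x)) * \<psi> x \<le> ((L x)\<^sup>2 + L' x) * \<psi> x" for x
  proof (rule mult_right_mono)
    \<comment> \<open>In terms of \<rho> the quotient \<psi>'' / \<psi> is (M^2 - 2 M \<rho>) / (1 +
      \<rho>)^2. The coefficient 2 M^2 + 2 M is taken so that, after multiplying out, the linear
      terms match and all higher ones have the right sign.\<close>
    define \<rho> where "\<rho> = D * exp (2 * x)"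
    have \<rho>: "\<rho> \<ge> 0" using D by (simp add: \<rho>_def)
    have "(M\<^sup>2 - (2 * M\<^sup>2 + 2 * M) * \<rho>) * (1 + \<rho>)\<^sup>2 = M\<^sup>2 - 2 * M * \<rho> - (3 * M\<^sup>2 * \<rho>\<^sup>2 + 2 * M\<^sup>2 * \<rho> ^ 3 + 2 * M * \<rho> * (2 * \<rho> + \<rho>\<^sup>2))"
      by (simp add: algebra_simps power2_eq_square power3_eq_cube)
    also have "\<dots> \<le> M\<^sup>2 - 2 * M * \<rho>"
    proof -
      have "0 \<le> 3 * M\<^sup>2 * \<rho>\<^sup>2 + 2 * M\<^sup>2 * \<rho> ^ 3 + 2 * M * \<rho> * (2 * \<rho> + \<rho>\<^sup>2)"
        using M \<rho> by (intro add_nonneg_nonneg mult_nonneg_nonneg) auto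
      then show ?thesis by linarith
    qed
    finally have "M\<^sup>2 - (2 * M\<^sup>2 + 2 * M) * \<rho> \<le> (M\<^sup>2 - 2 * M * \<rho>) / (1 + \<rho>)\<^sup>2"
      using \<rho> by (simp add: pos_le_divide_eq)
    also have "\<dots> = (L x)\<^sup>2 + L' x"
      unfolding L_def L'_def \<rho>_def by (simp add: power_divide diff_divide_distrib mult.assoc)
    finally show "M\<^sup>2 - (2 * M\<^sup>2 + 2 * M) * D * exp (2 * x) \<le> (L x)\<^sup>2 + L' x"
      by (simp add: \<rho>_def mult.assoc)
  qed (use p0[of x] in simp)
  moreover have "(\<psi> \<longlongrightarrow> \<epsilon>) at_top"
  proof -
    have "((\<lambda>x::real. exp (-2 * x)) \<longlongrightarrow> 0) at_top"
      by (intro filterlim_compose[OF exp_at_bot] filterlim_tendsto_neg_mult_at_bot[OF tendsto_const] filterlim_ident) auto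
    then have "(\<psi> \<longlongrightarrow> \<epsilon> * exp (-(M / 2) * ln (1 + 0 / D))) at_top"
      unfolding \<psi>_def[abs_def] using D by (intro tendsto_intros) auto
    then show ?thesis by simp
  qed
  ultimately show ?thesis by blast
qed

lemma has_second_deriv_const: "has_second_deriv (\<lambda>_. c) (\<lambda>_. 0) S"
  by (rule has_second_derivI[where w'="\<lambda>_. 0"]) auto

lemma has_second_deriv_minus:
  assumes "has_second_deriv w w2 S" shows "has_second_deriv (\<lambda>x. - w x) (\<lambda>x. - w2 x) S"
  using has_second_deriv_diff[OF has_second_deriv_const[of 0] assms] by simp

text \<open>The working class: the conditions at r = 0 and at infinity are relaxed to boundedness
  and a positive lower bound near plus infinity. The iteration yields membership, every radial
  solution belongs to it after x = ln r, and it is still small enough for uniqueness.\<close>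

definition profile_pair where
  "profile_pair A A' B s t m n p q \<longleftrightarrow>
     has_second_deriv p (\<lambda>x. reaction A B s t m x (p x) (q x)) UNIV \<and>
     has_second_deriv q (\<lambda>x. reaction A' B t s n x (q x) (p x)) UNIV \<and>
     (\<forall>x. p x > 0 \<and> q x > 0) \<and> (\<exists>C. \<forall>x. p x \<le> C \<and> q x \<le> C) \<and>
     (\<exists>c>0. \<forall>\<^sub>F x in at_top. c \<le> p x \<and> c \<le> q x)"

lemma profile_pair_commute: "profile_pair A A' B s t m n p q \<Longrightarrow> profile_pair A' A B t s n m q p"
  unfolding profile_pair_def by (auto simp: conj_commute)

lemma profile_pairI:
  assumes "has_second_deriv p (\<lambda>x. reaction A B s t m x (p x) (q x)) UNIV"
     "has_second_deriv q (\<lambda>x. reaction A' B t s n x (q x) (p x)) UNIV"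
     "\<And>x. 0 < \<psi> x" "\<And>x. \<psi> x \<le> p x" "\<And>x. p x \<le> C"  "\<And>x. 0 < \<psi>' x" "\<And>x. \<psi>' x \<le> q x" "\<And>x. q x \<le> C'"
     and lim: "(\<psi> \<longlongrightarrow> \<epsilon>) at_top" "(\<psi>' \<longlongrightarrow> \<epsilon>') at_top" "\<epsilon> > 0" "\<epsilon>' > 0"
  shows "profile_pair A A' B s t m n p q"
proof -
  have "\<forall>\<^sub>F x in at_top. \<psi> x > \<epsilon> / 2" "\<forall>\<^sub>F x in at_top. \<psi>' x > \<epsilon>' / 2"
    by (rule order_tendstoD(1)[OF lim(1)], use lim in simp) (rule order_tendstoD(1)[OF lim(2)], use lim in simp)
  then have "\<forall>\<^sub>F x in at_top. min (\<epsilon> / 2) (\<epsilon>' / 2) \<le> p x \<and> min (\<epsilon> / 2) (\<epsilon>' / 2) \<le> q x"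
  proof eventually_elim
    case (elim x)
    then show ?case using assms(4)[of x] assms(7)[of x] by auto
  qed
  moreover have "min (\<epsilon> / 2) (\<epsilon>' / 2) > 0" using lim by auto
  moreover have "p x > 0 \<and> q x > 0" for x using assms(3,4,6,7)[of x] by linarith
  moreover have "p x \<le> max C C' \<and> q x \<le> max C C'" for x using assms(5)[of x] assms(8)[of x] by auto
  ultimately show ?thesis unfolding profile_pair_def using assms(1,2) by blast
qed

text \<open>The system is cooperative in \<open>(p, - q)\<close>.\<close>

lemma exists_profile_pair_competitive:
  fixes A A' B s t m n :: real
  assumes A: "A > 0" "A' > 0" and st: "s > 0" "t > 0" and AB: "A * A' - B\<^sup>2 > 0" and B: "B \<ge> 0"
    and mn: "m \<ge> 0" "n \<ge> 0"
  shows "\<exists>p q. profile_pair A A' B s t m n p q"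
proof -
  \<comment> \<open>\<open>P\<close> solves A (P^2 - s^2) = B t^2. The bracket in the equation for p
    is then B q^2 >= 0 for every q, so the constant \<open>P\<close> is a supersolution.
    \<open>Q\<close> is its counterpart.\<close>
  define P where "P = sqrt (s\<^sup>2 + B / A * t\<^sup>2)"
  define Q where "Q = sqrt (t\<^sup>2 + B / A' * s\<^sup>2)"
  have nn: "B / A * t\<^sup>2 \<ge> 0" "B / A' * s\<^sup>2 \<ge> 0" using A B by auto
  have P2: "P\<^sup>2 = s\<^sup>2 + B / A * t\<^sup>2" and Q2: "Q\<^sup>2 = t\<^sup>2 + B / A' * s\<^sup>2"
    using nn by (auto simp: P_def Q_def)
  have P0: "P > 0" "Q > 0" using nn st by (auto simp: P_def Q_def intro: add_pos_nonneg)
  \<comment> \<open>At p = 0 and q = Q the bracket in the equation for p equals -c, and c > 0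
    because A A' > B^2. Half of c will pay for A p^2 with p <= \<epsilon>, the other half remains in
    the subsolution inequality.\<close>
  define c where "c = (A - B\<^sup>2 / A') * s\<^sup>2"
  define c' where "c' = (A' - B\<^sup>2 / A) * t\<^sup>2"
  have c: "c > 0" "c' > 0" using A AB st by (auto simp: c_def c'_def field_simps)
  have cle: "c / (2 * A) \<le> s\<^sup>2" "c' / (2 * A') \<le> t\<^sup>2"
    using A st by (auto simp: c_def c'_def field_simps mult_left_mono intro!: add_increasing)
  define \<epsilon> where "\<epsilon> = sqrt (c / (2 * A))"
  define \<epsilon>' where "\<epsilon>' = sqrt (c' / (2 * A'))"
  have \<epsilon>: "\<epsilon> > 0" "\<epsilon>' > 0" "\<epsilon>\<^sup>2 = c / (2 * A)" "\<epsilon>'\<^sup>2 = c' / (2 * A')" using c A by (auto simp: \<epsilon>_def \<epsilon>'_def)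
  have \<epsilon>P: "\<epsilon> \<le> P" "\<epsilon>' \<le> Q"
    using cle nn P0 \<epsilon> P2 Q2 by (auto intro: power2_le_imp_le)
  have prof: "\<exists>\<psi> \<psi>2. has_second_deriv \<psi> \<psi>2 UNIV \<and> (\<forall>x. 0 < \<psi> x \<and> \<psi> x \<le> \<epsilon>) \<and>
     (\<forall>x. (m\<^sup>2 - c / 2 * exp (2 * x)) * \<psi> x \<le> \<psi>2 x) \<and> (\<psi> \<longlongrightarrow> \<epsilon>) at_top"
    if h: "m \<ge> 0" "c > 0" "\<epsilon> > 0" for m c \<epsilon> :: real
  proof -
    define D where "D = c / 2 / (2 * m\<^sup>2 + 2 * m + 1)"
    have p: "2 * m\<^sup>2 + 2 * m + 1 > 0" using that by (auto intro: add_nonneg_pos)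
    then have D: "D > 0" using that by (simp add: D_def)
    have Dc: "(2 * m\<^sup>2 + 2 * m) * D \<le> c / 2" using p that(2) by (simp add: D_def field_simps)
    obtain \<psi> \<psi>2 where \<psi>: "has_second_deriv \<psi> \<psi>2 UNIV" "\<And>x. 0 < \<psi> x \<and> \<psi> x \<le> \<epsilon>"
      "\<And>x. (m\<^sup>2 - (2 * m\<^sup>2 + 2 * m) * D * exp (2 * x)) * \<psi> x \<le> \<psi>2 x" "(\<psi> \<longlongrightarrow> \<epsilon>) at_top"
      using power_profile[OF h(1) D h(3)] by blast
    have "(m\<^sup>2 - c / 2 * exp (2 * x)) * \<psi> x \<le> \<psi>2 x" for x
    proof -
      have "(m\<^sup>2 - c / 2 * exp (2 * x)) * \<psi> x \<le> (m\<^sup>2 - (2 * m\<^sup>2 + 2 * m) * D * exp (2 * x)) * \<psi> x"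
        using Dc \<psi>(2)[of x] by (intro mult_right_mono diff_left_mono) auto
      then show ?thesis using \<psi>(3)[of x] by linarith
    qed
    with \<psi> show ?thesis by blast
  qed
  obtain \<psi> \<psi>2 where \<psi>: "has_second_deriv \<psi> \<psi>2 UNIV" "\<And>x. 0 < \<psi> x" "\<And>x. \<psi> x \<le> \<epsilon>"
      "\<And>x. (m\<^sup>2 - c / 2 * exp (2 * x)) * \<psi> x \<le> \<psi>2 x" "(\<psi> \<longlongrightarrow> \<epsilon>) at_top"
    using prof[OF mn(1) c(1) \<epsilon>(1)] by blast
  obtain \<psi>' \<psi>2' where \<psi>': "has_second_deriv \<psi>' \<psi>2' UNIV" "\<And>x. 0 < \<psi>' x" "\<And>x. \<psi>' x \<le> \<epsilon>'"
      "\<And>x. (n\<^sup>2 - c' / 2 * exp (2 * x)) * \<psi>' x \<le> \<psi>2' x" "(\<psi>' \<longlongrightarrow> \<epsilon>') at_top"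
    using prof[OF mn(2) c(2) \<epsilon>(2)] by blast
  have sub: "reaction A B s t m x u v \<le> u2"
    if "0 < A" "0 < A'" "c = (A - B\<^sup>2 / A') * s\<^sup>2" "v\<^sup>2 = t\<^sup>2 + B / A' * s\<^sup>2" "0 < u" "u\<^sup>2 \<le> c / (2 * A)"
      "(m\<^sup>2 - c / 2 * exp (2 * x)) * u \<le> u2" for A A' c s t m x u v u2
  proof -
    have 1: "A * u\<^sup>2 \<le> c / 2" using that(1,6) by (simp add: field_simps)
    have 2: "A * s\<^sup>2 - B\<^sup>2 / A' * s\<^sup>2 = c" using that(3) by (simp add: algebra_simps)
    have 3: "B * (v\<^sup>2 - t\<^sup>2) = B\<^sup>2 / A' * s\<^sup>2" using that(4) by (simp add: power2_eq_square)
    have "A * (u\<^sup>2 - s\<^sup>2) + B * (v\<^sup>2 - t\<^sup>2) \<le> - (c / 2)"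
      using 1 2 3 by (simp add: algebra_simps)
    then have "exp (2 * x) * (A * (u\<^sup>2 - s\<^sup>2) + B * (v\<^sup>2 - t\<^sup>2)) \<le> exp (2 * x) * (- (c / 2))"
      by (intro mult_left_mono) auto
    then have "reaction A B s t m x u v \<le> (m\<^sup>2 - c / 2 * exp (2 * x)) * u"
      unfolding reaction_def using that(5) by (intro mult_right_mono) (auto simp: mult.commute)
    with that(7) show ?thesis by linarith
  qed
  have sup: "0 \<le> reaction A B s t m x u v"
    if "0 < A" "u\<^sup>2 = s\<^sup>2 + B / A * t\<^sup>2" "0 < u" for A s t m x u v
  proof -
    have "A * (u\<^sup>2 - s\<^sup>2) + B * (v\<^sup>2 - t\<^sup>2) = B * v\<^sup>2" using that by (simp add: algebra_simps)
    then show ?thesis unfolding reaction_def using that(3) B by simp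
  qed
  have sqle: "u\<^sup>2 \<le> a" if "0 < u" "u \<le> e" "e\<^sup>2 = a" for u e a :: real
    using power_mono[of u e 2] that by simp
  define R where "R = max P Q"
  have R: "P \<le> R" "Q \<le> R" "R > 0" using P0 by (auto simp: R_def)
  obtain \<phi> \<phi>' K where w: "\<And>x. \<phi> x > 0" "\<And>x. (\<phi> has_real_derivative \<phi>' x) (at x)"
    "\<And>x. (\<phi>' has_real_derivative K x * \<phi> x) (at x)" "\<And>x. K x > 0" "continuous_on UNIV K"
    and K1: "\<And>x. m\<^sup>2 + exp (2 * x) * (3 * A * R\<^sup>2 + \<bar>B\<bar> * (R\<^sup>2 + t\<^sup>2)) \<le> K x"
    and K2: "\<And>x. n\<^sup>2 + exp (2 * x) * (3 * A' * R\<^sup>2 + \<bar>B\<bar> * (R\<^sup>2 + s\<^sup>2)) \<le> K x"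
    using reaction_weight[of A A' m n R B t s] A mn by auto
  \<comment> \<open>The second unknown is v = -q, so the barriers of q change sign and trade
    places.\<close>
  have "\<exists>u v. (\<forall>x. \<psi> x \<le> u x \<and> u x \<le> P \<and> - Q \<le> v x \<and> v x \<le> - \<psi>' x) \<and>
      has_second_deriv u (\<lambda>x. reaction A B s t m x (u x) (v x)) UNIV \<and>
      has_second_deriv v (\<lambda>x. reaction A' B t s n x (v x) (u x)) UNIV"
  proof (rule sub_super_solution[OF w(1-5) continuous_on_reaction continuous_on_reaction_swap])
    fix x
    show "\<psi> x \<le> P" "- Q \<le> - \<psi>' x" using \<psi>(3)[of x] \<psi>'(3)[of x] \<epsilon>P by auto
    show "has_second_deriv \<psi> \<psi>2 UNIV" by (rule \<psi>(1))
    show "has_second_deriv (\<lambda>x. - \<psi>' x) (\<lambda>x. - \<psi>2' x) UNIV" by (rule has_second_deriv_minus[OF \<psi>'(1)])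
    show "has_second_deriv (\<lambda>_. P) (\<lambda>_. 0) UNIV" "has_second_deriv (\<lambda>_. - Q) (\<lambda>_. 0) UNIV"
      by (rule has_second_deriv_const)+
    show "reaction A B s t m x (\<psi> x) (- Q) \<le> \<psi>2 x"
      using sub[OF A c_def Q2 \<psi>(2)[of x] sqle[OF \<psi>(2,3) \<epsilon>(3)] \<psi>(4)[of x]] by (simp add: reaction_minus)
    show "reaction A' B t s n x (- Q) (\<psi> x) \<le> 0"
      using sup[OF A(2) Q2 P0(2)] by (simp add: reaction_minus)
    show "0 \<le> reaction A B s t m x P (- \<psi>' x)"
      using sup[OF A(1) P2 P0(1)] by (simp add: reaction_minus)
    show "- \<psi>2' x \<le> reaction A' B t s n x (- \<psi>' x) P"
      using sub[OF A(2,1) c'_def P2 \<psi>'(2)[of x] sqle[OF \<psi>'(2,3) \<epsilon>(4)] \<psi>'(4)[of x]] by (simp add: reaction_minus)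
  next
    fix x u1 u2 v1 v2
    assume *: "\<psi> x \<le> u1" "u1 \<le> u2" "u2 \<le> P" "- Q \<le> v1" "v1 \<le> v2" "v2 \<le> - \<psi>' x"
    have h: "0 < \<psi> x" "0 < \<psi>' x" by (rule \<psi>(2) \<psi>'(2))+
    have "v2\<^sup>2 \<le> v1\<^sup>2" using * h by (simp add: abs_le_square_iff[symmetric])
    then have "B * v2\<^sup>2 \<le> B * v1\<^sup>2" using B by (rule mult_left_mono)
    then show "K x * u1 - reaction A B s t m x u1 v1 \<le> K x * u2 - reaction A B s t m x u2 v2"
      using * h A R by (intro reaction_mono[OF _ _ _ _ _ _ K1]) auto
    have "u1\<^sup>2 \<le> u2\<^sup>2" using * h by (intro power_mono) auto
    then have "B * u1\<^sup>2 \<le> B * u2\<^sup>2" using B by (rule mult_left_mono)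
    then have "K x * (- v2) - reaction A' B t s n x (- v2) u2 \<le> K x * (- v1) - reaction A' B t s n x (- v1) u1"
      using * h A R by (intro reaction_mono[OF _ _ _ _ _ _ K2]) auto
    then show "K x * v1 - reaction A' B t s n x v1 u1 \<le> K x * v2 - reaction A' B t s n x v2 u2"
      by (simp add: reaction_minus)
  qed
  then obtain u v where uv: "\<And>x. \<psi> x \<le> u x" "\<And>x. u x \<le> P" "\<And>x. - Q \<le> v x" "\<And>x. v x \<le> - \<psi>' x"
      "has_second_deriv u (\<lambda>x. reaction A B s t m x (u x) (v x)) UNIV"
      "has_second_deriv v (\<lambda>x. reaction A' B t s n x (v x) (u x)) UNIV" by blast
  have "profile_pair A A' B s t m n u (\<lambda>x. - v x)"
  proof (rule profile_pairI[OF _ _ \<psi>(2) uv(1) uv(2) \<psi>'(2) _ _ \<psi>(5) \<psi>'(5) \<epsilon>(1,2)])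
    show "has_second_deriv u (\<lambda>x. reaction A B s t m x (u x) (- v x)) UNIV"
      using uv(5) by (simp add: reaction_minus)
    show "has_second_deriv (\<lambda>x. - v x) (\<lambda>x. reaction A' B t s n x (- v x) (u x)) UNIV"
      using has_second_deriv_minus[OF uv(6)] by (simp add: reaction_minus)
    show "\<psi>' x \<le> - v x" "- v x \<le> Q" for x using uv(3,4)[of x] by auto
  qed
  then show ?thesis by blast
qed

text \<open>The constants \<open>(s, t)\<close> are a supersolution. The subsolution for \<open>q\<close> ignores \<open>p\<close>, which is possible by
  \<open>dom\<close>; it helps \<open>p\<close> only for \<open>x \<ge> X\<close>, and a large exponent \<open>M\<close> makes up for it on \<open>x \<le> X\<close>.\<close>

lemma exists_profile_pair_cooperative:
  fixes A A' B s t m n :: real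
  assumes A: "A > 0" "A' > 0" and st: "s > 0" "t > 0" and AB: "A * A' - B\<^sup>2 > 0" and B: "B \<le> 0"
    and dom: "A' * t\<^sup>2 + B * s\<^sup>2 > 0" and mn: "m \<ge> 0" "n \<ge> 0"
  shows "\<exists>p q. profile_pair A A' B s t m n p q"
proof -
  \<comment> \<open>For q with p = 0 the bracket is A' q^2 - c', so a subsolution may let q^2 rise
    almost to c' / A'. At q^2 = c' / A' the bracket for p, taken at p = 0, is exactly -c.\<close>
  define c where "c = (A - B\<^sup>2 / A') * s\<^sup>2"
  define c' where "c' = A' * t\<^sup>2 + B * s\<^sup>2"
  have c: "c > 0" "c' > 0" using A AB st dom by (auto simp: c_def c'_def field_simps)
  \<comment> \<open>Room below c' / A': the first bound keeps \<epsilon>'^2 = c' / A' - \<eta>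
    positive, the second limits the loss 2 |B| \<eta> in the equation for p to c / 4. Writing 1 - B
    instead of -B covers B = 0.\<close>
  define \<eta> where "\<eta> = min (c' / (2 * A')) (c / (8 * (1 - B)))"
  have \<eta>: "\<eta> > 0" "\<eta> \<le> c' / (2 * A')" "\<eta> \<le> c / (8 * (1 - B))" using c A B by (auto simp: \<eta>_def)
  have \<eta>c: "- 2 * B * \<eta> \<le> c / 4"
  proof -
    have "- 2 * B * \<eta> \<le> 2 * (1 - B) * \<eta>" using \<eta>(1) by (simp add: algebra_simps)
    also have "\<dots> \<le> c / 4" using \<eta>(3) B by (simp add: field_simps)
    finally show ?thesis .
  qed
  define \<epsilon>' where "\<epsilon>' = sqrt (c' / A' - \<eta>)"
  have "c' / A' - \<eta> > 0"
    using \<eta>(2) divide_pos_pos[OF c(2) A(2)] by (simp add: field_simps)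
  then have \<epsilon>': "\<epsilon>' > 0" "\<epsilon>'\<^sup>2 = c' / A' - \<eta>" by (auto simp: \<epsilon>'_def)
  define \<epsilon> where "\<epsilon> = sqrt (c / (4 * A))"
  have \<epsilon>: "\<epsilon> > 0" "\<epsilon>\<^sup>2 = c / (4 * A)" using c A by (auto simp: \<epsilon>_def)
  have \<epsilon>s: "\<epsilon> \<le> s"
  proof (rule power2_le_imp_le)
    have "c \<le> A * s\<^sup>2" using A by (simp add: c_def mult_right_mono)
    also have "\<dots> \<le> s\<^sup>2 * (4 * A)" using A by simp
    finally show "\<epsilon>\<^sup>2 \<le> s\<^sup>2" using A unfolding \<epsilon>(2) by (simp add: pos_divide_le_eq)
  qed (use st in simp)
  have \<epsilon>t: "\<epsilon>' \<le> t"
  proof (rule power2_le_imp_le)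
    have "B * s\<^sup>2 \<le> 0" using B by (simp add: mult_nonpos_nonneg)
    then have "c' / A' \<le> t\<^sup>2" using A by (simp add: c'_def field_simps)
    then show "\<epsilon>'\<^sup>2 \<le> t\<^sup>2" using \<eta>(1) unfolding \<epsilon>'(2) by simp
  qed (use st in simp)
  define D' where "D' = A' * \<eta> / (2 * n\<^sup>2 + 2 * n + 1)"
  have p': "2 * n\<^sup>2 + 2 * n + 1 > 0" using mn by (auto intro: add_nonneg_pos)
  have D': "D' > 0" "(2 * n\<^sup>2 + 2 * n) * D' \<le> A' * \<eta>"
    using p' A \<eta>(1) by (auto simp: D'_def field_simps)
  obtain \<psi>' \<psi>2' where \<psi>': "has_second_deriv \<psi>' \<psi>2' UNIV" "\<And>x. 0 < \<psi>' x" "\<And>x. \<psi>' x \<le> \<epsilon>'"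
      "\<And>x. (n\<^sup>2 - (2 * n\<^sup>2 + 2 * n) * D' * exp (2 * x)) * \<psi>' x \<le> \<psi>2' x" "(\<psi>' \<longlongrightarrow> \<epsilon>') at_top"
    using power_profile[OF mn(2) D'(1) \<epsilon>'(1)] by blast
  have "((\<lambda>x. (\<psi>' x)\<^sup>2) \<longlongrightarrow> \<epsilon>'\<^sup>2) at_top" by (intro tendsto_intros \<psi>'(5))
  then have "\<forall>\<^sub>F x in at_top. (\<psi>' x)\<^sup>2 > \<epsilon>'\<^sup>2 - \<eta>" by (rule order_tendstoD(1)) (use \<eta> in simp)
  then obtain X where X: "\<And>x. x \<ge> X \<Longrightarrow> (\<psi>' x)\<^sup>2 > \<epsilon>'\<^sup>2 - \<eta>" by (auto simp: eventually_at_top_linorder)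
  \<comment> \<open>On x <= X the subsolution for q may be small, but exp (2x) times the bracket for
    p is at most \<open>k\<close>. The exponent satisfies M^2 >= m^2 + k + 1, with a spare 1 for the
    loss term, which the second bound in \<open>D\<close> keeps at most 1 there; the first bound in
    \<open>D\<close> serves x >= X.\<close>
  define k where "k = exp (2 * X) * (- B * t\<^sup>2)"
  have k: "k \<ge> 0" using B by (simp add: k_def mult_nonneg_nonpos mult_nonpos_nonneg)
  define M where "M = 1 + m + k"
  have M0: "M \<ge> 0" using mn k by (simp add: M_def)
  have M: "m\<^sup>2 + k + 1 \<le> M\<^sup>2"
  proof -
    have "M\<^sup>2 = 1 + m\<^sup>2 + k\<^sup>2 + 2 * m + 2 * k + 2 * m * k" by (simp add: M_def power2_eq_square algebra_simps)
    moreover have "0 \<le> 2 * m * k" "0 \<le> k\<^sup>2" using mn k by auto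
    ultimately show ?thesis using mn k by linarith
  qed
  define D where "D = min (c / 2) (exp (- 2 * X)) / (2 * M\<^sup>2 + 2 * M + 1)"
  have p: "2 * M\<^sup>2 + 2 * M + 1 > 0" using M0 by (auto intro: add_nonneg_pos)
  have D0: "D > 0" using p c by (simp add: D_def)
  have "(2 * M\<^sup>2 + 2 * M) * D \<le> (2 * M\<^sup>2 + 2 * M + 1) * D" using D0 by (simp add: algebra_simps)
  also have "\<dots> = min (c / 2) (exp (- 2 * X))" using p by (simp add: D_def)
  finally have D: "(2 * M\<^sup>2 + 2 * M) * D \<le> c / 2" "(2 * M\<^sup>2 + 2 * M) * D \<le> exp (- 2 * X)" by auto
  obtain \<psi> \<psi>2 where \<psi>: "has_second_deriv \<psi> \<psi>2 UNIV" "\<And>x. 0 < \<psi> x" "\<And>x. \<psi> x \<le> \<epsilon>"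
      "\<And>x. (M\<^sup>2 - (2 * M\<^sup>2 + 2 * M) * D * exp (2 * x)) * \<psi> x \<le> \<psi>2 x" "(\<psi> \<longlongrightarrow> \<epsilon>) at_top"
    using power_profile[OF M0 D0 \<epsilon>(1)] by blast
  have sub2: "reaction A' B t s n x (\<psi>' x) (\<psi> x) \<le> \<psi>2' x" for x
  proof -
    have "(\<psi>' x)\<^sup>2 \<le> \<epsilon>'\<^sup>2" using \<psi>'(2,3)[of x] by (intro power_mono) auto
    then have "A' * (\<psi>' x)\<^sup>2 \<le> A' * (c' / A' - \<eta>)" unfolding \<epsilon>'(2) using A by (intro mult_left_mono) auto
    also have "\<dots> = c' - A' * \<eta>" using A by (simp add: algebra_simps)
    finally have 1: "A' * (\<psi>' x)\<^sup>2 \<le> c' - A' * \<eta>" .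
    have "B * (\<psi> x)\<^sup>2 \<le> 0" using B by (simp add: mult_nonpos_nonneg)
    then have "A' * ((\<psi>' x)\<^sup>2 - t\<^sup>2) + B * ((\<psi> x)\<^sup>2 - s\<^sup>2) \<le> - (A' * \<eta>)"
      using 1 unfolding c'_def by (simp add: algebra_simps)
    also have "\<dots> \<le> - ((2 * n\<^sup>2 + 2 * n) * D')" using D'(2) by simp
    finally have "exp (2 * x) * (A' * ((\<psi>' x)\<^sup>2 - t\<^sup>2) + B * ((\<psi> x)\<^sup>2 - s\<^sup>2)) \<le> exp (2 * x) * - ((2 * n\<^sup>2 + 2 * n) * D')"
      by (rule mult_left_mono) simp
    then have "reaction A' B t s n x (\<psi>' x) (\<psi> x) \<le> (n\<^sup>2 - (2 * n\<^sup>2 + 2 * n) * D' * exp (2 * x)) * \<psi>' x"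
      unfolding reaction_def using \<psi>'(2)[of x] by (intro mult_right_mono) (auto simp: mult_ac)
    then show ?thesis using \<psi>'(4)[of x] by linarith
  qed
  have sub1: "reaction A B s t m x (\<psi> x) (\<psi>' x) \<le> \<psi>2 x" for x
  proof -
    have "(\<psi> x)\<^sup>2 \<le> \<epsilon>\<^sup>2" using \<psi>(2,3)[of x] by (intro power_mono) auto
    then have "A * (\<psi> x)\<^sup>2 \<le> A * (c / (4 * A))" unfolding \<epsilon>(2) using A by (intro mult_left_mono) auto
    also have "\<dots> = c / 4" using A by simp
    finally have 1: "A * (\<psi> x)\<^sup>2 \<le> c / 4" .
    have c2: "c = A * s\<^sup>2 - B\<^sup>2 / A' * s\<^sup>2" by (simp add: c_def algebra_simps)
    let ?V = "A * ((\<psi> x)\<^sup>2 - s\<^sup>2) + B * ((\<psi>' x)\<^sup>2 - t\<^sup>2)"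
    have "m\<^sup>2 + exp (2 * x) * ?V \<le> M\<^sup>2 - (2 * M\<^sup>2 + 2 * M) * D * exp (2 * x)"
    proof (cases "x \<ge> X")
      case True
      have "B * ((\<psi>' x)\<^sup>2 - t\<^sup>2) \<le> B * (\<epsilon>'\<^sup>2 - \<eta> - t\<^sup>2)"
        using X[OF True] B by (intro mult_left_mono_neg) auto
      also have "\<dots> = B\<^sup>2 / A' * s\<^sup>2 - 2 * B * \<eta>"
        using A unfolding \<epsilon>'(2) c'_def by (simp add: field_simps power2_eq_square)
      finally have "?V \<le> - (c / 2)" using 1 \<eta>c c2 by (simp add: algebra_simps)
      also have "\<dots> \<le> - ((2 * M\<^sup>2 + 2 * M) * D)" using D by simp
      finally have "exp (2 * x) * ?V \<le> exp (2 * x) * - ((2 * M\<^sup>2 + 2 * M) * D)" by (rule mult_left_mono) simp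
      then show ?thesis using M k by (simp add: mult_ac)
    next
      case False
      have "B * (\<psi>' x)\<^sup>2 \<le> 0" using B by (simp add: mult_nonpos_nonneg)
      moreover have "c / 4 \<le> A * s\<^sup>2"
      proof -
        have "B\<^sup>2 / A' * s\<^sup>2 \<ge> 0" using A by simp
        then show ?thesis using c2 c(1) by linarith
      qed
      ultimately have "?V \<le> - B * t\<^sup>2" using 1 by (simp add: algebra_simps)
      then have "exp (2 * x) * ?V \<le> exp (2 * x) * (- B * t\<^sup>2)" by (rule mult_left_mono) simp
      also have "\<dots> \<le> k" unfolding k_def using False B by (intro mult_right_mono) (auto simp: mult_nonpos_nonneg)
      finally have 2: "exp (2 * x) * ?V \<le> k" .
      have "(2 * M\<^sup>2 + 2 * M) * D * exp (2 * x) \<le> exp (- 2 * X) * exp (2 * X)"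
        using D(2) False M0 D0 by (intro mult_mono) auto
      also have "\<dots> = 1" by (simp add: exp_minus)
      finally show ?thesis using 2 M by linarith
    qed
    then have "reaction A B s t m x (\<psi> x) (\<psi>' x) \<le> (M\<^sup>2 - (2 * M\<^sup>2 + 2 * M) * D * exp (2 * x)) * \<psi> x"
      unfolding reaction_def using \<psi>(2)[of x] by (intro mult_right_mono) auto
    then show ?thesis using \<psi>(4)[of x] by linarith
  qed
  define R where "R = max s t"
  have R: "s \<le> R" "t \<le> R" "R > 0" using st by (auto simp: R_def)
  obtain \<phi> \<phi>' K where w: "\<And>x. \<phi> x > 0" "\<And>x. (\<phi> has_real_derivative \<phi>' x) (at x)"
    "\<And>x. (\<phi>' has_real_derivative K x * \<phi> x) (at x)" "\<And>x. K x > 0" "continuous_on UNIV K"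
    and K1: "\<And>x. m\<^sup>2 + exp (2 * x) * (3 * A * R\<^sup>2 + \<bar>B\<bar> * (R\<^sup>2 + t\<^sup>2)) \<le> K x"
    and K2: "\<And>x. n\<^sup>2 + exp (2 * x) * (3 * A' * R\<^sup>2 + \<bar>B\<bar> * (R\<^sup>2 + s\<^sup>2)) \<le> K x"
    using reaction_weight[of A A' m n R B t s] A mn by auto
  have "\<exists>u v. (\<forall>x. \<psi> x \<le> u x \<and> u x \<le> s \<and> \<psi>' x \<le> v x \<and> v x \<le> t) \<and>
      has_second_deriv u (\<lambda>x. reaction A B s t m x (u x) (v x)) UNIV \<and>
      has_second_deriv v (\<lambda>x. reaction A' B t s n x (v x) (u x)) UNIV"
  proof (rule sub_super_solution[OF w(1-5) continuous_on_reaction continuous_on_reaction_swap])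
    fix x
    show "\<psi> x \<le> s" "\<psi>' x \<le> t" using \<psi>(3)[of x] \<psi>'(3)[of x] \<epsilon>s \<epsilon>t by auto
    show "has_second_deriv \<psi> \<psi>2 UNIV" "has_second_deriv \<psi>' \<psi>2' UNIV" by (rule \<psi>(1) \<psi>'(1))+
    show "has_second_deriv (\<lambda>_. s) (\<lambda>_. 0) UNIV" "has_second_deriv (\<lambda>_. t) (\<lambda>_. 0) UNIV"
      by (rule has_second_deriv_const)+
    show "reaction A B s t m x (\<psi> x) (\<psi>' x) \<le> \<psi>2 x" "reaction A' B t s n x (\<psi>' x) (\<psi> x) \<le> \<psi>2' x"
      by (rule sub1 sub2)+
    show "0 \<le> reaction A B s t m x s t" "0 \<le> reaction A' B t s n x t s"
      using st by (auto simp: reaction_def)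
  next
    fix x u1 u2 v1 v2
    assume *: "\<psi> x \<le> u1" "u1 \<le> u2" "u2 \<le> s" "\<psi>' x \<le> v1" "v1 \<le> v2" "v2 \<le> t"
    have h: "0 < \<psi> x" "0 < \<psi>' x" by (rule \<psi>(2) \<psi>'(2))+
    have "v1\<^sup>2 \<le> v2\<^sup>2" using * h by (intro power_mono) auto
    then have "B * v2\<^sup>2 \<le> B * v1\<^sup>2" using B by (rule mult_left_mono_neg)
    then show "K x * u1 - reaction A B s t m x u1 v1 \<le> K x * u2 - reaction A B s t m x u2 v2"
      using * h A R by (intro reaction_mono[OF _ _ _ _ _ _ K1]) auto
    have "u1\<^sup>2 \<le> u2\<^sup>2" using * h by (intro power_mono) auto
    then have "B * u2\<^sup>2 \<le> B * u1\<^sup>2" using B by (rule mult_left_mono_neg)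
    then show "K x * v1 - reaction A' B t s n x v1 u1 \<le> K x * v2 - reaction A' B t s n x v2 u2"
      using * h A R by (intro reaction_mono[OF _ _ _ _ _ _ K2]) auto
  qed
  then obtain u v where uv: "\<And>x. \<psi> x \<le> u x" "\<And>x. u x \<le> s" "\<And>x. \<psi>' x \<le> v x" "\<And>x. v x \<le> t"
      "has_second_deriv u (\<lambda>x. reaction A B s t m x (u x) (v x)) UNIV"
      "has_second_deriv v (\<lambda>x. reaction A' B t s n x (v x) (u x)) UNIV" by blast
  have "profile_pair A A' B s t m n u v"
    by (rule profile_pairI[OF uv(5,6) \<psi>(2) uv(1,2) \<psi>'(2) uv(3,4) \<psi>(5) \<psi>'(5) \<epsilon>(1) \<epsilon>'(1)])
  then show ?thesis by blast
qed

text \<open>For B <= 0 at least one component has a subsolution that ignores the other: if both A'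
  t^2 + B s^2 and A s^2 + B t^2 were nonpositive, multiplying the two inequalities would contradict
  A A' > B^2.\<close>

theorem exists_profile_pair:
  fixes A A' B s t m n :: real
  assumes A: "A > 0" "A' > 0" and st: "s > 0" "t > 0" and AB: "A * A' - B\<^sup>2 > 0"
    and mn: "m \<ge> 0" "n \<ge> 0"
  shows "\<exists>p q. profile_pair A A' B s t m n p q"
proof -
  consider "B \<ge> 0" | "B \<le> 0" "A' * t\<^sup>2 + B * s\<^sup>2 > 0" | "B \<le> 0" "A * s\<^sup>2 + B * t\<^sup>2 > 0"
  proof (cases "B \<ge> 0 \<or> A' * t\<^sup>2 + B * s\<^sup>2 > 0 \<or> A * s\<^sup>2 + B * t\<^sup>2 > 0")
    case True
    then show ?thesis using that by linarith
  next
    case False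
    then have h: "A' * t\<^sup>2 \<le> - B * s\<^sup>2" "A * s\<^sup>2 \<le> - B * t\<^sup>2" "B \<le> 0" by auto
    then have "(A' * t\<^sup>2) * (A * s\<^sup>2) \<le> (- B * s\<^sup>2) * (- B * t\<^sup>2)"
      using A h(3) by (intro mult_mono[OF h(1,2)]) (auto simp: mult_nonpos_nonneg)
    then have "(A * A' - B\<^sup>2) * (s\<^sup>2 * t\<^sup>2) \<le> 0" by (simp add: algebra_simps power2_eq_square)
    moreover have "(A * A' - B\<^sup>2) * (s\<^sup>2 * t\<^sup>2) > 0" using AB st by simp
    ultimately show ?thesis by simp
  qed
  then show ?thesis
  proof cases
    case 1
    show ?thesis by (rule exists_profile_pair_competitive[OF A st AB 1 mn])
  next
    case 2
    show ?thesis by (rule exists_profile_pair_cooperative[OF A st AB 2 mn])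
  next
    case 3
    have "A' * A - B\<^sup>2 > 0" using AB by (simp add: mult.commute)
    from exists_profile_pair_cooperative[OF A(2,1) st(2,1) this 3 mn(2,1)]
    show ?thesis using profile_pair_commute by blast
  qed
qed

section \<open>Decay at infinity\<close>

text \<open>No interior maximum of \<open>\<sigma> (p\<^sup>2 - s\<^sup>2) / \<nu>\<close> minus the barrier is possible: at such a point \<open>p'\<^sup>2\<close> is controlled by
  the derivative of the barrier. The term \<open>\<epsilon> e\<^sup>x\<close> compensates for the missing boundary condition at \<open>+\<infinity>\<close>.\<close>

lemma barrier_contact:
  fixes p p' q :: "real \<Rightarrow> real" and \<sigma> :: real
  assumes p: "\<And>z. X < z \<Longrightarrow> z < Y \<Longrightarrow> (p has_real_derivative p' z) (at z)"
    and p': "\<And>z. X < z \<Longrightarrow> z < Y \<Longrightarrow> (p' has_real_derivative reaction A B s t m z (p z) (q z)) (at z)"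
    and x: "X < x" "x < Y" and \<sigma>: "\<sigma> = 1 \<or> \<sigma> = -1" and lam: "\<nu> > 0" "\<mu> > 0"
    and pc: "0 < c" "c \<le> p x" "p x \<le> C" and k: "k = A * \<nu> - \<bar>B\<bar> * \<mu>" "k > 0" and A: "A > 0"
    and mx: "\<And>z. X < z \<Longrightarrow> z < Y \<Longrightarrow> \<sigma> * ((p z)\<^sup>2 - s\<^sup>2) / \<nu> - (K * exp (-2 * z) + \<epsilon> * exp z)
        \<le> \<sigma> * ((p x)\<^sup>2 - s\<^sup>2) / \<nu> - (K * exp (-2 * x) + \<epsilon> * exp x)"
    and dom: "\<bar>(q x)\<^sup>2 - t\<^sup>2\<bar> / \<mu> \<le> \<sigma> * ((p x)\<^sup>2 - s\<^sup>2) / \<nu>"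
    and big: "K * exp (-2 * x) + \<epsilon> * exp x < \<sigma> * ((p x)\<^sup>2 - s\<^sup>2) / \<nu>"
    and K: "K > 0" "\<epsilon> \<ge> 0"
    and h1: "2 * \<nu>\<^sup>2 / c\<^sup>2 * (exp (-4 * x) * K + \<epsilon> * exp (- x)) + 4 * \<nu> * exp (-2 * x) \<le> c\<^sup>2 * k"
    and h2: "2 * m\<^sup>2 * C\<^sup>2 < c\<^sup>2 * k * K"
  shows False
proof -
  define g where "g = reaction A B s t m x (p x) (q x)"
  define P where "P = (p x)\<^sup>2"
  define M where "M = K * exp (-2 * x) + \<epsilon> * exp x"
  define M' where "M' = -2 * K * exp (-2 * x) + \<epsilon> * exp x"
  define \<zeta> where "\<zeta> = \<sigma> * (P - s\<^sup>2) / \<nu>"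
  \<comment> \<open>\<open>N\<close> is exp (2x) times the barrier \<open>M\<close>. Since the
    bracket in the reaction carries the factor exp (2x), all terms will be compared with
    \<open>N\<close>, which is at least \<open>K\<close>.\<close>
  define N where "N = K + \<epsilon> * exp (3 * x)"
  define w where "w z = \<sigma> * ((p z)\<^sup>2 - s\<^sup>2) / \<nu> - (K * exp (-2 * z) + \<epsilon> * exp z)" for z
  define w' where "w' z = \<sigma> * (2 * p z * p' z) / \<nu> - (-2 * K * exp (-2 * z) + \<epsilon> * exp z)" for z
  have dw: "(w has_real_derivative w' z) (at z)" if "X < z" "z < Y" for z
    unfolding w_def[abs_def] w'_def using lam
    by (auto intro!: derivative_eq_intros p[OF that] simp: field_simps)
  have dw': "(w' has_real_derivative (\<sigma> * (2 * (p' x)\<^sup>2 + 2 * p x * g) / \<nu> - (4 * K * exp (-2 * x) + \<epsilon> * exp x))) (at x)"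
    unfolding w'_def[abs_def] g_def using lam
    by (auto intro!: derivative_eq_intros p[OF x] p'[OF x] simp: field_simps power2_eq_square)
  have max: "w z \<le> w x" if "X < z" "z < Y" for z using mx[OF that] unfolding w_def .
  note c = interior_max_derivs[OF x dw dw' max]
  have pos: "p x > 0" using pc by linarith
  have P0: "P > 0" "c\<^sup>2 \<le> P" "P \<le> C\<^sup>2" using pc pos by (auto simp: P_def intro: power_mono)
  \<comment> \<open>The first-order condition at the maximum expresses p' through the derivative
    \<open>M'\<close> of the barrier; squaring it removes the sign \<sigma>.\<close>
  have first: "\<sigma> * (2 * p x * p' x) = \<nu> * M'"
    using c(1) lam unfolding w'_def M'_def by (simp add: field_simps)
  have s2: "\<sigma>\<^sup>2 = 1" "\<bar>\<sigma>\<bar> = 1" using \<sigma> by auto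
  have "4 * P * (p' x)\<^sup>2 = \<sigma>\<^sup>2 * (2 * p x * p' x)\<^sup>2" using s2 by (simp add: P_def power2_eq_square)
  also have "\<dots> = \<nu>\<^sup>2 * M'\<^sup>2" using first by (metis power_mult_distrib)
  finally have p'2: "4 * P * (p' x)\<^sup>2 = \<nu>\<^sup>2 * M'\<^sup>2" .
  have MN: "M = exp (-2 * x) * N"
    unfolding M_def N_def by (simp add: algebra_simps flip: exp_add)
  have N0: "N \<ge> K" "N > 0" using K by (auto simp: N_def intro: add_pos_nonneg)
  have M'M: "M'\<^sup>2 \<le> 4 * M\<^sup>2"
  proof -
    define a where "a = \<epsilon> * exp x"
    define b where "b = K * exp (-2 * x)"
    have "0 \<le> a" "0 \<le> b" using K by (auto simp: a_def b_def)
    moreover have "M' = a - 2 * b" "M = b + a" by (simp_all add: M_def M'_def a_def b_def)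
    ultimately have "\<bar>M'\<bar> \<le> 2 * M" by linarith
    then have "\<bar>M'\<bar>\<^sup>2 \<le> (2 * M)\<^sup>2" by (intro power_mono) auto
    then show ?thesis by (simp add: power_mult_distrib)
  qed
  have \<zeta>M: "\<zeta> > M" using big by (simp add: \<zeta>_def P_def M_def)
  have \<alpha>: "\<sigma> * (P - s\<^sup>2) = \<nu> * \<zeta>" using lam by (simp add: \<zeta>_def)
  have Bd: "- (\<bar>B\<bar> * (\<mu> * \<zeta>)) \<le> \<sigma> * (B * ((q x)\<^sup>2 - t\<^sup>2))"
  proof -
    have "\<bar>(q x)\<^sup>2 - t\<^sup>2\<bar> \<le> \<mu> * \<zeta>" using dom lam by (simp add: \<zeta>_def P_def pos_divide_le_eq mult.commute)
    then have "\<bar>B\<bar> * \<bar>(q x)\<^sup>2 - t\<^sup>2\<bar> \<le> \<bar>B\<bar> * (\<mu> * \<zeta>)" by (intro mult_left_mono) auto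
    moreover have "\<bar>\<sigma> * (B * ((q x)\<^sup>2 - t\<^sup>2))\<bar> = \<bar>B\<bar> * \<bar>(q x)\<^sup>2 - t\<^sup>2\<bar>" using s2 by (simp add: abs_mult)
    ultimately show ?thesis by linarith
  qed
  \<comment> \<open>Because the error of q in its own weight is no larger than \<zeta>, the coupling
    costs at most |B| \<mu> \<zeta>, and the positive coefficient k = A \<nu> - |B| \<mu> is
    left.\<close>
  have V: "k * \<zeta> \<le> \<sigma> * (A * (P - s\<^sup>2) + B * ((q x)\<^sup>2 - t\<^sup>2))"
  proof -
    have "\<sigma> * (A * (P - s\<^sup>2) + B * ((q x)\<^sup>2 - t\<^sup>2)) = A * (\<sigma> * (P - s\<^sup>2)) + \<sigma> * (B * ((q x)\<^sup>2 - t\<^sup>2))"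
      by (simp add: algebra_simps)
    then show ?thesis using Bd unfolding \<alpha> k(1) by (simp add: algebra_simps)
  qed
  have pg: "\<sigma> * (2 * p x * g) \<ge> 2 * P * (exp (2 * x) * (k * \<zeta>) - m\<^sup>2)"
  proof -
    have eq: "\<sigma> * (2 * p x * g) = 2 * P * (\<sigma> * m\<^sup>2 + exp (2 * x) * (\<sigma> * (A * (P - s\<^sup>2) + B * ((q x)\<^sup>2 - t\<^sup>2))))"
      by (simp add: g_def reaction_def P_def power2_eq_square algebra_simps)
    have "\<sigma> * m\<^sup>2 \<ge> - m\<^sup>2" using \<sigma> by (auto intro: order_trans[of _ 0])
    moreover have "exp (2 * x) * (\<sigma> * (A * (P - s\<^sup>2) + B * ((q x)\<^sup>2 - t\<^sup>2))) \<ge> exp (2 * x) * (k * \<zeta>)"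
      using V by (intro mult_left_mono) auto
    ultimately have "exp (2 * x) * (k * \<zeta>) - m\<^sup>2 \<le> \<sigma> * m\<^sup>2 + exp (2 * x) * (\<sigma> * (A * (P - s\<^sup>2) + B * ((q x)\<^sup>2 - t\<^sup>2)))"
      by linarith
    then have "2 * P * (exp (2 * x) * (k * \<zeta>) - m\<^sup>2) \<le> 2 * P * (\<sigma> * m\<^sup>2 + exp (2 * x) * (\<sigma> * (A * (P - s\<^sup>2) + B * ((q x)\<^sup>2 - t\<^sup>2))))"
      using P0(1) by (intro mult_left_mono) auto
    then show ?thesis unfolding eq .
  qed
  have eM: "exp (2 * x) * M = N" unfolding MN by (simp add: exp_minus)
  have "exp (2 * x) * (k * \<zeta>) \<ge> k * N"
  proof -
    have "exp (2 * x) * (k * M) \<le> exp (2 * x) * (k * \<zeta>)"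
      using \<zeta>M k by (intro mult_left_mono) auto
    moreover have "exp (2 * x) * (k * M) = k * (exp (2 * x) * M)" by simp
    ultimately show ?thesis unfolding eM by linarith
  qed
  then have "2 * P * (k * N - m\<^sup>2) \<le> 2 * P * (exp (2 * x) * (k * \<zeta>) - m\<^sup>2)"
    using P0 by (intro mult_left_mono) auto
  with pg have pg2: "2 * P * (k * N) - 2 * P * m\<^sup>2 \<le> \<sigma> * (2 * p x * g)" by (simp add: algebra_simps)
  have p'b: "2 * (p' x)\<^sup>2 \<le> 2 * \<nu>\<^sup>2 / c\<^sup>2 * M\<^sup>2"
  proof -
    have "2 * (p' x)\<^sup>2 = \<nu>\<^sup>2 * M'\<^sup>2 / (2 * P)" using p'2 P0 by (simp add: field_simps)
    also have "\<dots> \<le> \<nu>\<^sup>2 * (4 * M\<^sup>2) / (2 * c\<^sup>2)"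
      using M'M P0 pc by (intro frac_le mult_left_mono) auto
    finally show ?thesis by (simp add: mult_ac)
  qed
  have s1: "\<sigma> * y \<ge> - y" if "y \<ge> 0" for y using \<sigma> that by auto
  have "\<sigma> * (2 * (p' x)\<^sup>2) \<ge> - (2 * (p' x)\<^sup>2)" by (rule s1) simp
  moreover have "\<sigma> * (2 * (p' x)\<^sup>2 + 2 * p x * g) \<le> \<nu> * (4 * K * exp (-2 * x) + \<epsilon> * exp x)"
  proof -
    have "\<sigma> * (2 * (p' x)\<^sup>2 + 2 * p x * g) / \<nu> \<le> 4 * K * exp (-2 * x) + \<epsilon> * exp x"
      by (rule iffD1[OF diff_le_0_iff_le c(2)])
    then have "\<sigma> * (2 * (p' x)\<^sup>2 + 2 * p x * g) \<le> (4 * K * exp (-2 * x) + \<epsilon> * exp x) * \<nu>"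
      by (rule iffD1[OF pos_divide_le_eq[OF lam(1)]])
    then show ?thesis by (simp only: mult.commute[of _ \<nu>])
  qed
  moreover have "\<nu> * (4 * K * exp (-2 * x) + \<epsilon> * exp x) \<le> \<nu> * (4 * M)"
    using lam K unfolding M_def by (intro mult_left_mono) auto
  moreover have "\<sigma> * (2 * (p' x)\<^sup>2 + 2 * p x * g) = \<sigma> * (2 * (p' x)\<^sup>2) + \<sigma> * (2 * p x * g)"
    by (rule distrib_left)
  ultimately have main: "2 * P * (k * N) - 2 * P * m\<^sup>2 \<le> 2 * \<nu>\<^sup>2 / c\<^sup>2 * M\<^sup>2 + \<nu> * (4 * M)"
    using pg2 p'b by (smt (verit))
  \<comment> \<open>Final balance: the left side of \<open>main\<close> is at least 2 c^2 k N - 2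
    m^2 C^2. One c^2 k N exceeds 2 m^2 C^2 by \<open>h2\<close>, the other covers the right side by
    \<open>h1\<close>.\<close>
  have "2 * P * m\<^sup>2 \<le> 2 * m\<^sup>2 * C\<^sup>2"
    using mult_left_mono[OF P0(3), of "2 * m\<^sup>2"] by (simp add: mult_ac)
  moreover have "2 * c\<^sup>2 * (k * N) \<le> 2 * P * (k * N)" using P0 N0 k by (intro mult_right_mono) auto
  moreover have "2 * \<nu>\<^sup>2 / c\<^sup>2 * M\<^sup>2 + \<nu> * (4 * M) =
     (2 * \<nu>\<^sup>2 / c\<^sup>2 * (exp (-4 * x) * K + \<epsilon> * exp (- x)) + 4 * \<nu> * exp (-2 * x)) * N"
  proof -
    have "exp (-2 * x) * M = exp (-4 * x) * K + \<epsilon> * exp (- x)"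
      unfolding M_def by (simp add: algebra_simps flip: exp_add)
    then have "exp (-2 * x) * (exp (-2 * x) * N) = exp (-4 * x) * K + \<epsilon> * exp (- x)" unfolding MN .
    then show ?thesis unfolding MN by (simp add: algebra_simps power2_eq_square)
  qed
  moreover have "\<dots> \<le> c\<^sup>2 * k * N" using h1 N0 by (intro mult_right_mono) auto
  moreover have "c\<^sup>2 * k * K \<le> c\<^sup>2 * k * N" using N0 k by (intro mult_left_mono) auto
  moreover have "2 * c\<^sup>2 * (k * N) = c\<^sup>2 * k * N + c\<^sup>2 * k * N" by simp
  ultimately show False using main h2 by linarith
qed

text \<open>The larger of the two weighted errors is compared with K exp (-2x) + \<epsilon> exp x on
  [X, Y]. The a priori bound \<open>K0\<close> settles both ends, \<open>barrier_contact\<close> the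
  interior, and \<epsilon> tends to 0 with K and X fixed.\<close>

lemma decay_at_top:
  fixes p q :: "real \<Rightarrow> real"
  assumes A: "A > 0" "A' > 0" and AB: "A * A' - B\<^sup>2 > 0"
    and p: "has_second_deriv p (\<lambda>x. reaction A B s t m x (p x) (q x)) UNIV"
    and q: "has_second_deriv q (\<lambda>x. reaction A' B t s n x (q x) (p x)) UNIV"
    and bd: "\<And>x. x \<ge> X0 \<Longrightarrow> c \<le> p x \<and> p x \<le> C \<and> c \<le> q x \<and> q x \<le> C" and c: "c > 0"
  shows "\<exists>K X. \<forall>x\<ge>X. \<bar>(p x)\<^sup>2 - s\<^sup>2\<bar> \<le> K * exp (-2 * x) \<and> \<bar>(q x)\<^sup>2 - t\<^sup>2\<bar> \<le> K * exp (-2 * x)"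
proof -
  obtain p' where p': "\<And>x. (p has_real_derivative p' x) (at x)"
    "\<And>x. (p' has_real_derivative reaction A B s t m x (p x) (q x)) (at x)"
    using p unfolding has_second_deriv_def by blast
  obtain q' where q': "\<And>x. (q has_real_derivative q' x) (at x)"
    "\<And>x. (q' has_real_derivative reaction A' B t s n x (q x) (p x)) (at x)"
    using q unfolding has_second_deriv_def by blast
  \<comment> \<open>With these weights both margins contain the factor \<nu> \<mu> - |B|: k = \<mu>
    (\<nu> \<mu> - |B|) and k' = \<nu> (\<nu> \<mu> - |B|). The condition A A' > B^2 makes both
    positive.\<close>
  define \<nu> where "\<nu> = sqrt A'"
  define \<mu> where "\<mu> = sqrt A"
  have lm: "\<nu> > 0" "\<mu> > 0" using A by (auto simp: \<nu>_def \<mu>_def)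
  have l2: "\<nu>\<^sup>2 = A'" "\<mu>\<^sup>2 = A" using A by (auto simp: \<nu>_def \<mu>_def)
  have "B\<^sup>2 < (\<nu> * \<mu>)\<^sup>2" using AB by (simp add: power_mult_distrib l2 mult.commute)
  then have Blm: "\<bar>B\<bar> < \<nu> * \<mu>" using lm by (metis abs_of_pos mult_pos_pos power2_less_imp_less abs_ge_zero power2_abs)
  define k where "k = A * \<nu> - \<bar>B\<bar> * \<mu>"
  define k' where "k' = A' * \<mu> - \<bar>B\<bar> * \<nu>"
  have k: "k > 0" "k' > 0"
    using mult_strict_right_mono[OF Blm lm(2)] mult_strict_right_mono[OF Blm lm(1)]
    unfolding k_def k'_def l2[symmetric] by (simp_all add: power2_eq_square mult_ac)
  define K0 where "K0 = (C\<^sup>2 + s\<^sup>2) / \<nu> + (C\<^sup>2 + t\<^sup>2) / \<mu>"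
  have C0: "C > 0" using bd[of X0] c by linarith
  have K0: "K0 > 0" 
  proof -
    have "C\<^sup>2 > 0" using C0 by simp
    then have "C\<^sup>2 + s\<^sup>2 > 0" "C\<^sup>2 + t\<^sup>2 > 0" by (simp_all add: add_pos_nonneg)
    then show ?thesis unfolding K0_def using lm by (intro add_pos_pos[OF divide_pos_pos divide_pos_pos])
  qed
  have bnd: "\<bar>(p x)\<^sup>2 - s\<^sup>2\<bar> / \<nu> \<le> K0" "\<bar>(q x)\<^sup>2 - t\<^sup>2\<bar> / \<mu> \<le> K0" if "x \<ge> X0" for x
  proof -
    have "(p x)\<^sup>2 \<le> C\<^sup>2" "(q x)\<^sup>2 \<le> C\<^sup>2" using bd[OF that] c by (auto intro!: power_mono)
    then have "\<bar>(p x)\<^sup>2 - s\<^sup>2\<bar> \<le> C\<^sup>2 + s\<^sup>2" "\<bar>(q x)\<^sup>2 - t\<^sup>2\<bar> \<le> C\<^sup>2 + t\<^sup>2" by (auto simp: abs_le_iff add_increasing add_increasing2)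
    then have "\<bar>(p x)\<^sup>2 - s\<^sup>2\<bar> / \<nu> \<le> (C\<^sup>2 + s\<^sup>2) / \<nu>" "\<bar>(q x)\<^sup>2 - t\<^sup>2\<bar> / \<mu> \<le> (C\<^sup>2 + t\<^sup>2) / \<mu>"
      using lm by (auto intro: divide_right_mono)
    moreover have "(C\<^sup>2 + s\<^sup>2) / \<nu> \<ge> 0" "(C\<^sup>2 + t\<^sup>2) / \<mu> \<ge> 0" using lm by auto
    ultimately show "\<bar>(p x)\<^sup>2 - s\<^sup>2\<bar> / \<nu> \<le> K0" "\<bar>(q x)\<^sup>2 - t\<^sup>2\<bar> / \<mu> \<le> K0"
      unfolding K0_def by linarith+
  qed
  have e0: "((\<lambda>x::real. exp (- x)) \<longlongrightarrow> 0) at_top" "((\<lambda>x::real. exp (-2 * x)) \<longlongrightarrow> 0) at_top"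
    by (intro filterlim_compose[OF exp_at_bot] filterlim_uminus_at_bot_at_top
        filterlim_tendsto_neg_mult_at_bot[OF tendsto_const] filterlim_ident; simp)+
  have lim: "((\<lambda>x. 2 * \<nu>\<^sup>2 / c\<^sup>2 * (K0 * exp (-2 * x) + exp (- x)) + 4 * \<nu> * exp (-2 * x)) \<longlongrightarrow>
      2 * \<nu>\<^sup>2 / c\<^sup>2 * (K0 * 0 + 0) + 4 * \<nu> * 0) at_top" for \<nu>
    by (intro tendsto_intros e0)
  have ev1: "\<forall>\<^sub>F x in at_top. 2 * \<nu>\<^sup>2 / c\<^sup>2 * (K0 * exp (-2 * x) + exp (- x)) + 4 * \<nu> * exp (-2 * x) < c\<^sup>2 * k"
    if "k > 0" for \<nu> k
    by (rule order_tendstoD(2)[OF lim]) (use that c in simp)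
  have ev2: "\<forall>\<^sub>F x in at_top. 2 * m\<^sup>2 * C\<^sup>2 < c\<^sup>2 * k * (K0 * exp (2 * x))" if "k > 0" for k m
  proof -
    have "filterlim (\<lambda>x::real. exp (2 * x)) at_top at_top"
      by (intro filterlim_compose[OF exp_at_top] filterlim_tendsto_pos_mult_at_top[OF tendsto_const] filterlim_ident) simp
    then have "\<forall>\<^sub>F x in at_top. 2 * m\<^sup>2 * C\<^sup>2 / (c\<^sup>2 * k * K0) < exp (2 * x)"
      by (simp add: filterlim_at_top_dense)
    then show ?thesis
      by eventually_elim (use that c K0 in \<open>simp add: field_simps\<close>)
  qed
  have "\<forall>\<^sub>F x in at_top. X0 \<le> x \<and> (0::real) \<le> x" by (intro eventually_conj eventually_ge_at_top)
  with ev1[OF k(1), of \<nu>] ev1[OF k(2), of \<mu>] ev2[OF k(1), of m] ev2[OF k(2), of n]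
  have "\<forall>\<^sub>F X in at_top. (X0 \<le> X \<and> 0 \<le> X) \<and>
      2 * \<nu>\<^sup>2 / c\<^sup>2 * (K0 * exp (-2 * X) + exp (- X)) + 4 * \<nu> * exp (-2 * X) < c\<^sup>2 * k \<and>
      2 * \<mu>\<^sup>2 / c\<^sup>2 * (K0 * exp (-2 * X) + exp (- X)) + 4 * \<mu> * exp (-2 * X) < c\<^sup>2 * k' \<and>
      2 * m\<^sup>2 * C\<^sup>2 < c\<^sup>2 * k * (K0 * exp (2 * X)) \<and> 2 * n\<^sup>2 * C\<^sup>2 < c\<^sup>2 * k' * (K0 * exp (2 * X))"
    by eventually_elim blast
  then obtain X where X: "X0 \<le> X" "0 \<le> X"
      "2 * \<nu>\<^sup>2 / c\<^sup>2 * (K0 * exp (-2 * X) + exp (- X)) + 4 * \<nu> * exp (-2 * X) < c\<^sup>2 * k"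
      "2 * \<mu>\<^sup>2 / c\<^sup>2 * (K0 * exp (-2 * X) + exp (- X)) + 4 * \<mu> * exp (-2 * X) < c\<^sup>2 * k'"
      "2 * m\<^sup>2 * C\<^sup>2 < c\<^sup>2 * k * (K0 * exp (2 * X))" "2 * n\<^sup>2 * C\<^sup>2 < c\<^sup>2 * k' * (K0 * exp (2 * X))"
    using eventually_happens'[OF trivial_limit_at_top_linorder] by blast
  \<comment> \<open>K exp (-2X) equals the a priori bound \<open>K0\<close>, which settles the left
    end. Although K is large, exp (-4X) K = K0 exp (-2X) is small; this is why the conditions on X
    are stated before K is fixed.\<close>
  define K where "K = K0 * exp (2 * X)"
  have K: "K > 0" using K0 by (simp add: K_def)
  have small: "2 * \<nu>\<^sup>2 / c\<^sup>2 * (exp (-4 * x) * K + \<epsilon> * exp (- x)) + 4 * \<nu> * exp (-2 * x)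
      \<le> 2 * \<nu>\<^sup>2 / c\<^sup>2 * (K0 * exp (-2 * X) + exp (- X)) + 4 * \<nu> * exp (-2 * X)"
    if "x \<ge> X" "\<epsilon> \<le> 1" "\<epsilon> \<ge> 0" "\<nu> > 0" for x \<epsilon> \<nu>
  proof -
    have "exp (-4 * x) * K \<le> exp (-4 * X) * K" using that K by simp
    also have "\<dots> = K0 * exp (-2 * X)" unfolding K_def by (simp flip: exp_add)
    finally have "exp (-4 * x) * K \<le> K0 * exp (-2 * X)" .
    moreover have "\<epsilon> * exp (- x) \<le> 1 * exp (- X)" using that by (intro mult_mono) auto
    ultimately have "2 * \<nu>\<^sup>2 / c\<^sup>2 * (exp (-4 * x) * K + \<epsilon> * exp (- x)) \<le> 2 * \<nu>\<^sup>2 / c\<^sup>2 * (K0 * exp (-2 * X) + exp (- X))"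
      by (intro mult_left_mono) auto
    moreover have "4 * \<nu> * exp (-2 * x) \<le> 4 * \<nu> * exp (-2 * X)" using that by simp
    ultimately show ?thesis by linarith
  qed
  have main: "\<bar>(p x)\<^sup>2 - s\<^sup>2\<bar> / \<nu> \<le> K * exp (-2 * x) + \<epsilon> * exp x \<and> \<bar>(q x)\<^sup>2 - t\<^sup>2\<bar> / \<mu> \<le> K * exp (-2 * x) + \<epsilon> * exp x"
    if x: "x \<ge> X" and \<epsilon>: "\<epsilon> > 0" "\<epsilon> \<le> 1" for x \<epsilon>
  proof -
    \<comment> \<open>Far enough out for \<epsilon> exp Y to reach \<open>K0\<close>, which settles
      the right end.\<close>
    define Y where "Y = max (x + 1) (ln (K0 / \<epsilon>))"
    have Y: "x < Y" "K0 \<le> \<epsilon> * exp Y"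
    proof -
      have "ln (K0 / \<epsilon>) \<le> Y" by (simp add: Y_def)
      then have "exp (ln (K0 / \<epsilon>)) \<le> exp Y" by simp
      then have "K0 / \<epsilon> \<le> exp Y" using K0 \<epsilon> by simp
      then show "K0 \<le> \<epsilon> * exp Y" using \<epsilon> by (simp add: field_simps)
    qed (simp add: Y_def)
    define M where "M z = K * exp (-2 * z) + \<epsilon> * exp z" for z
    define \<zeta> where "\<zeta> z = max (\<bar>(p z)\<^sup>2 - s\<^sup>2\<bar> / \<nu>) (\<bar>(q z)\<^sup>2 - t\<^sup>2\<bar> / \<mu>)" for z
    have cont: "continuous_on {X..Y} p" "continuous_on {X..Y} q"
      using p q by (auto intro: has_second_deriv_continuous)
    have "continuous_on {X..Y} (\<lambda>z. \<zeta> z - M z)"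
      unfolding \<zeta>_def M_def using lm by (intro continuous_intros cont) auto
    moreover have "{X..Y} \<noteq> {}" using x Y by auto
    ultimately obtain z where z: "z \<in> {X..Y}" "\<And>y. y \<in> {X..Y} \<Longrightarrow> \<zeta> y - M y \<le> \<zeta> z - M z"
      using continuous_attains_sup[of "{X..Y}" "\<lambda>z. \<zeta> z - M z"] by auto
    have "\<zeta> z - M z \<le> 0"
    proof (rule ccontr)
      assume "\<not> \<zeta> z - M z \<le> 0"
      then have gt: "\<zeta> z > M z" by simp
      have \<zeta>K: "\<zeta> y \<le> K0" if "y \<ge> X" for y using bnd[of y] that X(1) by (auto simp: \<zeta>_def)
      have "K * exp (-2 * X) = K0" by (simp add: K_def flip: exp_add)
      then have "\<zeta> X \<le> M X" using \<zeta>K[of X] \<epsilon> by (simp add: M_def add_increasing2)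
      moreover have "\<zeta> Y \<le> M Y" using \<zeta>K[of Y] Y x K by (simp add: M_def add_increasing)
      ultimately have int: "X < z" "z < Y" using gt z(1) by (auto simp: less_le)
      have zb: "c \<le> p z" "p z \<le> C" "c \<le> q z" "q z \<le> C" using bd[of z] int X(1) by auto
      have mxp: "\<sigma> * ((p y)\<^sup>2 - s\<^sup>2) / \<nu> \<le> \<zeta> y" "\<sigma> * ((q y)\<^sup>2 - t\<^sup>2) / \<mu> \<le> \<zeta> y" if "\<sigma> = 1 \<or> \<sigma> = -1" for \<sigma> y
      proof -
        have "\<sigma> * ((p y)\<^sup>2 - s\<^sup>2) \<le> \<bar>(p y)\<^sup>2 - s\<^sup>2\<bar>" "\<sigma> * ((q y)\<^sup>2 - t\<^sup>2) \<le> \<bar>(q y)\<^sup>2 - t\<^sup>2\<bar>" using that by auto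
        then have "\<sigma> * ((p y)\<^sup>2 - s\<^sup>2) / \<nu> \<le> \<bar>(p y)\<^sup>2 - s\<^sup>2\<bar> / \<nu>" "\<sigma> * ((q y)\<^sup>2 - t\<^sup>2) / \<mu> \<le> \<bar>(q y)\<^sup>2 - t\<^sup>2\<bar> / \<mu>"
          using lm by (auto intro: divide_right_mono)
        then show "\<sigma> * ((p y)\<^sup>2 - s\<^sup>2) / \<nu> \<le> \<zeta> y" "\<sigma> * ((q y)\<^sup>2 - t\<^sup>2) / \<mu> \<le> \<zeta> y"
          unfolding \<zeta>_def by linarith+
      qed
      consider "\<zeta> z = \<bar>(p z)\<^sup>2 - s\<^sup>2\<bar> / \<nu>" | "\<zeta> z = \<bar>(q z)\<^sup>2 - t\<^sup>2\<bar> / \<mu>" unfolding \<zeta>_def by linarith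
      then show False
      proof cases
        case 1
        obtain \<sigma> :: real where \<sigma>: "\<sigma> = 1 \<or> \<sigma> = -1" "\<bar>(p z)\<^sup>2 - s\<^sup>2\<bar> = \<sigma> * ((p z)\<^sup>2 - s\<^sup>2)"
          by (cases "(p z)\<^sup>2 - s\<^sup>2 \<ge> 0") (auto intro: that[of 1] that[of "-1"])
        have eq: "\<zeta> z = \<sigma> * ((p z)\<^sup>2 - s\<^sup>2) / \<nu>" using 1 \<sigma>(2) by simp
        show False
        proof (rule barrier_contact[OF p'(1,2) int \<sigma>(1) lm c zb(1,2) k_def k(1) A(1) _ _ _ K _ _ X(5)[folded K_def]])
          fix y assume y: "X < y" "y < Y"
          then have "\<zeta> y - M y \<le> \<zeta> z - M z" by (intro z(2)) auto
          then show "\<sigma> * ((p y)\<^sup>2 - s\<^sup>2) / \<nu> - (K * exp (-2 * y) + \<epsilon> * exp y)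
            \<le> \<sigma> * ((p z)\<^sup>2 - s\<^sup>2) / \<nu> - (K * exp (-2 * z) + \<epsilon> * exp z)"
            using mxp(1)[OF \<sigma>(1), of y] unfolding eq M_def by linarith
        next
          show "\<bar>(q z)\<^sup>2 - t\<^sup>2\<bar> / \<mu> \<le> \<sigma> * ((p z)\<^sup>2 - s\<^sup>2) / \<nu>" unfolding eq[symmetric] by (simp add: \<zeta>_def)
          show "K * exp (- 2 * z) + \<epsilon> * exp z < \<sigma> * ((p z)\<^sup>2 - s\<^sup>2) / \<nu>"
            using gt unfolding eq M_def .
          show "\<epsilon> \<ge> 0" using \<epsilon> by simp
          show "2 * \<nu>\<^sup>2 / c\<^sup>2 * (exp (-4 * z) * K + \<epsilon> * exp (- z)) + 4 * \<nu> * exp (-2 * z) \<le> c\<^sup>2 * k"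
            using small[of z \<epsilon> \<nu>] int \<epsilon> lm X(3) by linarith
        qed
      next
        case 2
        obtain \<sigma> :: real where \<sigma>: "\<sigma> = 1 \<or> \<sigma> = -1" "\<bar>(q z)\<^sup>2 - t\<^sup>2\<bar> = \<sigma> * ((q z)\<^sup>2 - t\<^sup>2)"
          by (cases "(q z)\<^sup>2 - t\<^sup>2 \<ge> 0") (auto intro: that[of 1] that[of "-1"])
        have eq: "\<zeta> z = \<sigma> * ((q z)\<^sup>2 - t\<^sup>2) / \<mu>" using 2 \<sigma>(2) by simp
        show False
        proof (rule barrier_contact[OF q'(1,2) int \<sigma>(1) lm(2,1) c zb(3,4) k'_def k(2) A(2) _ _ _ K _ _ X(6)[folded K_def]])
          fix y assume y: "X < y" "y < Y"
          then have "\<zeta> y - M y \<le> \<zeta> z - M z" by (intro z(2)) auto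
          then show "\<sigma> * ((q y)\<^sup>2 - t\<^sup>2) / \<mu> - (K * exp (-2 * y) + \<epsilon> * exp y)
            \<le> \<sigma> * ((q z)\<^sup>2 - t\<^sup>2) / \<mu> - (K * exp (-2 * z) + \<epsilon> * exp z)"
            using mxp(2)[OF \<sigma>(1), of y] unfolding eq M_def by linarith
        next
          show "\<bar>(p z)\<^sup>2 - s\<^sup>2\<bar> / \<nu> \<le> \<sigma> * ((q z)\<^sup>2 - t\<^sup>2) / \<mu>" unfolding eq[symmetric] by (simp add: \<zeta>_def)
          show "K * exp (- 2 * z) + \<epsilon> * exp z < \<sigma> * ((q z)\<^sup>2 - t\<^sup>2) / \<mu>"
            using gt unfolding eq M_def .
          show "\<epsilon> \<ge> 0" using \<epsilon> by simp
          show "2 * \<mu>\<^sup>2 / c\<^sup>2 * (exp (-4 * z) * K + \<epsilon> * exp (- z)) + 4 * \<mu> * exp (-2 * z) \<le> c\<^sup>2 * k'"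
            using small[of z \<epsilon> \<mu>] int \<epsilon> lm X(4) by linarith
        qed
      qed
    qed
    then have "\<zeta> x \<le> M x" using z(2)[of x] x Y by auto
    then show ?thesis by (simp add: \<zeta>_def M_def)
  qed
  have lim0: "y \<le> K * exp (-2 * x)" if "\<And>\<epsilon>. \<epsilon> > 0 \<Longrightarrow> \<epsilon> \<le> 1 \<Longrightarrow> y \<le> K * exp (-2 * x) + \<epsilon> * exp x" for x y
  proof (rule field_le_epsilon)
    fix e :: real assume e: "e > 0"
    have "y \<le> K * exp (-2 * x) + min 1 (e / exp x) * exp x" by (rule that) (use e in auto)
    also have "\<dots> \<le> K * exp (-2 * x) + e / exp x * exp x" by (intro add_left_mono mult_right_mono) auto
    finally show "y \<le> K * exp (-2 * x) + e" by simp
  qed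
  have "\<bar>(p x)\<^sup>2 - s\<^sup>2\<bar> \<le> (K * \<nu> + K * \<mu>) * exp (-2 * x) \<and> \<bar>(q x)\<^sup>2 - t\<^sup>2\<bar> \<le> (K * \<nu> + K * \<mu>) * exp (-2 * x)" if "x \<ge> X" for x
  proof -
    have "\<bar>(p x)\<^sup>2 - s\<^sup>2\<bar> / \<nu> \<le> K * exp (-2 * x)" "\<bar>(q x)\<^sup>2 - t\<^sup>2\<bar> / \<mu> \<le> K * exp (-2 * x)"
      by (intro lim0 conjunct1[OF main[OF that]] conjunct2[OF main[OF that]]; assumption)+
    then have "\<bar>(p x)\<^sup>2 - s\<^sup>2\<bar> \<le> K * exp (-2 * x) * \<nu>" "\<bar>(q x)\<^sup>2 - t\<^sup>2\<bar> \<le> K * exp (-2 * x) * \<mu>"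
      using lm by (auto simp: pos_divide_le_eq)
    moreover have "K * exp (-2 * x) * \<nu> \<ge> 0" "K * exp (-2 * x) * \<mu> \<ge> 0" using K lm by auto
    ultimately show ?thesis by (simp add: algebra_simps)
  qed
  then show ?thesis by blast
qed

text \<open>Landau's interpolation with step h = exp (-x): p moves by at most 2 K h^2 over the step,
  so |p'| is at most 2 K h somewhere in it, and the bound on p'' adds K h.\<close>

lemma landau_decay:
  fixes p p' g :: "real \<Rightarrow> real"
  assumes p: "\<And>x. x \<ge> X \<Longrightarrow> (p has_real_derivative p' x) (at x)"
    and p': "\<And>x. x \<ge> X \<Longrightarrow> (p' has_real_derivative g x) (at x)"
    and ps: "\<And>x. x \<ge> X \<Longrightarrow> \<bar>p x - s\<bar> \<le> K * exp (-2 * x)" and g: "\<And>x. x \<ge> X \<Longrightarrow> \<bar>g x\<bar> \<le> K"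
    and x: "x \<ge> X"
  shows "\<bar>p' x\<bar> \<le> 3 * K * exp (- x)"
proof -
  define h where "h = exp (- x)"
  have h: "h > 0" by (simp add: h_def)
  have h2: "exp (-2 * x) = h * h" by (simp add: h_def flip: exp_add)
  have K: "K \<ge> 0" using g[OF x] by linarith
  have "\<exists>z>x. z < x + h \<and> p (x + h) - p x = (x + h - x) * p' z"
    using h x by (intro MVT2 p) auto
  then obtain z where z: "x < z" "z < x + h" "p (x + h) - p x = h * p' z" by auto
  have "\<exists>y>x. y < z \<and> p' z - p' x = (z - x) * g y"
    using z x by (intro MVT2 p') auto
  then obtain y where y: "x < y" "y < z" "p' z - p' x = (z - x) * g y" by auto
  have "\<bar>p' z - p' x\<bar> \<le> h * K"
    using g[of y] y z x K by (auto simp: abs_mult intro!: mult_mono)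
  moreover have "\<bar>p' z\<bar> \<le> 2 * K * h"
  proof -
    have "exp (-2 * (x + h)) \<le> h * h" using h unfolding h2[symmetric] by simp
    then have "K * exp (-2 * (x + h)) \<le> K * (h * h)" using K by (rule mult_left_mono)
    moreover have "\<bar>p (x + h) - s\<bar> \<le> K * exp (-2 * (x + h))" "\<bar>p x - s\<bar> \<le> K * (h * h)"
      using ps[of "x + h"] ps[OF x] h x h2 by auto
    ultimately have "\<bar>h * p' z\<bar> \<le> 2 * (K * (h * h))" unfolding z(3)[symmetric] by linarith
    then have "h * \<bar>p' z\<bar> \<le> h * (2 * K * h)" using h by (simp add: abs_mult algebra_simps)
    then show ?thesis using h by simp
  qed
  ultimately show ?thesis unfolding h_def[symmetric] by (simp add: algebra_simps)
qed

section \<open>Behaviour at the origin and uniqueness\<close>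

lemma exp_double_le:
  fixes e :: real
  assumes "e > 0" "x \<le> ln e / 2"
  shows "exp (2 * x) \<le> e"
  using assms by (simp add: ln_ge_iff[symmetric])

text \<open>The sign of \<open>f'\<close> is known only where \<open>f > 0\<close>. After the last
  point where \<open>f\<close> is at most a level \<open>c\<close> strictly between 0 and
  \<open>f b\<close>, the function is positive, hence nonincreasing, and cannot rise to
  \<open>f b\<close>.\<close>

lemma backward_positive:
  fixes f f' :: "real \<Rightarrow> real"
  assumes f: "\<And>x. x \<le> b \<Longrightarrow> (f has_real_derivative f' x) (at x)"
    and f': "\<And>x. x \<le> b \<Longrightarrow> f x > 0 \<Longrightarrow> f' x \<le> 0" and b: "f b > 0" and x: "x \<le> b"
  shows "f b \<le> f x"
proof (rule ccontr)
  assume n: "\<not> f b \<le> f x"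
  define c where "c = max (f x) (f b / 2)"
  have c: "f x \<le> c" "c < f b" "0 < c" using n b by (auto simp: c_def)
  have cont: "continuous_on {x..b} f"
    using f by (intro continuous_at_imp_continuous_on ballI DERIV_isCont) auto
  define S where "S = {x..b} \<inter> f -` {..c}"
  have "closed S" unfolding S_def by (intro continuous_closed_preimage cont) auto
  moreover have "bounded S" unfolding S_def by (rule bounded_subset[of "{x..b}"]) auto
  ultimately have "compact S" by (simp add: compact_eq_bounded_closed)
  moreover have "S \<noteq> {}" using x c by (auto simp: S_def)
  ultimately obtain z where z: "z \<in> S" "\<And>y. y \<in> S \<Longrightarrow> y \<le> z"
    using compact_attains_sup[of S] by blast
  have zb: "x \<le> z" "f z \<le> c" "z < b" using z(1) c by (auto simp: S_def less_le)
  have "\<exists>u>z. u < b \<and> f b - f z = (b - z) * f' u"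
    using zb by (intro MVT2 f) auto
  then obtain u where u: "z < u" "u < b" "f b - f z = (b - z) * f' u" by auto
  have "u \<notin> S" using z(2)[of u] u(1) by auto
  then have "f u > c" using u zb by (auto simp: S_def)
  then have "f' u \<le> 0" using f'[of u] u c by simp
  then have "f b - f z \<le> 0" using u zb by (simp add: mult_nonneg_nonpos)
  then show False using zb c by simp
qed

lemma no_backward_growth:
  fixes f f' :: "real \<Rightarrow> real"
  assumes f: "\<And>x. x \<le> b \<Longrightarrow> (f has_real_derivative f' x) (at x)"
    and f': "\<And>x. x \<le> b \<Longrightarrow> f' x \<le> - \<delta>" and \<delta>: "\<delta> > 0" and bd: "\<And>x. x \<le> b \<Longrightarrow> f x \<le> C"
  shows False
proof -
  define x where "x = b - (C - f b + 1) / \<delta>"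
  have "C - f b + 1 > 0" using bd[of b] by simp
  then have xb: "x < b" using \<delta> by (simp add: x_def)
  have "\<exists>u>x. u < b \<and> f b - f x = (b - x) * f' u" using xb by (intro MVT2 f) auto
  then obtain u where u: "u < b" "f b - f x = (b - x) * f' u" by auto
  have "(b - x) * f' u \<le> (b - x) * (- \<delta>)" using xb f'[of u] u by (intro mult_left_mono) auto
  also have "\<dots> = - (C - f b + 1)" using \<delta> by (simp add: x_def)
  finally have "f x \<ge> C + 1" using u by linarith
  then show False using bd[of x] xb by simp
qed

text \<open>Riccati equation \<open>y' = m\<^sup>2 + e\<^bsup>2x\<^esup> V - y\<^sup>2\<close> for \<open>y = p' / p\<close>: an error \<open>\<bar>y - m\<bar>\<close> larger than
  a multiple of \<open>e\<^bsup>2x\<^esup>\<close> persists towards \<open>-\<infinity>\<close>, where it makes \<open>1 / y\<close>, \<open>y\<close> or \<open>p\<close> leave its range.\<close>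

lemma log_derivative_at_bot:
  fixes p p' V :: "real \<Rightarrow> real"
  assumes p: "\<And>x. x \<le> X0 \<Longrightarrow> (p has_real_derivative p' x) (at x)"
    and p': "\<And>x. x \<le> X0 \<Longrightarrow> (p' has_real_derivative (m\<^sup>2 + exp (2 * x) * V x) * p x) (at x)"
    and V: "\<And>x. x \<le> X0 \<Longrightarrow> \<bar>V x\<bar> \<le> K" and pos: "\<And>x. x \<le> X0 \<Longrightarrow> 0 < p x"
    and pC: "\<And>x. x \<le> X0 \<Longrightarrow> p x \<le> C" and m: "m \<ge> 0"
  shows "\<exists>D X. \<forall>x\<le>X. \<bar>p' x / p x - m\<bar> \<le> D * exp (2 * x)"
proof -
  define D where "D = \<bar>K\<bar> + 1"
  have D: "D > 0" "K < D" by (auto simp: D_def)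
  have eV: "\<bar>exp (2 * x) * V x\<bar> \<le> D * exp (2 * x)" if "x \<le> X0" for x
    using V[OF that] D by (simp add: abs_mult mult.commute)
  define y where "y x = p' x / p x" for x
  define y' where "y' x = m\<^sup>2 + exp (2 * x) * V x - (y x)\<^sup>2" for x
  have y: "(y has_real_derivative y' x) (at x)" if "x \<le> X0" for x
  proof -
    have "(y has_real_derivative ((m\<^sup>2 + exp (2 * x) * V x) * p x * p x - p' x * p' x) / (p x * p x)) (at x)"
      unfolding y_def[abs_def] using pos[OF that] by (intro DERIV_divide p p' that) auto
    moreover have "((m\<^sup>2 + exp (2 * x) * V x) * p x * p x - p' x * p' x) / (p x * p x) = y' x"
      using pos[OF that] by (simp add: y'_def y_def field_simps power2_eq_square)
    ultimately show ?thesis by simp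
  qed
  have de: "((\<lambda>x. D * exp (2 * x)) has_real_derivative 2 * D * exp (2 * x)) (at x)" for x D :: real
    by (auto intro!: derivative_eq_intros)
  have upper: "y x2 - m \<le> D * exp (2 * x2)" if x2: "x2 \<le> X0" for x2
  proof (rule ccontr)
    assume "\<not> ?thesis"
    then have gt: "y x2 - m - D * exp (2 * x2) > 0" by simp
    define \<delta> where "\<delta> = y x2 - m - D * exp (2 * x2)"
    have \<delta>: "\<delta> > 0" using gt by (simp add: \<delta>_def)
    have pers: "y x \<ge> m + \<delta>" if x: "x \<le> x2" for x
    proof -
      have "\<delta> \<le> y x - m - D * exp (2 * x)"
        unfolding \<delta>_def
      proof (rule backward_positive[where f="\<lambda>x. y x - m - D * exp (2 * x)" and b=x2, OF _ _ gt x])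
        fix z assume z: "z \<le> x2"
        show "((\<lambda>x. y x - m - D * exp (2 * x)) has_real_derivative y' z - 0 - 2 * D * exp (2 * z)) (at z)"
          using z x2 by (intro DERIV_diff y DERIV_const de) auto
        assume "y z - m - D * exp (2 * z) > 0"
        then have "y z \<ge> m" using D by (smt (verit) exp_gt_zero mult_pos_pos)
        then have "m\<^sup>2 \<le> (y z)\<^sup>2" using m by (intro power_mono) auto
        moreover have "exp (2 * z) * V z \<le> D * exp (2 * z)" using eV[of z] z x2 by (auto simp: abs_le_iff)
        moreover have "D * exp (2 * z) \<ge> 0" using D by simp
        ultimately show "y' z - 0 - 2 * D * exp (2 * z) \<le> 0" unfolding y'_def by linarith
      qed
      moreover have "D * exp (2 * x) \<ge> 0" using D by simp
      ultimately show ?thesis by linarith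
    qed
    \<comment> \<open>Chosen so that m^2 <= (1 - 2 \<omega>) (m + \<delta>)^2. One \<omega> y^2
      absorbs the perturbation exp (2x) V far to the left, the other leaves y' <= -\<omega> y^2.
      Then 1 / y has slope at least \<omega> and would become negative backwards.\<close>
    define \<omega> where "\<omega> = \<delta>\<^sup>2 / (2 * (m + \<delta>)\<^sup>2)"
    have \<omega>: "\<omega> > 0" using \<delta> m by (simp add: \<omega>_def)
    have md: "(m + \<delta>)\<^sup>2 > 0" using \<delta> m by simp
    define x3 where "x3 = min x2 (ln (\<omega> * \<delta>\<^sup>2 / D) / 2)"
    have x3: "x3 \<le> x2" by (simp add: x3_def)
    have small: "D * exp (2 * x) \<le> \<omega> * \<delta>\<^sup>2" if "x \<le> x3" for x
    proof -
      have "exp (2 * x) \<le> \<omega> * \<delta>\<^sup>2 / D"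
        using that \<omega> \<delta> D by (intro exp_double_le) (auto simp: x3_def)
      then show ?thesis using D by (simp add: field_simps)
    qed
    have ric: "y' x \<le> - \<omega> * (y x)\<^sup>2" if x: "x \<le> x3" for x
    proof -
      have yx: "y x \<ge> m + \<delta>" using pers x x3 by simp
      then have y2: "(m + \<delta>)\<^sup>2 \<le> (y x)\<^sup>2" using m \<delta> by (intro power_mono) auto
      have "\<delta>\<^sup>2 \<le> (m + \<delta>)\<^sup>2" using m \<delta> by (intro power_mono) auto
      then have "D * exp (2 * x) \<le> \<omega> * (y x)\<^sup>2"
        using small[OF x] y2 \<omega> by (smt (verit) mult_left_mono)
      moreover have "exp (2 * x) * V x \<le> D * exp (2 * x)" using eV[of x] x x3 x2 by (auto simp: abs_le_iff)
      moreover have "m\<^sup>2 + 2 * \<omega> * (y x)\<^sup>2 \<le> (y x)\<^sup>2"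
      proof -
        have "m\<^sup>2 + \<delta>\<^sup>2 \<le> (m + \<delta>)\<^sup>2" using m \<delta> by (simp add: power2_sum)
        moreover have "2 * \<omega> * (m + \<delta>)\<^sup>2 = \<delta>\<^sup>2" using md by (simp add: \<omega>_def)
        ultimately have "m\<^sup>2 \<le> (1 - 2 * \<omega>) * (m + \<delta>)\<^sup>2" by (simp add: left_diff_distrib)
        also have "\<dots> \<le> (1 - 2 * \<omega>) * (y x)\<^sup>2"
        proof (rule mult_left_mono[OF y2])
          show "0 \<le> 1 - 2 * \<omega>" using \<open>\<delta>\<^sup>2 \<le> (m + \<delta>)\<^sup>2\<close> md by (simp add: \<omega>_def field_simps)
        qed
        finally show ?thesis by (simp add: algebra_simps)
      qed
      ultimately show ?thesis unfolding y'_def by linarith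
    qed
    show False
    proof (rule no_backward_growth[where f="\<lambda>x. - (1 / y x)" and b=x3 and \<delta>=\<omega> and C=0])
      fix x assume x: "x \<le> x3"
      have yx: "y x > 0" using pers[of x] x x3 m \<delta> by linarith
      show "((\<lambda>x. - (1 / y x)) has_real_derivative y' x / (y x)\<^sup>2) (at x)"
        using yx x x3 x2 by (auto intro!: derivative_eq_intros y simp: power2_eq_square)
      show "y' x / (y x)\<^sup>2 \<le> - \<omega>" using ric[OF x] yx by (simp add: pos_divide_le_eq)
      show "- (1 / y x) \<le> 0" using yx by simp
    qed (rule \<omega>)
  qed
  show ?thesis
  proof (cases "m = 0")
    case False
    with m have m0: "m > 0" by simp
    \<comment> \<open>Below \<open>X1\<close> the factor of p in p'' is nonnegative, so p is convex.
      A negative slope would persist backwards and make p unbounded; hence y >= 0, which allows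
      passing from y <= m to y^2 <= m^2.\<close>
    define X1 where "X1 = min X0 (ln (m\<^sup>2 / D) / 2)"
    have X1: "X1 \<le> X0" by (simp add: X1_def)
    have sm: "D * exp (2 * x) \<le> m\<^sup>2" if "x \<le> X1" for x
    proof -
      have "exp (2 * x) \<le> m\<^sup>2 / D"
        using that m0 D by (intro exp_double_le) (auto simp: X1_def)
      then show ?thesis using D by (simp add: field_simps)
    qed
    have p'0: "p' x2 \<ge> 0" if x2: "x2 \<le> X1" for x2
    proof (rule ccontr)
      assume n: "\<not> p' x2 \<ge> 0"
      show False
      proof (rule no_backward_growth[where f=p and f'=p' and b=x2 and \<delta>="- p' x2" and C=C])
        fix x assume x: "x \<le> x2"
        have "p' x \<le> p' x2"
        proof (rule DERIV_nonneg_imp_nondecreasing[OF x])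
          fix z assume z: "x \<le> z" "z \<le> x2"
          have zX: "z \<le> X0" "z \<le> X1" using z x2 X1 by auto
          have "0 \<le> m\<^sup>2 + exp (2 * z) * V z" using sm[OF zX(2)] eV[OF zX(1)] by (auto simp: abs_le_iff)
          then show "\<exists>y. (p' has_real_derivative y) (at z) \<and> 0 \<le> y"
            using p'[OF zX(1)] pos[OF zX(1)] by (intro exI[of _ "(m\<^sup>2 + exp (2 * z) * V z) * p z"]) auto
        qed
        then show "p' x \<le> - (- p' x2)" by simp
      qed (use n p pC x2 X1 in auto)
    qed
    have y0: "y x \<ge> 0" if "x \<le> X1" for x using p'0[OF that] pos[of x] that X1 by (simp add: y_def)
    have lower: "y x2 - m \<ge> - D * exp (2 * x2)" if x2: "x2 \<le> X1" for x2
    proof (rule ccontr)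
      assume "\<not> ?thesis"
      then have gt: "m - y x2 - D * exp (2 * x2) > 0" by simp
      define \<delta> where "\<delta> = m - y x2 - D * exp (2 * x2)"
      have \<delta>: "\<delta> > 0" using gt by (simp add: \<delta>_def)
      have pers: "y x \<le> m - \<delta>" if x: "x \<le> x2" for x
      proof -
        have "\<delta> \<le> m - y x - D * exp (2 * x)"
          unfolding \<delta>_def
        proof (rule backward_positive[where f="\<lambda>x. m - y x - D * exp (2 * x)" and b=x2, OF _ _ gt x])
          fix z assume z: "z \<le> x2"
          show "((\<lambda>x. m - y x - D * exp (2 * x)) has_real_derivative 0 - y' z - 2 * D * exp (2 * z)) (at z)"
            using z x2 X1 by (intro DERIV_diff y DERIV_const de) auto
          assume "m - y z - D * exp (2 * z) > 0"
          then have "y z \<le> m" using D by (smt (verit) exp_gt_zero mult_pos_pos)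
          then have "(y z)\<^sup>2 \<le> m\<^sup>2" using y0[of z] z x2 by (intro power_mono) auto
          moreover have "- (D * exp (2 * z)) \<le> exp (2 * z) * V z" using eV[of z] z x2 X1 by (auto simp: abs_le_iff)
          moreover have "D * exp (2 * z) \<ge> 0" using D by simp
          ultimately show "0 - y' z - 2 * D * exp (2 * z) \<le> 0" unfolding y'_def by linarith
        qed
        moreover have "D * exp (2 * x) \<ge> 0" using D by simp
        ultimately show ?thesis by linarith
      qed
      \<comment> \<open>From 0 <= y <= m - \<delta> follows y^2 <= m (m - \<delta>) = m^2 - 2
        \<eta>. One \<eta> absorbs the perturbation, so y' >= \<eta> and y would become negative
        backwards.\<close>
      define \<eta> where "\<eta> = m * \<delta> / 2"
      have \<eta>: "\<eta> > 0" using m0 \<delta> by (simp add: \<eta>_def)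
      define x3 where "x3 = min x2 (ln (\<eta> / D) / 2)"
      have x3: "x3 \<le> x2" by (simp add: x3_def)
      show False
      proof (rule no_backward_growth[where f="\<lambda>x. - y x" and f'="\<lambda>x. - y' x" and b=x3 and \<delta>=\<eta> and C=0])
        fix x assume x: "x \<le> x3"
        show "((\<lambda>x. - y x) has_real_derivative - y' x) (at x)"
          using x x3 x2 X1 by (intro DERIV_minus y) auto
        show "- y x \<le> 0" using y0[of x] x x3 x2 by simp
        have "exp (2 * x) \<le> \<eta> / D" using x \<eta> D by (intro exp_double_le) (auto simp: x3_def)
        then have e: "D * exp (2 * x) \<le> \<eta>" using D by (simp add: field_simps)
        have yx: "0 \<le> y x" "y x \<le> m - \<delta>" using y0[of x] pers[of x] x x3 x2 by auto
        have "(y x)\<^sup>2 \<le> m * (m - \<delta>)"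
          unfolding power2_eq_square using yx \<delta> by (intro mult_mono) auto
        then have "(y x)\<^sup>2 \<le> m\<^sup>2 - 2 * \<eta>" by (simp add: \<eta>_def power2_eq_square algebra_simps)
        moreover have "- (D * exp (2 * x)) \<le> exp (2 * x) * V x" using eV[of x] x x3 x2 X1 by (auto simp: abs_le_iff)
        ultimately show "- y' x \<le> - \<eta>" using e unfolding y'_def by linarith
      qed (rule \<eta>)
    qed
    have "\<forall>x\<le>X1. \<bar>y x - m\<bar> \<le> D * exp (2 * x)"
      using upper lower X1 by (force simp: abs_le_iff)
    then show ?thesis unfolding y_def by blast
  next
    case True
    \<comment> \<open>For m = 0 the Riccati equation has no restoring term from below. Instead p'' =
      exp (2x) V p is used directly: p' >= -E exp (2x), since otherwise p would be unbounded
      backwards. Division by a positive lower bound of p gives the estimate for y.\<close>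
    define E where "E = D * (C + 1)"
    have C0: "C > 0" using pos[of X0] pC[of X0] by linarith
    have E: "E > 0" using D C0 by (simp add: E_def)
    have p'low: "p' x2 \<ge> - E * exp (2 * x2)" if x2: "x2 \<le> X0" for x2
    proof (rule ccontr)
      assume "\<not> ?thesis"
      then have gt: "- p' x2 - E * exp (2 * x2) > 0" by simp
      show False
      proof (rule no_backward_growth[where f=p and f'=p' and b=x2 and \<delta>="- p' x2 - E * exp (2 * x2)" and C=C])
        fix x assume x: "x \<le> x2"
        have "- p' x2 - E * exp (2 * x2) \<le> - p' x - E * exp (2 * x)"
        proof (rule backward_positive[where f="\<lambda>x. - p' x - E * exp (2 * x)" and b=x2, OF _ _ gt x])
          fix z assume z: "z \<le> x2"
          show "((\<lambda>x. - p' x - E * exp (2 * x)) has_real_derivative - ((m\<^sup>2 + exp (2 * z) * V z) * p z) - 2 * E * exp (2 * z)) (at z)"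
            using z x2 by (intro DERIV_diff DERIV_minus p' de) auto
          have "\<bar>exp (2 * z) * V z * p z\<bar> \<le> D * exp (2 * z) * C"
            using eV[of z] pC[of z] pos[of z] z x2 unfolding abs_mult[of _ "p z"] by (intro mult_mono) auto
          also have "\<dots> \<le> E * exp (2 * z)" using D by (simp add: E_def algebra_simps)
          finally have "- (exp (2 * z) * V z * p z) \<le> E * exp (2 * z)" by (auto simp: abs_le_iff)
          moreover have "E * exp (2 * z) \<ge> 0" using E by simp
          ultimately show "- ((m\<^sup>2 + exp (2 * z) * V z) * p z) - 2 * E * exp (2 * z) \<le> 0"
            using True by simp
        qed
        moreover have "E * exp (2 * x) \<ge> 0" using E by simp
        ultimately show "p' x \<le> - (- p' x2 - E * exp (2 * x2))" by linarith
      qed (use gt p pC x2 in auto)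
    qed
    \<comment> \<open>Integrating the upper bound y <= D exp (2x) from x to \<open>X0\<close> keeps
      p above this value.\<close>
    define c where "c = p X0 * exp (- (D / 2 * exp (2 * X0)))"
    have c0: "c > 0" using pos[of X0] by (simp add: c_def)
    have plow: "p x \<ge> c" if x: "x \<le> X0" for x
    proof -
      have "ln (p X0) - D / 2 * exp (2 * X0) \<le> ln (p x) - D / 2 * exp (2 * x)"
      proof (rule DERIV_nonpos_imp_nonincreasing[OF x])
        fix z assume z: "x \<le> z" "z \<le> X0"
        have "((\<lambda>x. ln (p x) - D / 2 * exp (2 * x)) has_real_derivative y z - 2 * (D / 2) * exp (2 * z)) (at z)"
          using z pos[of z] unfolding y_def
          by (intro DERIV_diff de) (auto intro!: derivative_eq_intros p)
        moreover have "y z - 2 * (D / 2) * exp (2 * z) \<le> 0" using upper[of z] z True by simp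
        ultimately show "\<exists>y. ((\<lambda>x. ln (p x) - D / 2 * exp (2 * x)) has_real_derivative y) (at z) \<and> y \<le> 0" by blast
      qed
      moreover have "D / 2 * exp (2 * x) \<ge> 0" using D by simp
      ultimately have "ln (p X0) - D / 2 * exp (2 * X0) \<le> ln (p x)" by linarith
      then have "exp (ln (p X0) - D / 2 * exp (2 * X0)) \<le> exp (ln (p x))" by simp
      moreover have "exp (ln (p X0) - D / 2 * exp (2 * X0)) = c"
      proof -
        have "exp (ln (p X0)) = p X0" using pos[of X0] by simp
        then show ?thesis unfolding c_def diff_conv_add_uminus exp_add by (rule arg_cong)
      qed
      moreover have "exp (ln (p x)) = p x" using pos[OF x] by simp
      ultimately show ?thesis by simp
    qed
    have "\<bar>y x - m\<bar> \<le> (D + E / c) * exp (2 * x)" if x: "x \<le> X0" for x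
    proof -
      have "y x \<ge> - (E / c) * exp (2 * x)"
      proof -
        have "- E * exp (2 * x) / p x \<le> y x" unfolding y_def using p'low[OF x] pos[OF x] by (intro divide_right_mono) auto
        moreover have "E * exp (2 * x) / p x \<le> E * exp (2 * x) / c"
          using plow[OF x] c0 E by (intro divide_left_mono) auto
        ultimately show ?thesis by simp
      qed
      moreover have "0 \<le> E / c * exp (2 * x)" "0 \<le> D * exp (2 * x)" using E c0 D by auto
      ultimately show ?thesis using upper[OF x] True by (simp add: abs_le_iff distrib_right)
    qed
    then show ?thesis unfolding y_def by blast
  qed
qed

section \<open>The quadratic form of the potential, the Picone quantity and uniqueness\<close>

lemma potential_bounded:
  fixes p q :: real
  assumes "\<bar>p\<bar> \<le> C" "\<bar>q\<bar> \<le> C"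
  shows "\<bar>A * (p\<^sup>2 - s\<^sup>2) + B * (q\<^sup>2 - t\<^sup>2)\<bar> \<le> (\<bar>A\<bar> + \<bar>B\<bar>) * (2 * C\<^sup>2 + s\<^sup>2 + t\<^sup>2)"
proof -
  have "p\<^sup>2 \<le> C\<^sup>2" "q\<^sup>2 \<le> C\<^sup>2" using assms by (auto simp: abs_le_square_iff[symmetric])
  moreover have "0 \<le> p\<^sup>2" "0 \<le> q\<^sup>2" "0 \<le> s\<^sup>2" "0 \<le> t\<^sup>2" "0 \<le> C\<^sup>2" by auto
  ultimately have "\<bar>p\<^sup>2 - s\<^sup>2\<bar> \<le> 2 * C\<^sup>2 + s\<^sup>2 + t\<^sup>2" "\<bar>q\<^sup>2 - t\<^sup>2\<bar> \<le> 2 * C\<^sup>2 + s\<^sup>2 + t\<^sup>2" by linarith+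
  then have "\<bar>A\<bar> * \<bar>p\<^sup>2 - s\<^sup>2\<bar> \<le> \<bar>A\<bar> * (2 * C\<^sup>2 + s\<^sup>2 + t\<^sup>2)" "\<bar>B\<bar> * \<bar>q\<^sup>2 - t\<^sup>2\<bar> \<le> \<bar>B\<bar> * (2 * C\<^sup>2 + s\<^sup>2 + t\<^sup>2)"
    by (auto intro!: mult_left_mono)
  moreover have "\<bar>A * (p\<^sup>2 - s\<^sup>2) + B * (q\<^sup>2 - t\<^sup>2)\<bar> \<le> \<bar>A\<bar> * \<bar>p\<^sup>2 - s\<^sup>2\<bar> + \<bar>B\<bar> * \<bar>q\<^sup>2 - t\<^sup>2\<bar>"
    by (metis abs_mult abs_triangle_ineq)
  ultimately show ?thesis by (simp only: distrib_right)
qed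

text \<open>For the symmetric matrix S of the form, Cayley-Hamilton reads tr(S) S - det(S) I = S^2,
  so tr(S) times the form minus det(S) (a^2 + b^2) is the square |S (a, b)|^2. Hence determinant
  over trace is a lower bound.\<close>

lemma positive_definite_form:
  fixes A A' B a b :: real
  assumes "A > 0" "A' > 0"
  shows "(A * A' - B\<^sup>2) / (A + A') * (a\<^sup>2 + b\<^sup>2) \<le> A * a\<^sup>2 + 2 * B * a * b + A' * b\<^sup>2"
proof -
  have "(A + A') * (A * a\<^sup>2 + 2 * B * a * b + A' * b\<^sup>2) - (A * A' - B\<^sup>2) * (a\<^sup>2 + b\<^sup>2)
      = (A * a + B * b)\<^sup>2 + (B * a + A' * b)\<^sup>2" by (simp add: power2_eq_square algebra_simps)
  then have "(A * A' - B\<^sup>2) * (a\<^sup>2 + b\<^sup>2) \<le> (A + A') * (A * a\<^sup>2 + 2 * B * a * b + A' * b\<^sup>2)"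
    by (smt (verit) zero_le_power2)
  then show ?thesis using assms by (simp add: pos_divide_le_eq mult.commute)
qed

text \<open>The constant \<open>c\<close>, which will be m^2 or n^2, cancels in the difference. The
  terms quadratic in a = p1'/p1 and b = p2'/p2 combine to (p1^2 + p2^2) (a - b)^2, so only the
  potentials lack a sign; they get one after the two components are added.\<close>

lemma picone_derivative:
  fixes p1 p2 :: "real \<Rightarrow> real"
  assumes p1: "(p1 has_real_derivative p1' x) (at x)" "(p1' has_real_derivative (c + W1) * p1 x) (at x)"
    and p2: "(p2 has_real_derivative p2' x) (at x)" "(p2' has_real_derivative (c + W2) * p2 x) (at x)"
    and pos: "p1 x > 0" "p2 x > 0"
  shows "((\<lambda>x. (p1' x / p1 x - p2' x / p2 x) * ((p1 x)\<^sup>2 - (p2 x)\<^sup>2)) has_real_derivative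
     (W1 - W2) * ((p1 x)\<^sup>2 - (p2 x)\<^sup>2) + ((p1 x)\<^sup>2 + (p2 x)\<^sup>2) * (p1' x / p1 x - p2' x / p2 x)\<^sup>2) (at x)"
proof -
  define a where "a = p1' x / p1 x"
  define b where "b = p2' x / p2 x"
  have ab: "p1' x = a * p1 x" "p2' x = b * p2 x" using pos by (auto simp: a_def b_def)
  have 1: "((\<lambda>x. p1' x / p1 x) has_real_derivative (c + W1) - a\<^sup>2) (at x)"
    using pos by (auto intro!: derivative_eq_intros p1 simp: ab power2_eq_square field_simps)
  have 2: "((\<lambda>x. p2' x / p2 x) has_real_derivative (c + W2) - b\<^sup>2) (at x)"
    using pos by (auto intro!: derivative_eq_intros p2 simp: ab power2_eq_square field_simps)
  have 3: "((\<lambda>x. (p1 x)\<^sup>2 - (p2 x)\<^sup>2) has_real_derivative 2 * a * (p1 x)\<^sup>2 - 2 * b * (p2 x)\<^sup>2) (at x)"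
    by (auto intro!: derivative_eq_intros p1 p2 simp: ab power2_eq_square)
  have "((\<lambda>x. (p1' x / p1 x - p2' x / p2 x) * ((p1 x)\<^sup>2 - (p2 x)\<^sup>2)) has_real_derivative
      ((c + W1) - a\<^sup>2 - ((c + W2) - b\<^sup>2)) * ((p1 x)\<^sup>2 - (p2 x)\<^sup>2)
      + (2 * a * (p1 x)\<^sup>2 - 2 * b * (p2 x)\<^sup>2) * (p1' x / p1 x - p2' x / p2 x)) (at x)"
    by (intro DERIV_mult DERIV_diff 1 2 3)
  moreover have "((c + W1) - a\<^sup>2 - ((c + W2) - b\<^sup>2)) * ((p1 x)\<^sup>2 - (p2 x)\<^sup>2)
      + (2 * a * (p1 x)\<^sup>2 - 2 * b * (p2 x)\<^sup>2) * (a - b)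
     = (W1 - W2) * ((p1 x)\<^sup>2 - (p2 x)\<^sup>2) + ((p1 x)\<^sup>2 + (p2 x)\<^sup>2) * (a - b)\<^sup>2"
    by (simp add: power2_eq_square algebra_simps)
  ultimately show ?thesis unfolding a_def b_def by simp
qed

text \<open>The antiderivative (M/2) exp (2x) of the bound controls f from both sides; X >= 0 lets
  the constant |f X| be absorbed into the exponential.\<close>

lemma derivative_growth:
  fixes f f' :: "real \<Rightarrow> real"
  assumes f: "\<And>x. x \<ge> X \<Longrightarrow> (f has_real_derivative f' x) (at x)"
    and f': "\<And>x. x \<ge> X \<Longrightarrow> \<bar>f' x\<bar> \<le> M * exp (2 * x)" and X: "X \<ge> 0" and x: "x \<ge> X"
  shows "\<bar>f x\<bar> \<le> (\<bar>f X\<bar> + M) * exp (2 * x)"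
proof -
  have M: "M \<ge> 0" using f'[of X] by (smt (verit) exp_gt_zero mult_neg_pos)
  have de: "((\<lambda>x. M / 2 * exp (2 * x)) has_real_derivative M * exp (2 * x)) (at x)" for x
    by (auto intro!: derivative_eq_intros)
  have "f x - M / 2 * exp (2 * x) \<le> f X - M / 2 * exp (2 * X)"
  proof (rule DERIV_nonpos_imp_nonincreasing[OF x])
    fix z assume "X \<le> z" "z \<le> x"
    then show "\<exists>y. ((\<lambda>x. f x - M / 2 * exp (2 * x)) has_real_derivative y) (at z) \<and> y \<le> 0"
      using f'[of z] by (intro exI[of _ "f' z - M * exp (2 * z)"] conjI DERIV_diff f de) (auto simp: abs_le_iff)
  qed
  moreover have "f X + M / 2 * exp (2 * X) \<le> f x + M / 2 * exp (2 * x)"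
  proof (rule DERIV_nonneg_imp_nondecreasing[OF x])
    fix z assume "X \<le> z" "z \<le> x"
    then show "\<exists>y. ((\<lambda>x. f x + M / 2 * exp (2 * x)) has_real_derivative y) (at z) \<and> 0 \<le> y"
      using f'[of z] by (intro exI[of _ "f' z + M * exp (2 * z)"] conjI DERIV_add f de) (auto simp: abs_le_iff)
  qed
  moreover have "M / 2 * exp (2 * X) \<ge> 0" "M / 2 * exp (2 * x) \<ge> 0" using M by auto
  moreover have "M / 2 * exp (2 * X) \<le> M / 2 * exp (2 * x)" using M x by (intro mult_left_mono) auto
  ultimately have "\<bar>f x\<bar> \<le> \<bar>f X\<bar> + M * exp (2 * x)" by (simp add: abs_le_iff) linarith
  moreover have "\<bar>f X\<bar> * 1 \<le> \<bar>f X\<bar> * exp (2 * x)" using x X by (intro mult_left_mono) auto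
  ultimately show ?thesis by (simp add: distrib_right)
qed

text \<open>Near plus infinity only exp (2x) growth of the logarithmic derivatives is used. It
  suffices because the interaction part of \<open>G'\<close> carries the factor exp (2x): together
  with the squares of \<open>y\<close> and \<open>z\<close>, Young's inequality gives G' >= 3 G for
  large x, and a positive G growing like exp (3x) contradicts |G| <= D exp (2x).\<close>

theorem profile_pair_unique:
  fixes p1 q1 p2 q2 :: "real \<Rightarrow> real"
  assumes A: "A > 0" "A' > 0" and AB: "A * A' - B\<^sup>2 > 0" and mn: "m \<ge> 0" "n \<ge> 0"
    and pp1: "profile_pair A A' B s t m n p1 q1" and pp2: "profile_pair A A' B s t m n p2 q2"
  shows "p1 = p2 \<and> q1 = q2"
proof -
  define V where "V p q x = A * ((p x)\<^sup>2 - s\<^sup>2) + B * ((q x)\<^sup>2 - t\<^sup>2)" for p q :: "real \<Rightarrow> real" and x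
  define V' where "V' p q x = A' * ((q x)\<^sup>2 - t\<^sup>2) + B * ((p x)\<^sup>2 - s\<^sup>2)" for p q :: "real \<Rightarrow> real" and x
  \<comment> \<open>Collects the facts about one solution, with constants common to both components,
    so that they are derived once and used for both solutions.\<close>
  define Data where "Data p q p' q' C c D \<longleftrightarrow> c > 0 \<and>
      (\<forall>x. (p has_real_derivative p' x) (at x) \<and> (p' has_real_derivative (m\<^sup>2 + exp (2 * x) * V p q x) * p x) (at x) \<and>
        (q has_real_derivative q' x) (at x) \<and> (q' has_real_derivative (n\<^sup>2 + exp (2 * x) * V' p q x) * q x) (at x) \<and>
        0 < p x \<and> p x \<le> C \<and> 0 < q x \<and> q x \<le> C) \<and>
      (\<forall>\<^sub>F x in at_bot. \<bar>p' x / p x - m\<bar> \<le> D * exp (2 * x) \<and> \<bar>q' x / q x - n\<bar> \<le> D * exp (2 * x)) \<and>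
      (\<forall>\<^sub>F x in at_top. c \<le> p x \<and> c \<le> q x) \<and>
      (\<forall>\<^sub>F x in at_top. \<bar>p' x / p x\<bar> \<le> D * exp (2 * x) \<and> \<bar>q' x / q x\<bar> \<le> D * exp (2 * x))"
    for p q p' q' :: "real \<Rightarrow> real" and C c D :: real
  have data: "\<exists>p' q' C c D. Data p q p' q' C c D"
    if pp: "profile_pair A A' B s t m n p q" for p q
  proof -
    from pp obtain p' q' C c where
      d: "\<And>x. (p has_real_derivative p' x) (at x)" "\<And>x. (p' has_real_derivative reaction A B s t m x (p x) (q x)) (at x)"
        "\<And>x. (q has_real_derivative q' x) (at x)" "\<And>x. (q' has_real_derivative reaction A' B t s n x (q x) (p x)) (at x)"
      and pos: "\<And>x. 0 < p x" "\<And>x. 0 < q x" and le: "\<And>x. p x \<le> C" "\<And>x. q x \<le> C"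
      and c: "c > 0" "\<forall>\<^sub>F x in at_top. c \<le> p x \<and> c \<le> q x"
      unfolding profile_pair_def has_second_deriv_def by blast
    have r: "reaction A B s t m x (p x) (q x) = (m\<^sup>2 + exp (2 * x) * V p q x) * p x"
      "reaction A' B t s n x (q x) (p x) = (n\<^sup>2 + exp (2 * x) * V' p q x) * q x" for x
      by (simp_all add: reaction_def V_def V'_def)
    define K where "K = (\<bar>A\<bar> + \<bar>B\<bar>) * (2 * C\<^sup>2 + s\<^sup>2 + t\<^sup>2) + (\<bar>A'\<bar> + \<bar>B\<bar>) * (2 * C\<^sup>2 + t\<^sup>2 + s\<^sup>2)"
    have VK: "\<bar>V p q x\<bar> \<le> K" "\<bar>V' p q x\<bar> \<le> K" for x
    proof -
      have C: "\<bar>p x\<bar> \<le> C" "\<bar>q x\<bar> \<le> C" using pos[of x] le[of x] by (auto simp: abs_le_iff)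
      have "(\<bar>A\<bar> + \<bar>B\<bar>) * (2 * C\<^sup>2 + s\<^sup>2 + t\<^sup>2) \<ge> 0" "(\<bar>A'\<bar> + \<bar>B\<bar>) * (2 * C\<^sup>2 + t\<^sup>2 + s\<^sup>2) \<ge> 0" by auto
      then show "\<bar>V p q x\<bar> \<le> K" "\<bar>V' p q x\<bar> \<le> K"
        using potential_bounded[OF C, of A s B t] potential_bounded[OF C(2,1), of A' t B s]
        unfolding V_def V'_def K_def by linarith+
    qed
    obtain D1 X1 where 1: "\<And>x. x \<le> X1 \<Longrightarrow> \<bar>p' x / p x - m\<bar> \<le> D1 * exp (2 * x)"
      using log_derivative_at_bot[of 0 p p' m "V p q" K C] d r VK pos le mn by auto
    obtain D2 X2 where 2: "\<And>x. x \<le> X2 \<Longrightarrow> \<bar>q' x / q x - n\<bar> \<le> D2 * exp (2 * x)"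
      using log_derivative_at_bot[of 0 q q' n "V' p q" K C] d r VK pos le mn by auto
    obtain X where X: "X \<ge> 0" "\<And>x. x \<ge> X \<Longrightarrow> c \<le> p x" "\<And>x. x \<ge> X \<Longrightarrow> c \<le> q x"
    proof -
      obtain Y where "\<And>x. x \<ge> Y \<Longrightarrow> c \<le> p x \<and> c \<le> q x" using c(2) by (auto simp: eventually_at_top_linorder)
      then show ?thesis by (intro that[of "max 0 Y"]) auto
    qed
    define M where "M = (m\<^sup>2 + n\<^sup>2 + K) * C"
    have C0: "C > 0" using pos(1)[of 0] le(1)[of 0] by linarith
    have K0: "K \<ge> 0" using VK(1)[of 0] by linarith
    have rb: "\<bar>(a\<^sup>2 + exp (2 * x) * v) * u\<bar> \<le> M * exp (2 * x)" if "x \<ge> X" "\<bar>v\<bar> \<le> K" "0 < u" "u \<le> C" "a\<^sup>2 \<le> m\<^sup>2 + n\<^sup>2" for a x u v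
    proof -
      have e: "1 \<le> exp (2 * x)" using that X by simp
      have "(m\<^sup>2 + n\<^sup>2) * 1 \<le> (m\<^sup>2 + n\<^sup>2) * exp (2 * x)" using e by (intro mult_left_mono) auto
      moreover have "\<bar>exp (2 * x) * v\<bar> \<le> exp (2 * x) * K" using that by (simp add: abs_mult)
      ultimately have "\<bar>a\<^sup>2 + exp (2 * x) * v\<bar> \<le> (m\<^sup>2 + n\<^sup>2) * exp (2 * x) + exp (2 * x) * K"
        using that(5) by (smt (verit) zero_le_power2)
      then have "\<bar>a\<^sup>2 + exp (2 * x) * v\<bar> * \<bar>u\<bar> \<le> ((m\<^sup>2 + n\<^sup>2) * exp (2 * x) + exp (2 * x) * K) * C"
        using that by (intro mult_mono) auto
      also have "\<dots> = M * exp (2 * x)" by (simp add: M_def algebra_simps)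
      finally show ?thesis by (simp add: abs_mult)
    qed
    have gp: "\<bar>p' x\<bar> \<le> (\<bar>p' X\<bar> + M) * exp (2 * x)" if "x \<ge> X" for x
      by (rule derivative_growth[OF _ _ X(1) that]) (use d(2) rb VK pos le in \<open>auto simp: r\<close>)
    have gq: "\<bar>q' x\<bar> \<le> (\<bar>q' X\<bar> + M) * exp (2 * x)" if "x \<ge> X" for x
      by (rule derivative_growth[OF _ _ X(1) that]) (use d(4) rb VK pos le in \<open>auto simp: r\<close>)
    have div: "\<bar>a / b\<bar> \<le> w / c * exp (2 * x)" if "\<bar>a\<bar> \<le> w * exp (2 * x)" "c \<le> b" for a b w x :: real
    proof -
      have "\<bar>a\<bar> / b \<le> w * exp (2 * x) / c" using that c(1) by (intro frac_le) auto
      then show ?thesis using that c(1) by simp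
    qed
    define D where "D = max (max D1 D2) (max ((\<bar>p' X\<bar> + M) / c) ((\<bar>q' X\<bar> + M) / c))"
    have DD: "D1 * exp (2 * x) \<le> D * exp (2 * x)" "D2 * exp (2 * x) \<le> D * exp (2 * x)"
      "(\<bar>p' X\<bar> + M) / c * exp (2 * x) \<le> D * exp (2 * x)" "(\<bar>q' X\<bar> + M) / c * exp (2 * x) \<le> D * exp (2 * x)" for x
      by (rule mult_right_mono; simp add: D_def)+
    have "\<forall>\<^sub>F x in at_bot. \<bar>p' x / p x - m\<bar> \<le> D * exp (2 * x) \<and> \<bar>q' x / q x - n\<bar> \<le> D * exp (2 * x)"
      unfolding eventually_at_bot_linorder
      using 1 2 DD(1,2) by (intro exI[of _ "min X1 X2"]) (meson min.boundedE order_trans)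
    moreover have "\<forall>\<^sub>F x in at_top. \<bar>p' x / p x\<bar> \<le> D * exp (2 * x) \<and> \<bar>q' x / q x\<bar> \<le> D * exp (2 * x)"
      unfolding eventually_at_top_linorder
      using div[OF gp X(2)] div[OF gq X(3)] DD(3,4) by (intro exI[of _ X]) (meson order_trans)
    ultimately have "Data p q p' q' C c D" using c d pos le unfolding r Data_def by blast
    then show ?thesis by blast
  qed
  obtain p1' q1' C1 c1 D1 where "Data p1 q1 p1' q1' C1 c1 D1" using data[OF pp1] by blast
  then have c1: "c1 > 0" and d1: "\<And>x. (p1 has_real_derivative p1' x) (at x)"
     "\<And>x. (p1' has_real_derivative (m\<^sup>2 + exp (2 * x) * V p1 q1 x) * p1 x) (at x)"
     "\<And>x. (q1 has_real_derivative q1' x) (at x)" "\<And>x. (q1' has_real_derivative (n\<^sup>2 + exp (2 * x) * V' p1 q1 x) * q1 x) (at x)"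
     and b1: "\<And>x. 0 < p1 x" "\<And>x. p1 x \<le> C1" "\<And>x. 0 < q1 x" "\<And>x. q1 x \<le> C1"
     and e1: "\<forall>\<^sub>F x in at_bot. \<bar>p1' x / p1 x - m\<bar> \<le> D1 * exp (2 * x) \<and> \<bar>q1' x / q1 x - n\<bar> \<le> D1 * exp (2 * x)"
      "\<forall>\<^sub>F x in at_top. c1 \<le> p1 x \<and> c1 \<le> q1 x"
      "\<forall>\<^sub>F x in at_top. \<bar>p1' x / p1 x\<bar> \<le> D1 * exp (2 * x) \<and> \<bar>q1' x / q1 x\<bar> \<le> D1 * exp (2 * x)"
    unfolding Data_def by blast+
  obtain p2' q2' C2 c2 D2 where "Data p2 q2 p2' q2' C2 c2 D2" using data[OF pp2] by blast
  then have c2: "c2 > 0" and d2: "\<And>x. (p2 has_real_derivative p2' x) (at x)"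
     "\<And>x. (p2' has_real_derivative (m\<^sup>2 + exp (2 * x) * V p2 q2 x) * p2 x) (at x)"
     "\<And>x. (q2 has_real_derivative q2' x) (at x)" "\<And>x. (q2' has_real_derivative (n\<^sup>2 + exp (2 * x) * V' p2 q2 x) * q2 x) (at x)"
     and b2: "\<And>x. 0 < p2 x" "\<And>x. p2 x \<le> C2" "\<And>x. 0 < q2 x" "\<And>x. q2 x \<le> C2"
     and e2: "\<forall>\<^sub>F x in at_bot. \<bar>p2' x / p2 x - m\<bar> \<le> D2 * exp (2 * x) \<and> \<bar>q2' x / q2 x - n\<bar> \<le> D2 * exp (2 * x)"
      "\<forall>\<^sub>F x in at_top. c2 \<le> p2 x \<and> c2 \<le> q2 x"
      "\<forall>\<^sub>F x in at_top. \<bar>p2' x / p2 x\<bar> \<le> D2 * exp (2 * x) \<and> \<bar>q2' x / q2 x\<bar> \<le> D2 * exp (2 * x)"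
    unfolding Data_def by blast+
  define P where "P x = (p1 x)\<^sup>2 - (p2 x)\<^sup>2" for x
  define Q where "Q x = (q1 x)\<^sup>2 - (q2 x)\<^sup>2" for x
  define y where "y x = p1' x / p1 x - p2' x / p2 x" for x
  define z where "z x = q1' x / q1 x - q2' x / q2 x" for x
  define G where "G x = y x * P x + z x * Q x" for x
  define F where "F x = A * (P x)\<^sup>2 + 2 * B * P x * Q x + A' * (Q x)\<^sup>2" for x
  define G' where "G' x = exp (2 * x) * F x + ((p1 x)\<^sup>2 + (p2 x)\<^sup>2) * (y x)\<^sup>2 + ((q1 x)\<^sup>2 + (q2 x)\<^sup>2) * (z x)\<^sup>2" for x
  have dG: "(G has_real_derivative G' x) (at x)" for x
  proof -
    have "(G has_real_derivative
       ((exp (2 * x) * V p1 q1 x - exp (2 * x) * V p2 q2 x) * P x + ((p1 x)\<^sup>2 + (p2 x)\<^sup>2) * (y x)\<^sup>2) +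
       ((exp (2 * x) * V' p1 q1 x - exp (2 * x) * V' p2 q2 x) * Q x + ((q1 x)\<^sup>2 + (q2 x)\<^sup>2) * (z x)\<^sup>2)) (at x)"
      unfolding G_def[abs_def] y_def P_def z_def Q_def
      by (rule DERIV_add[OF picone_derivative[OF d1(1,2) d2(1,2) b1(1) b2(1)]
            picone_derivative[OF d1(3,4) d2(3,4) b1(3) b2(3)]])
    moreover have "((exp (2 * x) * V p1 q1 x - exp (2 * x) * V p2 q2 x) * P x + ((p1 x)\<^sup>2 + (p2 x)\<^sup>2) * (y x)\<^sup>2) +
       ((exp (2 * x) * V' p1 q1 x - exp (2 * x) * V' p2 q2 x) * Q x + ((q1 x)\<^sup>2 + (q2 x)\<^sup>2) * (z x)\<^sup>2) = G' x"
      unfolding G'_def F_def V_def V'_def P_def Q_def by (simp add: algebra_simps power2_eq_square)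
    ultimately show ?thesis by simp
  qed
  define l where "l = (A * A' - B\<^sup>2) / (A + A')"
  have l: "l > 0" using A AB by (simp add: l_def)
  have F: "l * ((P x)\<^sup>2 + (Q x)\<^sup>2) \<le> F x" for x
    unfolding l_def F_def by (rule positive_definite_form[OF A])
  have F0: "F x \<ge> 0" for x using F[of x] l by (smt (verit) mult_nonneg_nonneg zero_le_power2)
  have G'0: "G' x \<ge> 0" for x unfolding G'_def using F0 by (intro add_nonneg_nonneg mult_nonneg_nonneg) auto
  have mono: "G a \<le> G b" if "a \<le> b" for a b
    by (rule DERIV_nonneg_imp_nondecreasing[OF that]) (use dG G'0 in blast)
  define C where "C = C1\<^sup>2 + C2\<^sup>2"
  have PQ: "\<bar>P x\<bar> \<le> C" "\<bar>Q x\<bar> \<le> C" for x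
  proof -
    have "(p1 x)\<^sup>2 \<le> C1\<^sup>2" "(q1 x)\<^sup>2 \<le> C1\<^sup>2" "(p2 x)\<^sup>2 \<le> C2\<^sup>2" "(q2 x)\<^sup>2 \<le> C2\<^sup>2"
      using b1 b2 by (auto intro!: power_mono simp: less_imp_le)
    moreover have "0 \<le> (p1 x)\<^sup>2" "0 \<le> (q1 x)\<^sup>2" "0 \<le> (p2 x)\<^sup>2" "0 \<le> (q2 x)\<^sup>2" by auto
    ultimately show "\<bar>P x\<bar> \<le> C" "\<bar>Q x\<bar> \<le> C" unfolding P_def Q_def C_def by linarith+
  qed
  define D where "D = 2 * (\<bar>D1\<bar> + \<bar>D2\<bar>) * C + 1"
  have C0: "C \<ge> 0" by (simp add: C_def)
  have D0: "D > 0" using C0 by (simp add: D_def add_nonneg_pos)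
  have GD: "\<bar>G x\<bar> \<le> D * exp (2 * x)" if "\<bar>y x\<bar> \<le> (\<bar>D1\<bar> + \<bar>D2\<bar>) * exp (2 * x)" "\<bar>z x\<bar> \<le> (\<bar>D1\<bar> + \<bar>D2\<bar>) * exp (2 * x)" for x
  proof -
    have "\<bar>y x\<bar> * \<bar>P x\<bar> \<le> (\<bar>D1\<bar> + \<bar>D2\<bar>) * exp (2 * x) * C" "\<bar>z x\<bar> * \<bar>Q x\<bar> \<le> (\<bar>D1\<bar> + \<bar>D2\<bar>) * exp (2 * x) * C"
      using that PQ by (auto intro!: mult_mono)
    moreover have "\<bar>G x\<bar> \<le> \<bar>y x\<bar> * \<bar>P x\<bar> + \<bar>z x\<bar> * \<bar>Q x\<bar>" unfolding G_def by (metis abs_mult abs_triangle_ineq)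
    ultimately have "\<bar>G x\<bar> \<le> 2 * ((\<bar>D1\<bar> + \<bar>D2\<bar>) * exp (2 * x) * C)" by linarith
    also have "\<dots> \<le> D * exp (2 * x)" by (simp add: D_def algebra_simps)
    finally show ?thesis .
  qed
  have dle: "\<bar>a - b\<bar> \<le> (\<bar>D1\<bar> + \<bar>D2\<bar>) * e" if "\<bar>a - k\<bar> \<le> D1 * e" "\<bar>b - k\<bar> \<le> D2 * e" "e > 0" for a b k e :: real
  proof -
    have "D1 * e \<le> \<bar>D1\<bar> * e" "D2 * e \<le> \<bar>D2\<bar> * e" using that(3) by auto
    then show ?thesis using that(1,2) unfolding distrib_right by linarith
  qed
  have "\<forall>\<^sub>F x in at_bot. \<bar>G x\<bar> \<le> D * exp (2 * x)"
    using e1(1) e2(1)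
  proof eventually_elim
    case (elim x)
    show ?case
    proof (rule GD)
      show "\<bar>y x\<bar> \<le> (\<bar>D1\<bar> + \<bar>D2\<bar>) * exp (2 * x)" unfolding y_def
        by (rule dle[OF conjunct1[OF elim(1)] conjunct1[OF elim(2)] exp_gt_zero])
      show "\<bar>z x\<bar> \<le> (\<bar>D1\<bar> + \<bar>D2\<bar>) * exp (2 * x)" unfolding z_def
        by (rule dle[OF conjunct2[OF elim(1)] conjunct2[OF elim(2)] exp_gt_zero])
    qed
  qed
  then obtain X where X: "\<And>x. x \<le> X \<Longrightarrow> \<bar>G x\<bar> \<le> D * exp (2 * x)" by (auto simp: eventually_at_bot_linorder)
  have Gnn: "G x \<ge> 0" for x
  proof (rule ccontr)
    assume n: "\<not> G x \<ge> 0"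
    \<comment> \<open>Far enough to the left for D exp (2w) to be at most half of -G x, while
      monotonicity keeps G w below G x.\<close>
    define w where "w = min (min x X) (ln (- G x / (2 * D)) / 2)"
    have "exp (2 * w) \<le> - G x / (2 * D)" using n D0 by (intro exp_double_le divide_pos_pos) (auto simp: w_def)
    then have "2 * (D * exp (2 * w)) \<le> - G x" using D0 by (simp add: field_simps)
    moreover have "G w \<le> G x" by (rule mono) (simp add: w_def)
    moreover have "\<bar>G w\<bar> \<le> D * exp (2 * w)" by (rule X) (simp add: w_def)
    ultimately show False using n by linarith
  qed
  define c where "c = min c1 c2"
  have c: "c > 0" using c1 c2 by (simp add: c_def)
  have "\<forall>\<^sub>F x in at_top. \<bar>G x\<bar> \<le> D * exp (2 * x)"
    using e1(3) e2(3)
  proof eventually_elim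
    case (elim x)
    then have e: "\<bar>p1' x / p1 x - 0\<bar> \<le> D1 * exp (2 * x)" "\<bar>p2' x / p2 x - 0\<bar> \<le> D2 * exp (2 * x)"
      "\<bar>q1' x / q1 x - 0\<bar> \<le> D1 * exp (2 * x)" "\<bar>q2' x / q2 x - 0\<bar> \<le> D2 * exp (2 * x)" by auto
    show ?case
    proof (rule GD)
      show "\<bar>y x\<bar> \<le> (\<bar>D1\<bar> + \<bar>D2\<bar>) * exp (2 * x)" unfolding y_def by (rule dle[OF e(1,2) exp_gt_zero])
      show "\<bar>z x\<bar> \<le> (\<bar>D1\<bar> + \<bar>D2\<bar>) * exp (2 * x)" unfolding z_def by (rule dle[OF e(3,4) exp_gt_zero])
    qed
  qed
  moreover have "\<forall>\<^sub>F x in at_top. c \<le> p1 x \<and> c \<le> p2 x \<and> c \<le> q1 x \<and> c \<le> q2 x"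
    using e1(2) e2(2) by eventually_elim (auto simp: c_def)
  \<comment> \<open>The threshold for Young's inequality with the factor 3: the product of the
    coefficients 2 c^2 and exp (2x) l has to be at least 9/4.\<close>
  moreover have "\<forall>\<^sub>F x in at_top. 9 / (8 * c\<^sup>2 * l) < exp (2 * x)"
  proof -
    have "filterlim (\<lambda>x::real. exp (2 * x)) at_top at_top"
      by (intro filterlim_compose[OF exp_at_top] filterlim_tendsto_pos_mult_at_top[OF tendsto_const] filterlim_ident) simp
    then show ?thesis by (simp add: filterlim_at_top_dense)
  qed
  ultimately have "\<forall>\<^sub>F x in at_top. \<bar>G x\<bar> \<le> D * exp (2 * x) \<and> (c \<le> p1 x \<and> c \<le> p2 x \<and> c \<le> q1 x \<and> c \<le> q2 x)
     \<and> 9 / (8 * c\<^sup>2 * l) < exp (2 * x)" by eventually_elim blast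
  then obtain Y where Y: "\<And>x. x \<ge> Y \<Longrightarrow> \<bar>G x\<bar> \<le> D * exp (2 * x)"
     "\<And>x. x \<ge> Y \<Longrightarrow> c \<le> p1 x \<and> c \<le> p2 x \<and> c \<le> q1 x \<and> c \<le> q2 x" "\<And>x. x \<ge> Y \<Longrightarrow> 9 / (8 * c\<^sup>2 * l) < exp (2 * x)"
    unfolding eventually_at_top_linorder by blast
  have young: "3 * (u * v) \<le> a * u\<^sup>2 + b * v\<^sup>2" if "9 \<le> 4 * a * b" "a > 0" for a b u v :: real
  proof -
    have "0 \<le> (2 * a * u - 3 * v)\<^sup>2 + (4 * a * b - 9) * v\<^sup>2" using that by simp
    also have "\<dots> = 4 * a * (a * u\<^sup>2 + b * v\<^sup>2 - 3 * (u * v))" by (simp add: power2_eq_square algebra_simps)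
    finally have "0 \<le> a * u\<^sup>2 + b * v\<^sup>2 - 3 * (u * v)" using that(2) by (simp add: zero_le_mult_iff)
    then show ?thesis by simp
  qed
  have grow: "3 * G x \<le> G' x" if x: "x \<ge> Y" for x
  proof -
    have "9 < 8 * c\<^sup>2 * l * exp (2 * x)" using Y(3)[OF x] c l by (simp add: field_simps)
    then have nine: "9 \<le> 4 * (2 * c\<^sup>2) * (exp (2 * x) * l)" by (simp add: mult_ac)
    have c2: "2 * c\<^sup>2 > 0" using c by simp
    have y1: "3 * (y x * P x) \<le> 2 * c\<^sup>2 * (y x)\<^sup>2 + exp (2 * x) * l * (P x)\<^sup>2" by (rule young[OF nine c2])
    have y2: "3 * (z x * Q x) \<le> 2 * c\<^sup>2 * (z x)\<^sup>2 + exp (2 * x) * l * (Q x)\<^sup>2" by (rule young[OF nine c2])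
    have "c\<^sup>2 \<le> (p1 x)\<^sup>2" "c\<^sup>2 \<le> (p2 x)\<^sup>2" "c\<^sup>2 \<le> (q1 x)\<^sup>2" "c\<^sup>2 \<le> (q2 x)\<^sup>2"
      using Y(2)[OF x] c by (auto intro!: power_mono)
    then have "2 * c\<^sup>2 * (y x)\<^sup>2 \<le> ((p1 x)\<^sup>2 + (p2 x)\<^sup>2) * (y x)\<^sup>2" "2 * c\<^sup>2 * (z x)\<^sup>2 \<le> ((q1 x)\<^sup>2 + (q2 x)\<^sup>2) * (z x)\<^sup>2"
      by (auto intro!: mult_right_mono)
    moreover have "exp (2 * x) * (l * ((P x)\<^sup>2 + (Q x)\<^sup>2)) \<le> exp (2 * x) * F x"
      using F[of x] by (intro mult_left_mono) auto
    moreover have "exp (2 * x) * (l * ((P x)\<^sup>2 + (Q x)\<^sup>2)) = exp (2 * x) * l * (P x)\<^sup>2 + exp (2 * x) * l * (Q x)\<^sup>2"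
      by (simp add: algebra_simps)
    moreover have "3 * (y x * P x + z x * Q x) = 3 * (y x * P x) + 3 * (z x * Q x)" by (rule distrib_left)
    ultimately show ?thesis using y1 y2 unfolding G'_def G_def by (smt (verit))
  qed
  have Gnp: "G x \<le> 0" if x: "x \<ge> Y" for x
  proof (rule ccontr)
    assume n: "\<not> G x \<le> 0"
    have inc: "G x * exp (-3 * x) \<le> G w * exp (-3 * w)" if "w \<ge> x" for w
    proof (rule DERIV_nonneg_imp_nondecreasing[OF that])
      fix v assume "x \<le> v" "v \<le> w"
      then have "(G' v - 3 * G v) * exp (-3 * v) \<ge> 0" using grow[of v] x by simp
      moreover have "((\<lambda>v. G v * exp (-3 * v)) has_real_derivative (G' v - 3 * G v) * exp (-3 * v)) (at v)"
        by (auto intro!: derivative_eq_intros dG simp: algebra_simps)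
      ultimately show "\<exists>y. ((\<lambda>v. G v * exp (-3 * v)) has_real_derivative y) (at v) \<and> 0 \<le> y" by blast
    qed
    define \<delta> where "\<delta> = G x * exp (-3 * x)"
    have \<delta>: "\<delta> > 0" using n by (simp add: \<delta>_def)
    \<comment> \<open>Far enough out for D exp (-w), the bound for G w exp (-3w), to fall to
      \<delta> / 2.\<close>
    define w where "w = max x (- ln (\<delta> / (2 * D)))"
    have w: "w \<ge> x" by (simp add: w_def)
    have "- w \<le> ln (\<delta> / (2 * D))" by (simp add: w_def)
    then have e: "exp (- w) \<le> \<delta> / (2 * D)" using \<delta> D0 by (simp add: ln_ge_iff)
    have "G w * exp (-3 * w) \<le> D * exp (2 * w) * exp (-3 * w)"
      using Y(1)[of w] w x by (intro mult_right_mono) (auto simp: abs_le_iff)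
    also have "\<dots> = D * exp (- w)" by (simp add: mult.assoc flip: exp_add)
    also have "\<dots> \<le> D * (\<delta> / (2 * D))" using e D0 by (intro mult_left_mono) auto
    also have "\<dots> = \<delta> / 2" using D0 by simp
    finally show False using inc[OF w] \<delta> unfolding \<delta>_def[symmetric] by linarith
  qed
  \<comment> \<open>G vanishes beyond \<open>Y\<close> and is nonnegative everywhere; monotonicity
    carries the zero back to the left.\<close>
  have G0: "G x = 0" for x
    using Gnn[of x] Gnp[of "max x Y"] mono[of x "max x Y"] by simp
  have G'z: "G' x = 0" for x
  proof (rule DERIV_unique[OF dG])
    have "G = (\<lambda>_. 0)" using G0 by auto
    then show "(G has_real_derivative 0) (at x)" by simp
  qed
  have PQ0: "P x = 0 \<and> Q x = 0" for x
  proof -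
    have "0 \<le> ((p1 x)\<^sup>2 + (p2 x)\<^sup>2) * (y x)\<^sup>2" "0 \<le> ((q1 x)\<^sup>2 + (q2 x)\<^sup>2) * (z x)\<^sup>2" by auto
    moreover have "0 \<le> exp (2 * x) * F x" using F0[of x] by simp
    ultimately have "exp (2 * x) * F x = 0" using G'z[of x] unfolding G'_def by linarith
    then have "l * ((P x)\<^sup>2 + (Q x)\<^sup>2) \<le> 0" using F[of x] by simp
    then have "(P x)\<^sup>2 + (Q x)\<^sup>2 \<le> 0" using l by (simp add: mult_le_0_iff)
    then show ?thesis by (simp add: sum_power2_le_zero_iff)
  qed
  have "p1 x = p2 x \<and> q1 x = q2 x" for x
    using PQ0[of x] b1(1,3)[of x] b2(1,3)[of x] unfolding P_def Q_def
    by (auto simp: power2_eq_iff intro: power2_eq_imp_eq)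
  then show ?thesis by auto
qed

section \<open>Profiles in the radial variable\<close>

text \<open>Adding e = (D/2) exp (2x), the integral of the bound, makes g nondecreasing, while the
  nonincreasing g - e bounds it from below near minus infinity. So g + e converges, and e tends to
  0.\<close>

lemma convergent_at_bot:
  fixes g g' :: "real \<Rightarrow> real"
  assumes g: "\<And>x. x \<le> X \<Longrightarrow> (g has_real_derivative g' x) (at x)"
    and g': "\<And>x. x \<le> X \<Longrightarrow> \<bar>g' x\<bar> \<le> D * exp (2 * x)"
  shows "\<exists>L. (g \<longlongrightarrow> L) at_bot"
proof -
  define e where "e x = D / 2 * exp (2 * x)" for x
  have de: "(e has_real_derivative D * exp (2 * x)) (at x)" for x
    unfolding e_def[abs_def] by (auto intro!: derivative_eq_intros)
  define h where "h x = g x + e x" for x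
  have D: "D \<ge> 0" using g'[of X] by (smt (verit) exp_gt_zero mult_neg_pos)
  have e0: "e x \<ge> 0" for x using D by (simp add: e_def)
  have inc: "h a \<le> h b" if "a \<le> b" "b \<le> X" for a b
  proof (rule DERIV_nonneg_imp_nondecreasing[OF that(1)])
    fix x assume "a \<le> x" "x \<le> b"
    then have x: "x \<le> X" using that by simp
    have "g' x + D * exp (2 * x) \<ge> 0" using g'[OF x] by (simp add: abs_le_iff)
    then show "\<exists>y. (h has_real_derivative y) (at x) \<and> 0 \<le> y"
      unfolding h_def[abs_def] using DERIV_add[OF g[OF x] de] by blast
  qed
  have low: "h x \<ge> g X - e X" if x: "x \<le> X" for x
  proof -
    have "g X - e X \<le> g x - e x"
    proof (rule DERIV_nonpos_imp_nonincreasing[OF x])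
      fix z assume "x \<le> z" and z: "z \<le> X"
      have "g' z - D * exp (2 * z) \<le> 0" using g'[OF z] by (simp add: abs_le_iff)
      then show "\<exists>y. ((\<lambda>x. g x - e x) has_real_derivative y) (at z) \<and> y \<le> 0"
        using DERIV_diff[OF g[OF z] de] by blast
    qed
    then show ?thesis using e0[of x] by (simp add: h_def)
  qed
  define L where "L = Inf (h ` {..X})"
  have bb: "bdd_below (h ` {..X})" using low by (auto intro!: bdd_belowI)
  have "(h \<longlongrightarrow> L) at_bot"
  proof (rule decreasing_tendsto)
    show "\<forall>\<^sub>F x in at_bot. L \<le> h x"
      using eventually_le_at_bot[of X] by eventually_elim (auto simp: L_def intro: cInf_lower bb)
    fix y assume "L < y"
    then obtain z where z: "z \<le> X" "h z < y"
      using cInf_less_iff[OF _ bb] by (auto simp: L_def)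
    show "\<forall>\<^sub>F x in at_bot. h x < y"
      using eventually_le_at_bot[of z] by eventually_elim (use inc z in fastforce)
  qed
  moreover have "(e \<longlongrightarrow> D / 2 * 0) at_bot"
    unfolding e_def[abs_def]
    by (intro tendsto_intros filterlim_compose[OF exp_at_bot]
        filterlim_tendsto_pos_mult_at_bot[OF tendsto_const] filterlim_ident) simp
  ultimately have "((\<lambda>x. h x - e x) \<longlongrightarrow> L - D / 2 * 0) at_bot" by (rule tendsto_diff)
  then show ?thesis by (auto simp: h_def)
qed

lemma exp_2_ln: "r > 0 \<Longrightarrow> exp (2 * ln r) = r\<^sup>2" for r :: real
  by (simp add: exp_double)

lemma bounded_on_UNIV:
  fixes f :: "real \<Rightarrow> real"
  assumes c: "continuous_on UNIV f" and b: "\<And>x. x \<le> a \<Longrightarrow> \<bar>f x\<bar> \<le> K" and t: "\<And>x. x \<ge> b \<Longrightarrow> \<bar>f x\<bar> \<le> L"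
  shows "\<exists>M. \<forall>x. \<bar>f x\<bar> \<le> M"
proof -
  have "compact (f ` {a..b})" by (intro compact_continuous_image continuous_on_subset[OF c]) auto
  then obtain M where "\<forall>x\<in>{a..b}. \<bar>f x\<bar> \<le> M" using compact_imp_bounded by (force simp: bounded_iff)
  then have "\<bar>f x\<bar> \<le> max M (max K L)" for x
    using b[of x] t[of x] by (cases "x \<le> a"; cases "x \<ge> b") (auto simp: le_max_iff_disj)
  then show ?thesis by blast
qed

text \<open>The majorant for the gradient integral, with antiderivative -1 / (2 (1 + r^2)).\<close>

lemma set_integrable_rational: "set_integrable lborel {0<..} (\<lambda>r::real. r / (1 + r\<^sup>2)\<^sup>2)"
proof -
  have nz: "1 + r\<^sup>2 \<noteq> 0" for r :: real by (smt (verit) zero_le_power2)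
  have d: "((\<lambda>r. 1 / (1 + r\<^sup>2)) has_real_derivative - (2 * x) / (1 + x\<^sup>2)\<^sup>2) (at x)" for x :: real
    using nz[of x] by (auto intro!: derivative_eq_intros simp: power2_eq_square)
  have "set_integrable lborel (einterval (ereal 0) \<infinity>) (\<lambda>r::real. r / (1 + r\<^sup>2)\<^sup>2)"
  proof (rule interval_integral_FTC_nonneg(1)[where F="\<lambda>r. - (1 / 2) * (1 / (1 + r\<^sup>2))" and A="- (1 / 2) * (1 / (1 + 0\<^sup>2))" and B=0])
    fix x :: real assume "ereal 0 < ereal x" "ereal x < \<infinity>"
    show "((\<lambda>r. - (1 / 2) * (1 / (1 + r\<^sup>2))) has_real_derivative x / (1 + x\<^sup>2)\<^sup>2) (at x)"
      by (rule DERIV_cong[OF DERIV_cmult[OF d]]) simp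
    show "isCont (\<lambda>r. r / (1 + r\<^sup>2)\<^sup>2) x" using nz[of x] by (intro continuous_intros) auto
  next
    show "AE x in lborel. ereal 0 < ereal x \<longrightarrow> ereal x < \<infinity> \<longrightarrow> 0 \<le> x / (1 + x\<^sup>2)\<^sup>2" by simp
    have "((\<lambda>r::real. - (1 / 2) * (1 / (1 + r\<^sup>2))) \<longlongrightarrow> - (1 / 2) * (1 / (1 + 0\<^sup>2))) (at_right 0)"
      by (intro tendsto_intros) auto
    then show "(((\<lambda>r. - (1 / 2) * (1 / (1 + r\<^sup>2))) \<circ> real_of_ereal) \<longlongrightarrow> - (1 / 2) * (1 / (1 + 0\<^sup>2))) (at_right (ereal 0))"
      by (simp add: ereal_tendsto_simps)
    have "((\<lambda>r::real. 1 / (1 + r\<^sup>2)) \<longlongrightarrow> 0) at_top"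
      by (intro tendsto_divide_0[OF tendsto_const] filterlim_at_top_imp_at_infinity
          filterlim_tendsto_add_at_top[OF tendsto_const] filterlim_pow_at_top filterlim_ident) auto
    from tendsto_mult[OF tendsto_const[of "- (1 / 2)"] this]
    have "((\<lambda>r::real. - (1 / 2) * (1 / (1 + r\<^sup>2))) \<longlongrightarrow> 0) at_top" by simp
    then show "(((\<lambda>r. - (1 / 2) * (1 / (1 + r\<^sup>2))) \<circ> real_of_ereal) \<longlongrightarrow> 0) (at_left \<infinity>)"
      by (simp add: ereal_tendsto_simps)
  qed simp
  then show ?thesis by simp
qed

text \<open>\<open>A\<close>, \<open>s\<close>, \<open>k\<close> and \<open>p\<close> belong to the
  first component. Results are proved for it alone; the second is covered by interpreting the locale
  with the roles exchanged.\<close>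

locale radial_profile =
  fixes A A' B s t :: real and k l :: nat and p q p' q' :: "real \<Rightarrow> real"
  assumes A: "A > 0" "A' > 0" and st: "s > 0" "t > 0" and AB: "A * A' - B\<^sup>2 > 0"
    and p: "\<And>x. (p has_real_derivative p' x) (at x)"
    and p': "\<And>x. (p' has_real_derivative reaction A B s t (real k) x (p x) (q x)) (at x)"
    and q: "\<And>x. (q has_real_derivative q' x) (at x)"
    and q': "\<And>x. (q' has_real_derivative reaction A' B t s (real l) x (q x) (p x)) (at x)"
    and pos: "\<And>x. 0 < p x" "\<And>x. 0 < q x"
    and bdd: "\<exists>C. \<forall>x. p x \<le> C \<and> q x \<le> C"
    and away: "\<exists>c>0. \<forall>\<^sub>F x in at_top. c \<le> p x \<and> c \<le> q x"
begin

lemma swap: "radial_profile A' A B t s l k q p q' p'"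
  by unfold_locales (use A st AB p p' q q' pos bdd away in \<open>auto simp: mult.commute conj_commute\<close>)

definition V where "V x = A * ((p x)\<^sup>2 - s\<^sup>2) + B * ((q x)\<^sup>2 - t\<^sup>2)"

lemma p'': "(p' has_real_derivative ((real k)\<^sup>2 + exp (2 * x) * V x) * p x) (at x)"
  using p'[of x] by (simp add: reaction_def V_def)

lemma V_bounded: "\<exists>K. \<forall>x. \<bar>V x\<bar> \<le> K"
proof -
  obtain C where C: "\<And>x. p x \<le> C \<and> q x \<le> C" using bdd by blast
  have "\<bar>p x\<bar> \<le> C" "\<bar>q x\<bar> \<le> C" for x using C[of x] pos[of x] by auto
  then show ?thesis unfolding V_def using potential_bounded by blast
qed

lemma continuous_p: "continuous_on S p" and continuous_q: "continuous_on S q"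
  and continuous_p': "continuous_on S p'"
  by (intro continuous_at_imp_continuous_on ballI DERIV_isCont[OF p] DERIV_isCont[OF q] DERIV_isCont[OF p'])+

lemma log_derivative: "\<exists>D X. \<forall>x\<le>X. \<bar>p' x / p x - real k\<bar> \<le> D * exp (2 * x)"
proof -
  obtain K where K: "\<And>x. \<bar>V x\<bar> \<le> K" using V_bounded by blast
  obtain C where "\<And>x. p x \<le> C" using bdd by blast
  then show ?thesis
    by (intro log_derivative_at_bot[of 0 p p' "real k" V K C] p p'' K pos) auto
qed

text \<open>The derivative of ln p - k x is O(exp (2x)), hence integrable at minus infinity; the
  limit of the exponential is automatically positive.\<close>

lemma power_limit: "\<exists>c>0. ((\<lambda>x. p x * exp (- (real k * x))) \<longlongrightarrow> c) at_bot"
proof -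
  obtain D X where D: "\<And>x. x \<le> X \<Longrightarrow> \<bar>p' x / p x - real k\<bar> \<le> D * exp (2 * x)"
    using log_derivative by blast
  have d: "((\<lambda>x. ln (p x) - real k * x) has_real_derivative p' x / p x - real k) (at x)" for x
    using pos(1)[of x] by (auto intro!: derivative_eq_intros p)
  obtain L where "((\<lambda>x. ln (p x) - real k * x) \<longlongrightarrow> L) at_bot"
    using convergent_at_bot[OF d D] by blast
  then have "((\<lambda>x. exp (ln (p x) - real k * x)) \<longlongrightarrow> exp L) at_bot" by (rule tendsto_exp)
  moreover have "exp (ln (p x) - real k * x) = p x * exp (- (real k * x))" for x
    unfolding diff_conv_add_uminus exp_add using pos(1)[of x] by (subst exp_ln) auto
  ultimately show ?thesis by (intro exI[of _ "exp L"]) simp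
qed

text \<open>The leading coefficient in f(r) ~ \<open>coeff0\<close> r^k at the origin.\<close>

definition coeff0 where "coeff0 = (THE c. ((\<lambda>x. p x * exp (- (real k * x))) \<longlongrightarrow> c) at_bot)"

lemma coeff0: "coeff0 > 0" "((\<lambda>x. p x * exp (- (real k * x))) \<longlongrightarrow> coeff0) at_bot"
proof -
  obtain c where c: "c > 0" "((\<lambda>x. p x * exp (- (real k * x))) \<longlongrightarrow> c) at_bot" using power_limit by blast
  have "coeff0 = c" unfolding coeff0_def
    by (rule the_equality) (use c tendsto_unique[OF trivial_limit_at_bot_linorder] in blast)+
  with c show "coeff0 > 0" "((\<lambda>x. p x * exp (- (real k * x))) \<longlongrightarrow> coeff0) at_bot" by auto
qed

definition p0 where "p0 = (if k = 0 then coeff0 else 0)"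

lemma p_at_bot: "(p \<longlongrightarrow> p0) at_bot"
proof -
  have "((\<lambda>x. exp (real k * x)) \<longlongrightarrow> (if k = 0 then 1 else 0)) at_bot"
  proof (cases "k = 0")
    case False
    then show ?thesis
      by (auto intro!: filterlim_compose[OF exp_at_bot] filterlim_tendsto_pos_mult_at_bot[OF tendsto_const] filterlim_ident)
  qed simp
  from tendsto_mult[OF coeff0(2) this]
  have "((\<lambda>x. p x * exp (- (real k * x)) * exp (real k * x)) \<longlongrightarrow> p0) at_bot"
    by (simp add: p0_def if_distrib cong: if_cong)
  moreover have "p x * exp (- (real k * x)) * exp (real k * x) = p x" for x
    by (simp add: mult.assoc flip: exp_add)
  ultimately show ?thesis by simp
qed

text \<open>The rate exp x, that is f' bounded near the origin, covers both cases: p' is O(exp (k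
  x)) for k >= 1, and O(exp (2x)) for k = 0, where p'/p itself is small.\<close>

lemma p'_at_bot_bound: "\<exists>E X. \<forall>x\<le>X. \<bar>p' x\<bar> \<le> E * exp x"
proof -
  obtain D X where D: "\<And>x. x \<le> X \<Longrightarrow> \<bar>p' x / p x - real k\<bar> \<le> D * exp (2 * x)"
    using log_derivative by blast
  obtain Y where Y: "\<And>x. x \<le> Y \<Longrightarrow> p x * exp (- (real k * x)) < coeff0 + 1"
    using order_tendstoD(2)[OF coeff0(2), of "coeff0 + 1"] by (auto simp: eventually_at_bot_linorder)
  define E where "E = (real k + \<bar>D\<bar>) * (coeff0 + 1)"
  have "\<bar>p' x\<bar> \<le> E * exp x" if x: "x \<le> min 0 (min X Y)" for x
  proof -
    have px: "p x \<le> (coeff0 + 1) * exp (real k * x)"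
    proof -
      have "p x = p x * exp (- (real k * x)) * exp (real k * x)" by (simp add: mult.assoc flip: exp_add)
      also have "\<dots> \<le> (coeff0 + 1) * exp (real k * x)"
        using Y[of x] x by (intro mult_right_mono) auto
      finally show ?thesis .
    qed
    have "\<bar>p' x / p x\<bar> \<le> real k + \<bar>D\<bar> * exp (2 * x)"
      using D[of x] x by (smt (verit) exp_gt_zero mult_right_mono of_nat_0_le_iff)
    then have "\<bar>p' x / p x\<bar> * p x \<le> (real k + \<bar>D\<bar> * exp (2 * x)) * ((coeff0 + 1) * exp (real k * x))"
      using px pos(1)[of x] by (intro mult_mono) auto
    then have 1: "\<bar>p' x\<bar> \<le> (real k + \<bar>D\<bar> * exp (2 * x)) * ((coeff0 + 1) * exp (real k * x))"
      using pos(1)[of x] by simp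
    have 2: "(real k + \<bar>D\<bar> * exp (2 * x)) * exp (real k * x) \<le> (real k + \<bar>D\<bar>) * exp x"
    proof (cases "k = 0")
      case True
      have "\<bar>D\<bar> * exp (2 * x) \<le> \<bar>D\<bar> * exp x" using x by (intro mult_left_mono) auto
      then show ?thesis using True by simp
    next
      case False
      have "real k * x \<le> 1 * x" using False x by (intro mult_right_mono_neg) auto
      moreover have "\<bar>D\<bar> * exp (2 * x) \<le> \<bar>D\<bar> * 1" using x by (intro mult_left_mono) auto
      ultimately show ?thesis by (intro mult_mono) auto
    qed
    have "(real k + \<bar>D\<bar> * exp (2 * x)) * exp (real k * x) * (coeff0 + 1) \<le> (real k + \<bar>D\<bar>) * exp x * (coeff0 + 1)"
      using 2 coeff0(1) by (intro mult_right_mono) auto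
    then show ?thesis using 1 by (simp add: E_def mult_ac)
  qed
  then show ?thesis by blast
qed

text \<open>Dividing by p + s >= s turns the decay of p^2 - s^2 into that of p - s. Then exp (2x) V,
  and with it p'', is bounded, and interpolation gives p' the rate exp (-x).\<close>

lemma decay: "\<exists>E X. \<forall>x\<ge>X. \<bar>p x - s\<bar> \<le> E * exp (-2 * x) \<and> \<bar>p' x\<bar> \<le> 3 * E * exp (- x) \<and>
   \<bar>V x\<bar> \<le> E * exp (-2 * x)"
proof -
  obtain C where C: "\<And>x. p x \<le> C \<and> q x \<le> C" using bdd by blast
  obtain c X0 where c: "c > 0" "\<And>x. x \<ge> X0 \<Longrightarrow> c \<le> p x \<and> c \<le> q x"
    using away by (auto simp: eventually_at_top_linorder)
  have hp: "has_second_deriv p (\<lambda>x. reaction A B s t (real k) x (p x) (q x)) UNIV"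
    by (rule has_second_derivI) (rule p p')+
  have hq: "has_second_deriv q (\<lambda>x. reaction A' B t s (real l) x (q x) (p x)) UNIV"
    by (rule has_second_derivI) (rule q q')+
  obtain K X where K: "\<And>x. x \<ge> X \<Longrightarrow> \<bar>(p x)\<^sup>2 - s\<^sup>2\<bar> \<le> K * exp (-2 * x)" "\<And>x. x \<ge> X \<Longrightarrow> \<bar>(q x)\<^sup>2 - t\<^sup>2\<bar> \<le> K * exp (-2 * x)"
    using decay_at_top[OF A AB hp hq, of X0 c C] c C by blast
  have K0: "K \<ge> 0" using K(1)[of X] by (smt (verit) exp_gt_zero mult_neg_pos)
  have C0: "C > 0" using C[of 0] pos(1)[of 0] by linarith
  have Vx: "\<bar>V x\<bar> \<le> (\<bar>A\<bar> + \<bar>B\<bar>) * K * exp (-2 * x)" if "x \<ge> X" for x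
  proof -
    have "\<bar>A\<bar> * \<bar>(p x)\<^sup>2 - s\<^sup>2\<bar> \<le> \<bar>A\<bar> * (K * exp (-2 * x))" "\<bar>B\<bar> * \<bar>(q x)\<^sup>2 - t\<^sup>2\<bar> \<le> \<bar>B\<bar> * (K * exp (-2 * x))"
      using K[OF that] by (auto intro!: mult_left_mono)
    moreover have "\<bar>V x\<bar> \<le> \<bar>A\<bar> * \<bar>(p x)\<^sup>2 - s\<^sup>2\<bar> + \<bar>B\<bar> * \<bar>(q x)\<^sup>2 - t\<^sup>2\<bar>"
      unfolding V_def by (metis abs_mult abs_triangle_ineq)
    ultimately show ?thesis by (simp add: distrib_right mult.assoc)
  qed
  have ps: "\<bar>p x - s\<bar> \<le> K / s * exp (-2 * x)" if "x \<ge> X" for x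
  proof -
    have "\<bar>p x - s\<bar> * s \<le> \<bar>p x - s\<bar> * (p x + s)" using pos(1)[of x] st by (intro mult_left_mono) auto
    also have "\<dots> = \<bar>(p x)\<^sup>2 - s\<^sup>2\<bar>"
      using pos(1)[of x] st by (simp add: power2_eq_square square_diff_square_factored abs_mult)
    finally show ?thesis using K(1)[OF that] st by (simp add: pos_le_divide_eq)
  qed
  define E where "E = max (K / s) (max ((\<bar>A\<bar> + \<bar>B\<bar>) * K) (((real k)\<^sup>2 + (\<bar>A\<bar> + \<bar>B\<bar>) * K) * C))"
  have E: "K / s \<le> E" "(\<bar>A\<bar> + \<bar>B\<bar>) * K \<le> E" "((real k)\<^sup>2 + (\<bar>A\<bar> + \<bar>B\<bar>) * K) * C \<le> E"
    unfolding E_def by (rule order_refl max.cobounded1 max.coboundedI2)+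
  have ps': "\<bar>p x - s\<bar> \<le> E * exp (-2 * x)" if "x \<ge> X" for x
    using ps[OF that] mult_right_mono[OF E(1), of "exp (-2 * x)"] by simp
  have rb: "\<bar>((real k)\<^sup>2 + exp (2 * x) * V x) * p x\<bar> \<le> E" if "x \<ge> X" for x
  proof -
    have "exp (2 * x) * \<bar>V x\<bar> \<le> exp (2 * x) * ((\<bar>A\<bar> + \<bar>B\<bar>) * K * exp (-2 * x))"
      using Vx[OF that] by (intro mult_left_mono) auto
    also have "\<dots> = (\<bar>A\<bar> + \<bar>B\<bar>) * K" by (simp add: exp_minus)
    finally have "\<bar>exp (2 * x) * V x\<bar> \<le> (\<bar>A\<bar> + \<bar>B\<bar>) * K" by (simp add: abs_mult)
    then have "\<bar>(real k)\<^sup>2 + exp (2 * x) * V x\<bar> \<le> (real k)\<^sup>2 + (\<bar>A\<bar> + \<bar>B\<bar>) * K"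
      by (smt (verit) zero_le_power2)
    then have "\<bar>(real k)\<^sup>2 + exp (2 * x) * V x\<bar> * \<bar>p x\<bar> \<le> ((real k)\<^sup>2 + (\<bar>A\<bar> + \<bar>B\<bar>) * K) * C"
      using C[of x] pos(1)[of x] by (intro mult_mono) auto
    then show ?thesis using E(3) by (simp add: abs_mult)
  qed
  have "\<bar>p' x\<bar> \<le> 3 * E * exp (- x)" if "x \<ge> X" for x
    by (rule landau_decay[OF p p'' ps' rb that]) auto
  moreover have "\<bar>V x\<bar> \<le> E * exp (-2 * x)" if "x \<ge> X" for x
    by (rule order_trans[OF Vx[OF that] mult_right_mono[OF E(2) exp_ge_zero]])
  ultimately show ?thesis using ps' by blast
qed

lemma exp_neg_at_top: "((\<lambda>x. K * exp (- x)) \<longlongrightarrow> 0) at_top" "((\<lambda>x. K * exp (-2 * x)) \<longlongrightarrow> 0) at_top" for K :: real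
proof -
  have "((\<lambda>x. K * exp (- x)) \<longlongrightarrow> K * 0) at_top" "((\<lambda>x. K * exp (-2 * x)) \<longlongrightarrow> K * 0) at_top"
    by (intro tendsto_intros filterlim_compose[OF exp_at_bot] filterlim_uminus_at_bot_at_top
        filterlim_tendsto_neg_mult_at_bot[OF tendsto_const] filterlim_ident; simp)+
  then show "((\<lambda>x. K * exp (- x)) \<longlongrightarrow> 0) at_top" "((\<lambda>x. K * exp (-2 * x)) \<longlongrightarrow> 0) at_top" by simp_all
qed

text \<open>The factor exp x is what the Hamiltonian calls for: its potential term is exp (2x) times
  a quadratic form in \<open>V\<close> and its counterpart.\<close>

lemma p_at_top: "(p \<longlongrightarrow> s) at_top" and p'_at_top: "(p' \<longlongrightarrow> 0) at_top"
  and V_at_top: "((\<lambda>x. exp x * V x) \<longlongrightarrow> 0) at_top"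
proof -
  obtain E X where E: "\<And>x. x \<ge> X \<Longrightarrow> \<bar>p x - s\<bar> \<le> E * exp (-2 * x)" "\<And>x. x \<ge> X \<Longrightarrow> \<bar>p' x\<bar> \<le> 3 * E * exp (- x)"
    "\<And>x. x \<ge> X \<Longrightarrow> \<bar>V x\<bar> \<le> E * exp (-2 * x)"
    using decay by blast
  have "((\<lambda>x. p x - s) \<longlongrightarrow> 0) at_top"
    by (rule Lim_null_comparison[OF _ exp_neg_at_top(2)[of E]]) (use E(1) in \<open>auto simp: eventually_at_top_linorder\<close>)
  then show "(p \<longlongrightarrow> s) at_top" by (simp add: Lim_null[of p])
  show "(p' \<longlongrightarrow> 0) at_top"
    by (rule Lim_null_comparison[OF _ exp_neg_at_top(1)[of "3 * E"]]) (use E(2) in \<open>auto simp: eventually_at_top_linorder\<close>)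
  show "((\<lambda>x. exp x * V x) \<longlongrightarrow> 0) at_top"
  proof (rule Lim_null_comparison[OF _ exp_neg_at_top(1)[of E]])
    have "norm (exp x * V x) \<le> E * exp (- x)" if "x \<ge> X" for x
    proof -
      have "exp x * \<bar>V x\<bar> \<le> exp x * (E * exp (-2 * x))"
        using E(3)[OF that] by (intro mult_left_mono) auto
      also have "\<dots> = E * exp (- x)" by (simp flip: exp_add)
      finally show ?thesis by (simp add: abs_mult)
    qed
    then show "\<forall>\<^sub>F x in at_top. norm (exp x * V x) \<le> E * exp (- x)"
      by (auto simp: eventually_at_top_linorder)
  qed
qed

section \<open>The solution as a function of the radial variable\<close>

definition f where "f r = (if r > 0 then p (ln r) else p0)"

definition f' where "f' r = p' (ln r) / r"

definition f'' where "f'' r = (((real k)\<^sup>2 + r\<^sup>2 * V (ln r)) * p (ln r) - p' (ln r)) / r\<^sup>2"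

lemma f_deriv: "r > 0 \<Longrightarrow> (f has_real_derivative f' r) (at r)"
proof -
  assume r: "r > 0"
  have "((\<lambda>r. p (ln r)) has_real_derivative p' (ln r) * (1 / r)) (at r)"
    by (rule DERIV_chain2[OF p]) (use r in \<open>auto intro!: derivative_eq_intros\<close>)
  then have "((\<lambda>r. p (ln r)) has_real_derivative f' r) (at r)" by (simp add: f'_def)
  then show ?thesis
    by (rule has_field_derivative_transform_within_open[of _ _ _ "{0<..}"]) (use r in \<open>auto simp: f_def\<close>)
qed

lemma f'_deriv: "r > 0 \<Longrightarrow> (f' has_real_derivative f'' r) (at r)"
proof -
  assume r: "r > 0"
  have "((\<lambda>r. p' (ln r)) has_real_derivative ((real k)\<^sup>2 + exp (2 * ln r) * V (ln r)) * p (ln r) * (1 / r)) (at r)"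
    by (rule DERIV_chain2[OF p'']) (use r in \<open>auto intro!: derivative_eq_intros\<close>)
  then have "(f' has_real_derivative
      (((real k)\<^sup>2 + exp (2 * ln r) * V (ln r)) * p (ln r) * (1 / r) * r - p' (ln r) * 1) / (r * r)) (at r)"
    unfolding f'_def[abs_def] by (intro DERIV_divide DERIV_ident) (use r in auto)
  moreover have "(((real k)\<^sup>2 + exp (2 * ln r) * V (ln r)) * p (ln r) * (1 / r) * r - p' (ln r) * 1) / (r * r) = f'' r"
    using r by (simp add: f''_def exp_2_ln power2_eq_square)
  ultimately show ?thesis by simp
qed

lemma deriv_f: "r > 0 \<Longrightarrow> deriv f r = f' r"
  using f_deriv by (rule DERIV_imp_deriv)

lemma deriv_f_deriv: "r > 0 \<Longrightarrow> (deriv f has_real_derivative f'' r) (at r)"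
  using has_field_derivative_transform_within_open[OF f'_deriv, of r "{0<..}" "deriv f"] deriv_f by auto

lemma deriv_deriv_f: "r > 0 \<Longrightarrow> deriv (deriv f) r = f'' r"
  using deriv_f_deriv by (rule DERIV_imp_deriv)

lemma continuous_on_ln_pos: "continuous_on {0<..} (ln :: real \<Rightarrow> real)"
  by (intro continuous_on_ln continuous_on_id) auto

lemma f_C2: "C2_pos f"
proof -
  have "continuous_on {0<..} f''"
    unfolding f''_def V_def
    by (intro continuous_intros continuous_on_ln_pos continuous_on_compose2[OF continuous_p]
        continuous_on_compose2[OF continuous_q] continuous_on_compose2[OF continuous_p']) auto
  then have "continuous_on {0<..} (deriv (deriv f))"
    by (rule continuous_on_cong[THEN iffD1, rotated -1]) (auto simp: deriv_deriv_f)
  then show ?thesis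
    unfolding C2_pos_def using f_deriv deriv_f_deriv by (auto simp: real_differentiable_def)
qed

lemma f_pos: "r > 0 \<Longrightarrow> f r > 0"
  by (simp add: f_def pos)

lemma f_at_right_0: "(f \<longlongrightarrow> p0) (at_right 0)"
proof -
  have "((\<lambda>r. p (ln r)) \<longlongrightarrow> p0) (at_right 0)" by (rule filterlim_compose[OF p_at_bot ln_at_0])
  moreover have "\<forall>\<^sub>F r in at_right 0. p (ln r) = f r"
    using eventually_at_right_less[of 0] by eventually_elim (simp add: f_def)
  ultimately show ?thesis by (rule Lim_transform_eventually)
qed

lemma f_0: "f 0 = p0"
  by (simp add: f_def)

lemma f_continuous: "continuous_on {0..} f"
proof -
  have "continuous (at r within {0..}) f" if "r \<ge> 0" for r
  proof (cases "r = 0")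
    case True
    have "(f \<longlongrightarrow> f 0) (at 0 within {0..})"
      using f_at_right_0 unfolding f_0 by (simp add: at_within_Ici_at_right)
    then show ?thesis using True by (simp add: continuous_within)
  next
    case False
    then have "isCont f r" using that f_deriv[of r] by (auto intro: DERIV_isCont)
    then show ?thesis by (rule continuous_at_imp_continuous_within)
  qed
  then show ?thesis by (simp add: continuous_on_eq_continuous_within)
qed

lemma f_at_top: "(f \<longlongrightarrow> s) at_top"
proof -
  have "((\<lambda>r. p (ln r)) \<longlongrightarrow> s) at_top" by (rule filterlim_compose[OF p_at_top ln_at_top])
  moreover have "\<forall>\<^sub>F r in at_top. p (ln r) = f r"
    using eventually_gt_at_top[of 0] by eventually_elim (simp add: f_def)
  ultimately show ?thesis by (rule Lim_transform_eventually)
qed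

lemma f_vanishes: "vanishes_to_order f k"
proof -
  have "((\<lambda>r. p (ln r) * exp (- (real k * ln r))) \<longlongrightarrow> coeff0) (at_right 0)"
    by (rule filterlim_compose[OF coeff0(2) ln_at_0])
  moreover have "\<forall>\<^sub>F r in at_right 0. p (ln r) * exp (- (real k * ln r)) = f r / r ^ k"
    using eventually_at_right_less[of 0]
  proof eventually_elim
    case (elim r)
    have "exp (real k * ln r) = r ^ k" using elim by (simp add: exp_of_nat_mult)
    then show ?case using elim by (simp add: f_def exp_minus divide_inverse)
  qed
  ultimately have "((\<lambda>r. f r / r ^ k) \<longlongrightarrow> coeff0) (at_right 0)" by (rule Lim_transform_eventually)
  then show ?thesis unfolding vanishes_to_order_def using coeff0(1) by blast
qed

text \<open>For k = 0 the estimate of p'/p reads O(r^2), and f' = p'/r. By the mean value theorem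
  this gives the one-sided derivative 0 at the origin.\<close>

lemma f'_bound_0: "k = 0 \<Longrightarrow> \<exists>E X. X > 0 \<and> (\<forall>r. 0 < r \<longrightarrow> r \<le> X \<longrightarrow> \<bar>f' r\<bar> \<le> E * r)"
proof -
  assume k: "k = 0"
  obtain D X where D: "\<And>x. x \<le> X \<Longrightarrow> \<bar>p' x / p x - real k\<bar> \<le> D * exp (2 * x)"
    using log_derivative by blast
  obtain C where C: "\<And>x. p x \<le> C" using bdd by blast
  have "\<bar>f' r\<bar> \<le> \<bar>D\<bar> * C * r" if r: "0 < r" "r \<le> exp X" for r
  proof -
    have x: "ln r \<le> X" using r by (simp add: ln_le_cancel_iff[symmetric] del: ln_le_cancel_iff)
    have "\<bar>p' (ln r) / p (ln r)\<bar> \<le> \<bar>D\<bar> * r\<^sup>2"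
      using D[OF x] k r by (simp add: exp_2_ln) (smt (verit) mult_right_mono zero_le_power2)
    then have "\<bar>p' (ln r) / p (ln r)\<bar> * p (ln r) \<le> \<bar>D\<bar> * r\<^sup>2 * C"
      using C[of "ln r"] pos(1)[of "ln r"] by (intro mult_mono) auto
    then have "\<bar>p' (ln r)\<bar> \<le> \<bar>D\<bar> * r\<^sup>2 * C" using pos(1)[of "ln r"] by simp
    then have "\<bar>p' (ln r)\<bar> / r \<le> \<bar>D\<bar> * r\<^sup>2 * C / r" using r by (intro divide_right_mono) auto
    then show ?thesis using r by (simp add: f'_def power2_eq_square mult_ac)
  qed
  then show ?thesis by (intro exI[of _ "\<bar>D\<bar> * C"] exI[of _ "exp X"]) auto
qed

lemma f_deriv_0: "k = 0 \<Longrightarrow> (f has_real_derivative 0) (at 0 within {0..})"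
proof -
  assume k: "k = 0"
  obtain E X where E: "X > 0" "\<And>r. 0 < r \<Longrightarrow> r \<le> X \<Longrightarrow> \<bar>f' r\<bar> \<le> E * r" using f'_bound_0[OF k] by blast
  have "((\<lambda>r. (f r - f 0) / (r - 0)) \<longlongrightarrow> 0) (at_right 0)"
  proof (rule Lim_null_comparison)
    show "\<forall>\<^sub>F r in at_right 0. norm ((f r - f 0) / (r - 0)) \<le> E * r"
      using eventually_at_right_real[OF E(1)]
    proof eventually_elim
      case (elim r)
      then have r: "0 < r" "r < X" by auto
      have "\<exists>l z. 0 < z \<and> z < r \<and> (f has_real_derivative l) (at z) \<and> f r - f 0 = (r - 0) * l"
      proof (rule MVT)
        show "continuous_on {0..r} f" using f_continuous by (rule continuous_on_subset) auto
        show "f differentiable (at z)" if "0 < z" "z < r" for z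
          using f_deriv[OF that(1)] by (auto simp: real_differentiable_def)
      qed (rule r)
      then obtain l z where z: "0 < z" "z < r" "(f has_real_derivative l) (at z)" "f r - f 0 = r * l" by auto
      have "l = f' z" using DERIV_unique[OF z(3) f_deriv[OF z(1)]] .
      then have "\<bar>l\<bar> \<le> E * z" using E(2)[of z] z r by auto
      also have "\<dots> \<le> E * r"
      proof (rule mult_left_mono)
        show "0 \<le> E" using E(2)[of X] E(1) by (smt (verit) mult_neg_pos)
      qed (use z in simp)
      finally show ?case using z(4) r by (simp add: abs_mult)
    qed
    show "((\<lambda>r. E * r) \<longlongrightarrow> 0) (at_right 0)"
      using tendsto_mult[OF tendsto_const[of E] tendsto_ident_at[of 0 "{0<..}"]] by simp
  qed
  then show ?thesis
    unfolding has_field_derivative_iff by (simp add: at_within_Ici_at_right)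
qed

text \<open>The decay of p' at both ends is packed into |p'| <= M / (exp x + exp (-x)), which in r =
  exp x reads |f'| <= M / (1 + r^2).\<close>

lemma f_gradient_integrable: "set_integrable lborel {0<..} (\<lambda>r. (deriv f r)\<^sup>2 * r)"
proof -
  obtain E1 X1 where 1: "\<And>x. x \<le> X1 \<Longrightarrow> \<bar>p' x\<bar> \<le> E1 * exp x" using p'_at_bot_bound by blast
  obtain E2 X2 where 2: "\<And>x. x \<ge> X2 \<Longrightarrow> \<bar>p' x\<bar> \<le> 3 * E2 * exp (- x)" using decay by blast
  have "\<exists>M. \<forall>x. \<bar>p' x * (exp x + exp (- x))\<bar> \<le> M"
  proof (rule bounded_on_UNIV[where a="min 0 X1" and b="max 0 X2" and K="2 * E1" and L="6 * E2"])
    show "continuous_on UNIV (\<lambda>x. p' x * (exp x + exp (- x)))" by (intro continuous_intros continuous_p')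
    fix x :: real
    assume x: "x \<le> min 0 X1"
    have "\<bar>p' x\<bar> * (exp x + exp (- x)) \<le> E1 * exp x * (2 * exp (- x))"
      using 1[of x] x by (intro mult_mono) auto
    moreover have "\<bar>p' x * (exp x + exp (- x))\<bar> = \<bar>p' x\<bar> * (exp x + exp (- x))" by (simp add: abs_mult)
    moreover have "E1 * exp x * (2 * exp (- x)) = 2 * E1" by (simp add: exp_minus)
    ultimately show "\<bar>p' x * (exp x + exp (- x))\<bar> \<le> 2 * E1" by linarith
  next
    fix x :: real
    assume x: "x \<ge> max 0 X2"
    have "exp x + exp (- x) \<le> 2 * exp x" using x by simp
    moreover have h: "\<bar>p' x\<bar> \<le> 3 * E2 * exp (- x)" using 2[of x] x by simp
    ultimately have "\<bar>p' x\<bar> * (exp x + exp (- x)) \<le> 3 * E2 * exp (- x) * (2 * exp x)"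
      by (intro mult_mono order_trans[OF abs_ge_zero h]) (auto intro: add_nonneg_nonneg)
    moreover have "\<bar>p' x * (exp x + exp (- x))\<bar> = \<bar>p' x\<bar> * (exp x + exp (- x))" by (simp add: abs_mult)
    moreover have "3 * E2 * exp (- x) * (2 * exp x) = 6 * E2" by (simp add: exp_minus)
    ultimately show "\<bar>p' x * (exp x + exp (- x))\<bar> \<le> 6 * E2" by linarith
  qed
  then obtain M where M: "\<And>x. \<bar>p' x * (exp x + exp (- x))\<bar> \<le> M" by blast
  have b: "(f' r)\<^sup>2 * r \<le> M\<^sup>2 * (r / (1 + r\<^sup>2)\<^sup>2)" if r: "r > 0" for r
  proof -
    have "\<bar>p' (ln r) * (r + 1 / r)\<bar> \<le> M" using M[of "ln r"] r by (simp add: exp_minus divide_inverse)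
    then have "(p' (ln r) * (r + 1 / r))\<^sup>2 \<le> M\<^sup>2" by (metis abs_ge_zero power2_abs power_mono)
    moreover have "p' (ln r) * (r + 1 / r) = f' r * (1 + r\<^sup>2)"
      using r by (simp add: f'_def field_simps power2_eq_square)
    ultimately have "(f' r)\<^sup>2 * (1 + r\<^sup>2)\<^sup>2 \<le> M\<^sup>2" by (simp add: power_mult_distrib)
    moreover have "(1 + r\<^sup>2)\<^sup>2 > 0" by (smt (verit) zero_le_power2 zero_less_power)
    ultimately have "(f' r)\<^sup>2 \<le> M\<^sup>2 / (1 + r\<^sup>2)\<^sup>2" by (simp add: pos_le_divide_eq)
    then have "(f' r)\<^sup>2 * r \<le> M\<^sup>2 / (1 + r\<^sup>2)\<^sup>2 * r" using r by (intro mult_right_mono) auto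
    then show ?thesis by simp
  qed
  show ?thesis
  proof (rule set_integrable_bound)
    show "set_integrable lborel {0<..} (\<lambda>r. M\<^sup>2 * (r / (1 + r\<^sup>2)\<^sup>2))"
      by (intro set_integrable_mult_right set_integrable_rational)
    have "continuous_on {0<..} f'"
      unfolding f'_def
      by (intro continuous_intros continuous_on_ln_pos continuous_on_compose2[OF continuous_p']) auto
    then have "continuous_on {0<..} (deriv f)"
      by (rule continuous_on_cong[THEN iffD1, rotated -1]) (auto simp: deriv_f)
    then have "continuous_on {0<..} (\<lambda>r. (deriv f r)\<^sup>2 * r)" by (intro continuous_intros)
    then have "(\<lambda>r. indicator {0<..} r *\<^sub>R ((deriv f r)\<^sup>2 * r)) \<in> borel_measurable borel"
      by (intro borel_measurable_continuous_on_indicator) auto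
    then show "set_borel_measurable lborel {0<..} (\<lambda>r. (deriv f r)\<^sup>2 * r)"
      unfolding set_borel_measurable_def by simp
    show "AE r in lborel. r \<in> {0<..} \<longrightarrow> norm ((deriv f r)\<^sup>2 * r) \<le> norm (M\<^sup>2 * (r / (1 + r\<^sup>2)\<^sup>2))"
      using b by (auto simp: deriv_f)
  qed
qed

end

section \<open>Smoothness, the Pohozaev identity and the factor at the origin\<close>

text \<open>The algebra of functions generated by \<open>G\<close>. If the generators have
  derivatives in it on r > 0, so has every member, and all members are smooth there; this replaces
  explicit formulas for higher derivatives.\<close>

inductive_set function_algebra :: "(real \<Rightarrow> real) set \<Rightarrow> (real \<Rightarrow> real) set" for G where
  gen: "g \<in> G \<Longrightarrow> g \<in> function_algebra G"
| const: "(\<lambda>_. c) \<in> function_algebra G"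
| add: "a \<in> function_algebra G \<Longrightarrow> b \<in> function_algebra G \<Longrightarrow> (\<lambda>r. a r + b r) \<in> function_algebra G"
| mult: "a \<in> function_algebra G \<Longrightarrow> b \<in> function_algebra G \<Longrightarrow> (\<lambda>r. a r * b r) \<in> function_algebra G"

lemma function_algebra_deriv:
  assumes G: "\<And>g. g \<in> G \<Longrightarrow> \<exists>g'\<in>function_algebra G. \<forall>r>0. (g has_real_derivative g' r) (at r)"
    and h: "h \<in> function_algebra G"
  shows "\<exists>h'\<in>function_algebra G. \<forall>r>0. (h has_real_derivative h' r) (at r)"
  using h
proof induction
  case (gen g)
  then show ?case by (rule G)
next
  case (const c)
  show ?case by (rule bexI[OF _ function_algebra.const[of 0]]) auto
next
  case (add a b)
  then obtain a' b' where "a' \<in> function_algebra G" "\<And>r. r > 0 \<Longrightarrow> (a has_real_derivative a' r) (at r)"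
    "b' \<in> function_algebra G" "\<And>r. r > 0 \<Longrightarrow> (b has_real_derivative b' r) (at r)" by blast
  then show ?case
    by (intro bexI[of _ "\<lambda>r. a' r + b' r"] function_algebra.add) (auto intro!: DERIV_add)
next
  case (mult a b)
  then obtain a' b' where *: "a' \<in> function_algebra G" "\<And>r. r > 0 \<Longrightarrow> (a has_real_derivative a' r) (at r)"
    "b' \<in> function_algebra G" "\<And>r. r > 0 \<Longrightarrow> (b has_real_derivative b' r) (at r)" by blast
  show ?case
  proof (intro bexI[of _ "\<lambda>r. a' r * b r + b' r * a r"] allI impI)
    show "(\<lambda>r. a' r * b r + b' r * a r) \<in> function_algebra G"
      by (intro function_algebra.add function_algebra.mult * mult.hyps)
    show "((\<lambda>r. a r * b r) has_real_derivative a' r * b r + b' r * a r) (at r)" if "r > 0" for r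
      by (rule DERIV_mult[OF *(2)[OF that] *(4)[OF that]])
  qed
qed

text \<open>By induction each iterated \<open>deriv\<close> agrees on r > 0 with a member of the
  algebra; agreement on an open set allows the next derivative to be taken.\<close>

lemma function_algebra_smooth:
  assumes G: "\<And>g. g \<in> G \<Longrightarrow> \<exists>g'\<in>function_algebra G. \<forall>r>0. (g has_real_derivative g' r) (at r)"
    and h: "h \<in> function_algebra G"
  shows "smooth_pos h"
proof -
  have ind: "\<exists>g\<in>function_algebra G. \<forall>r>0. (deriv ^^ n) h r = g r" for n
  proof (induction n)
    case 0
    then show ?case using h by auto
  next
    case (Suc n)
    then obtain g where g: "g \<in> function_algebra G" "\<And>r. r > 0 \<Longrightarrow> (deriv ^^ n) h r = g r" by blast
    obtain g' where g': "g' \<in> function_algebra G" "\<And>r. r > 0 \<Longrightarrow> (g has_real_derivative g' r) (at r)"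
      using function_algebra_deriv[OF G g(1)] by blast
    have "(deriv ^^ Suc n) h r = g' r" if r: "r > 0" for r
    proof -
      have "((deriv ^^ n) h has_real_derivative g' r) (at r)"
        by (rule has_field_derivative_transform_within_open[OF g'(2)[OF r], of "{0<..}"]) (use r g(2) in auto)
      then show ?thesis by (simp add: DERIV_imp_deriv)
    qed
    then show ?case using g'(1) by blast
  qed
  show ?thesis
    unfolding smooth_pos_def
  proof (intro allI impI)
    fix n and r :: real
    assume r: "r > 0"
    obtain g where g: "g \<in> function_algebra G" "\<And>r. r > 0 \<Longrightarrow> (deriv ^^ n) h r = g r" using ind by blast
    obtain g' where g': "\<And>r. r > 0 \<Longrightarrow> (g has_real_derivative g' r) (at r)"
      using function_algebra_deriv[OF G g(1)] by blast
    have "((deriv ^^ n) h has_real_derivative g' r) (at r)"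
      by (rule has_field_derivative_transform_within_open[OF g'[OF r], of "{0<..}"]) (use r g(2) in auto)
    then show "(deriv ^^ n) h differentiable (at r)" by (auto simp: real_differentiable_def)
  qed
qed

context radial_profile
begin

abbreviation (input) "g \<equiv> radial_profile.f l q"

lemma V_ln: "r > 0 \<Longrightarrow> V (ln r) = A * ((f r)\<^sup>2 - s\<^sup>2) + B * ((g r)\<^sup>2 - t\<^sup>2)"
proof -
  assume r: "r > 0"
  interpret sw: radial_profile A' A B t s l k q p q' p' by (rule swap)
  show ?thesis using r by (simp add: V_def f_def sw.f_def)
qed

lemma f_radial_component:
  assumes k: "k = nat \<bar>n\<bar>"
  shows "radial_component A B s t n f g"
proof -
  interpret sw: radial_profile A' A B t s l k q p q' p' by (rule swap)
  have kn: "(real_of_int n)\<^sup>2 = (real k)\<^sup>2" using k by (simp add: power2_eq_square abs_mult_self_eq flip: of_int_mult)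
  have ode: "- deriv (deriv f) r - 1 / r * deriv f r + (of_int n)\<^sup>2 / r\<^sup>2 * f r
            + (A * ((f r)\<^sup>2 - s\<^sup>2) + B * ((g r)\<^sup>2 - t\<^sup>2)) * f r = 0" if r: "r > 0" for r
  proof -
    have 1: "deriv (deriv f) r = (((real k)\<^sup>2 + r\<^sup>2 * V (ln r)) * f r - p' (ln r)) / r\<^sup>2"
      using r by (simp add: deriv_deriv_f f''_def f_def)
    have 2: "deriv f r = p' (ln r) / r" using r by (simp add: deriv_f f'_def)
    show ?thesis unfolding 1 2 V_ln[OF r, symmetric] kn
      using r by (simp add: field_simps power2_eq_square)
  qed
  have nk: "n = 0 \<longleftrightarrow> k = 0" using k by auto
  show ?thesis
    unfolding radial_component_def
  proof (intro conjI f_continuous f_C2 f_at_top allI impI)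
    show "f r \<ge> 0" for r
    proof -
      have "p0 \<ge> 0" unfolding p0_def using coeff0(1) by (metis less_imp_le order_refl)
      then show ?thesis using pos(1)[of "ln r"] by (simp add: f_def)
    qed
    show "n \<noteq> 0 \<Longrightarrow> f 0 = 0" using nk by (simp add: f_0 p0_def)
    show "n = 0 \<Longrightarrow> (f has_real_derivative 0) (at 0 within {0..})" using nk f_deriv_0 by simp
  qed (rule ode)
qed

text \<open>The derivatives of the generators f, f', g, g' and 1/r stay in the algebra, since the
  equations express f'' and g'' polynomially through them.\<close>

lemma f_smooth: "smooth_pos f"
proof -
  interpret sw: radial_profile A' A B t s l k q p q' p' by (rule swap)
  define G where "G = {f, f', g, sw.f', \<lambda>r. 1 / r}"
  have mem: "f \<in> function_algebra G" "f' \<in> function_algebra G" "g \<in> function_algebra G"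
    "sw.f' \<in> function_algebra G" "(\<lambda>r. 1 / r) \<in> function_algebra G"
    by (auto simp: G_def intro: function_algebra.gen)
  \<comment> \<open>The equation solved for the second derivative, spelled with sums and products
    only so that the closure rules apply; \<open>c'\<close> and \<open>d'\<close> stand for
    constants such as -A s^2 and -B t^2.\<close>
  define F where "F a b c' d' m u w u' r = (m * (1 / r * (1 / r)) + (a * (u r * u r) + c') + (b * (w r * w r) + d')) * u r + (-1) * (1 / r * u' r)"
    for a b c' d' m :: real and u w u' :: "real \<Rightarrow> real" and r
  have Fmem: "(\<lambda>r. F a b c' d' m u w u' r) \<in> function_algebra G"
    if "u \<in> function_algebra G" "w \<in> function_algebra G" "u' \<in> function_algebra G" for a b c' d' m u w u'
    unfolding F_def by (intro function_algebra.add function_algebra.mult function_algebra.const mem that)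
  have Vr: "V (ln r) = A * ((f r)\<^sup>2 - s\<^sup>2) + B * ((g r)\<^sup>2 - t\<^sup>2)" "sw.V (ln r) = A' * ((g r)\<^sup>2 - t\<^sup>2) + B * ((f r)\<^sup>2 - s\<^sup>2)"
    if "r > 0" for r
    using V_ln[OF that] that by (simp_all add: sw.V_def f_def sw.f_def)
  have f2: "f'' r = F A B (- A * s\<^sup>2) (- B * t\<^sup>2) ((real k)\<^sup>2) f g f' r" if r: "r > 0" for r
    using r unfolding f''_def Vr(1)[OF r] F_def f'_def by (simp add: f_def sw.f_def field_simps power2_eq_square)
  have g2: "sw.f'' r = F A' B (- A' * t\<^sup>2) (- B * s\<^sup>2) ((real l)\<^sup>2) g f sw.f' r" if r: "r > 0" for r
    using r unfolding sw.f''_def Vr(2)[OF r] F_def sw.f'_def by (simp add: f_def sw.f_def field_simps power2_eq_square)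
  have "\<exists>h'\<in>function_algebra G. \<forall>r>0. (h has_real_derivative h' r) (at r)" if "h \<in> G" for h
  proof -
    have "h = f \<or> h = f' \<or> h = g \<or> h = sw.f' \<or> h = (\<lambda>r. 1 / r)"
      using that by (simp only: G_def insert_iff empty_iff simp_thms)
    then show ?thesis
    proof (elim disjE)
      assume h: "h = f"
      show ?thesis unfolding h by (rule bexI[OF _ mem(2)]) (use f_deriv in blast)
    next
      assume h: "h = f'"
      show ?thesis unfolding h
      proof (rule bexI)
        show "\<forall>r>0. (f' has_real_derivative F A B (- A * s\<^sup>2) (- B * t\<^sup>2) ((real k)\<^sup>2) f g f' r) (at r)"
          using f'_deriv f2 by auto
      qed (rule Fmem[OF mem(1,3,2)])
    next
      assume h: "h = g"
      show ?thesis unfolding h by (rule bexI[OF _ mem(4)]) (use sw.f_deriv in blast)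
    next
      assume h: "h = sw.f'"
      show ?thesis unfolding h
      proof (rule bexI)
        show "\<forall>r>0. (sw.f' has_real_derivative F A' B (- A' * t\<^sup>2) (- B * s\<^sup>2) ((real l)\<^sup>2) g f sw.f' r) (at r)"
          using sw.f'_deriv g2 by auto
      qed (rule Fmem[OF mem(3,1,4)])
    next
      assume h: "h = (\<lambda>r. 1 / r)"
      have d: "((\<lambda>r. 1 / r) has_real_derivative (-1) * (1 / r * (1 / r))) (at r)" if "r > 0" for r :: real
        using that by (auto intro!: derivative_eq_intros simp: power2_eq_square)
      have "(\<lambda>r. (-1) * (1 / r * (1 / r))) \<in> function_algebra G"
        by (intro function_algebra.mult function_algebra.const mem)
      then show ?thesis unfolding h by (rule bexI[rotated]) (use d in auto)
    qed
  qed
  from function_algebra_smooth[OF this mem(1)] show ?thesis .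
qed

text \<open>Pohozaev identity: the Hamiltonian \<open>p'\<^sup>2 + q'\<^sup>2 - k\<^sup>2 p\<^sup>2 - l\<^sup>2 q\<^sup>2 - e\<^bsup>2x\<^esup> W / 2\<close> has derivative \<open>- e\<^bsup>2x\<^esup> W\<close>.\<close>

lemma potential_integral:
  defines "W \<equiv> \<lambda>r. (A * ((f r)\<^sup>2 - s\<^sup>2)\<^sup>2 + 2 * B * ((f r)\<^sup>2 - s\<^sup>2) * ((g r)\<^sup>2 - t\<^sup>2) + A' * ((g r)\<^sup>2 - t\<^sup>2)\<^sup>2) * r"
  shows "set_integrable lborel {0<..} W" "(LINT r:{0<..}|lborel. W r) = (real k)\<^sup>2 * s\<^sup>2 + (real l)\<^sup>2 * t\<^sup>2"
proof -
  interpret sw: radial_profile A' A B t s l k q p q' p' by (rule swap)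
  define w where "w x = A * ((p x)\<^sup>2 - s\<^sup>2)\<^sup>2 + 2 * B * ((p x)\<^sup>2 - s\<^sup>2) * ((q x)\<^sup>2 - t\<^sup>2) + A' * ((q x)\<^sup>2 - t\<^sup>2)\<^sup>2" for x
  define H where "H x = (p' x)\<^sup>2 + (q' x)\<^sup>2 - (real k)\<^sup>2 * (p x)\<^sup>2 - (real l)\<^sup>2 * (q x)\<^sup>2 - exp (2 * x) * w x / 2" for x
  \<comment> \<open>Nonnegativity of the potential lets the nonnegative form of the fundamental
    theorem give integrability and value at once.\<close>
  have w0: "w x \<ge> 0" for x
  proof -
    have "0 \<le> (A * A' - B\<^sup>2) / (A + A') * (((p x)\<^sup>2 - s\<^sup>2)\<^sup>2 + ((q x)\<^sup>2 - t\<^sup>2)\<^sup>2)"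
      using A AB by (intro mult_nonneg_nonneg) auto
    also have "\<dots> \<le> w x" unfolding w_def by (rule positive_definite_form[OF A])
    finally show ?thesis .
  qed
  have dw: "(w has_real_derivative 4 * (V x * p x * p' x + sw.V x * q x * q' x)) (at x)" for x
    unfolding w_def[abs_def] V_def sw.V_def
    by (auto intro!: derivative_eq_intros p q simp: algebra_simps power2_eq_square)
  have dH: "(H has_real_derivative - exp (2 * x) * w x) (at x)" for x
    unfolding H_def[abs_def]
    by (auto intro!: derivative_eq_intros p q p'' sw.p'' dw simp: algebra_simps power2_eq_square)
  \<comment> \<open>The terms with k^2 and l^2 vanish in the limit because a component tends to 0 at
    the origin unless its degree is 0.\<close>
  have H_bot: "(H \<longlongrightarrow> 0) at_bot"
  proof -
    have e: "((\<lambda>x. exp (2 * x :: real)) \<longlongrightarrow> 0) at_bot"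
      by (intro filterlim_compose[OF exp_at_bot] filterlim_tendsto_pos_mult_at_bot[OF tendsto_const] filterlim_ident) simp
    have z: "(f' \<longlongrightarrow> 0) at_bot" if "\<exists>E X. \<forall>x\<le>X. \<bar>f' x\<bar> \<le> E * exp x" for f' :: "real \<Rightarrow> real"
    proof -
      from that obtain E X where E: "\<And>x. x \<le> X \<Longrightarrow> \<bar>f' x\<bar> \<le> E * exp x" by blast
      have "((\<lambda>x. E * exp x) \<longlongrightarrow> E * 0) at_bot" by (intro tendsto_intros exp_at_bot)
      then show ?thesis
        by (intro Lim_null_comparison[of f' "\<lambda>x. E * exp x"]) (use E in \<open>auto simp: eventually_at_bot_linorder\<close>)
    qed
    have "(H \<longlongrightarrow> 0\<^sup>2 + 0\<^sup>2 - (real k)\<^sup>2 * p0\<^sup>2 - (real l)\<^sup>2 * sw.p0\<^sup>2 -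
       0 * (A * (p0\<^sup>2 - s\<^sup>2)\<^sup>2 + 2 * B * (p0\<^sup>2 - s\<^sup>2) * (sw.p0\<^sup>2 - t\<^sup>2) + A' * (sw.p0\<^sup>2 - t\<^sup>2)\<^sup>2) / 2) at_bot"
      unfolding H_def[abs_def] w_def
      by (intro tendsto_intros e z p'_at_bot_bound sw.p'_at_bot_bound p_at_bot sw.p_at_bot) auto
    then show ?thesis by (simp add: p0_def sw.p0_def split: if_splits)
  qed
  have H_top: "(H \<longlongrightarrow> - ((real k)\<^sup>2 * s\<^sup>2) - (real l)\<^sup>2 * t\<^sup>2) at_top"
  proof -
    \<comment> \<open>The form in p^2 - s^2 and q^2 - t^2 is rewritten through the inverse matrix as
      a form in \<open>V\<close> and its counterpart, whose products with exp x are known to tend to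
      0.\<close>
    have "exp (2 * x) * w x = (A' * (exp x * V x)\<^sup>2 - 2 * B * (exp x * V x) * (exp x * sw.V x) + A * (exp x * sw.V x)\<^sup>2) / (A * A' - B\<^sup>2)" for x
    proof -
      have "w x * (A * A' - B\<^sup>2) = A' * (V x)\<^sup>2 - 2 * B * V x * sw.V x + A * (sw.V x)\<^sup>2"
        unfolding w_def V_def sw.V_def by (simp add: algebra_simps power2_eq_square)
      then have "w x = (A' * (V x)\<^sup>2 - 2 * B * V x * sw.V x + A * (sw.V x)\<^sup>2) / (A * A' - B\<^sup>2)"
        using AB by (simp add: eq_divide_eq)
      moreover have "exp (2 * x) = exp x * exp x" by (simp flip: exp_add)
      ultimately show ?thesis by (simp add: algebra_simps power2_eq_square)
    qed
    moreover have "((\<lambda>x. (A' * (exp x * V x)\<^sup>2 - 2 * B * (exp x * V x) * (exp x * sw.V x) + A * (exp x * sw.V x)\<^sup>2) / (A * A' - B\<^sup>2))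
       \<longlongrightarrow> (A' * 0\<^sup>2 - 2 * B * 0 * 0 + A * 0\<^sup>2) / (A * A' - B\<^sup>2)) at_top"
      by (intro tendsto_intros V_at_top sw.V_at_top) (use AB in auto)
    ultimately have "((\<lambda>x. exp (2 * x) * w x) \<longlongrightarrow> 0) at_top" by simp
    then have "(H \<longlongrightarrow> 0\<^sup>2 + 0\<^sup>2 - (real k)\<^sup>2 * s\<^sup>2 - (real l)\<^sup>2 * t\<^sup>2 - 0 / 2) at_top"
      unfolding H_def[abs_def]
      by (intro tendsto_intros p'_at_top sw.p'_at_top p_at_top sw.p_at_top) auto
    then show ?thesis by simp
  qed
  have Wr: "W r = w (ln r) * r" if "r > 0" for r using that by (simp add: W_def w_def f_def sw.f_def)
  have cf: "isCont f r" "isCont g r" if "r > 0" for r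
    using f_deriv[OF that] sw.f_deriv[OF that] by (auto intro: DERIV_isCont)
  have dF: "((\<lambda>r. - H (ln r)) has_real_derivative W r) (at r)" if "ereal 0 < ereal r" for r
  proof -
    have r: "r > 0" using that by simp
    have "((\<lambda>r. - H (ln r)) has_real_derivative - (- exp (2 * ln r) * w (ln r) * (1 / r))) (at r)"
      by (intro DERIV_minus DERIV_chain2[OF dH]) (use r in \<open>auto intro!: derivative_eq_intros\<close>)
    moreover have "- (- exp (2 * ln r) * w (ln r) * (1 / r)) = W r"
      using r unfolding exp_2_ln[OF r] Wr[OF r] by (simp add: power2_eq_square)
    ultimately show ?thesis by simp
  qed
  have cW: "isCont W r" if "ereal 0 < ereal r" for r
    unfolding W_def using cf[of r] that by (intro continuous_intros) auto
  have nn: "AE r in lborel. ereal 0 < ereal r \<longrightarrow> ereal r < \<infinity> \<longrightarrow> 0 \<le> W r" using w0 by (auto simp: Wr)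
  have "((\<lambda>r. - H (ln r)) \<longlongrightarrow> - 0) (at_right 0)"
    by (intro tendsto_minus filterlim_compose[OF H_bot ln_at_0])
  then have l0: "(((\<lambda>r. - H (ln r)) \<circ> real_of_ereal) \<longlongrightarrow> 0) (at_right (ereal 0))" by (simp add: ereal_tendsto_simps)
  have "((\<lambda>r. - H (ln r)) \<longlongrightarrow> - (- ((real k)\<^sup>2 * s\<^sup>2) - (real l)\<^sup>2 * t\<^sup>2)) at_top"
    by (intro tendsto_minus filterlim_compose[OF H_top ln_at_top])
  then have l1: "(((\<lambda>r. - H (ln r)) \<circ> real_of_ereal) \<longlongrightarrow> (real k)\<^sup>2 * s\<^sup>2 + (real l)\<^sup>2 * t\<^sup>2) (at_left \<infinity>)"
    by (simp add: ereal_tendsto_simps add.commute)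
  have "ereal 0 < \<infinity>" by simp
  note I = interval_integral_FTC_nonneg[OF this dF cW nn l0 l1]
  show "set_integrable lborel {0<..} W" using I(1) by simp
  show "(LINT r:{0<..}|lborel. W r) = (real k)\<^sup>2 * s\<^sup>2 + (real l)\<^sup>2 * t\<^sup>2"
    using I(2) by (simp add: interval_lebesgue_integral_def)
qed

text \<open>The factor \<open>f r / r ^ k\<close> as a function of \<open>\<sigma> = r\<^sup>2\<close>.\<close>

lemma planar_factor:
  "\<exists>W W1 W2 c c1. (\<forall>\<sigma>>0. (W has_real_derivative W1 \<sigma>) (at \<sigma>) \<and> (W1 has_real_derivative W2 \<sigma>) (at \<sigma>)) \<and>
    continuous_on {0<..} W2 \<and> (W \<longlongrightarrow> c) (at_right 0) \<and> (W1 \<longlongrightarrow> c1) (at_right 0) \<and>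
    ((\<lambda>\<sigma>. \<sigma> * W2 \<sigma>) \<longlongrightarrow> 0) (at_right 0) \<and> (\<forall>r>0. f r = r ^ k * W (r\<^sup>2)) \<and> (k = 0 \<longrightarrow> f 0 = c) \<and>
    (\<forall>\<sigma>>0. 4 * \<sigma> * W2 \<sigma> + 4 * (real k + 1) * W1 \<sigma> = V (ln \<sigma> / 2) * W \<sigma>)"
proof -
  interpret sw: radial_profile A' A B t s l k q p q' p' by (rule swap)
  define e where "e x = exp (- (real k * x))" for x
  \<comment> \<open>The derivative of p exp (-k x), that is of f / r^k in the variable x.\<close>
  define N where "N x = (p' x - real k * p x) * e x" for x
  have de: "(e has_real_derivative - real k * e x) (at x)" for x
    unfolding e_def[abs_def] by (auto intro!: derivative_eq_intros)
  have dpe: "((\<lambda>x. p x * e x) has_real_derivative N x) (at x)" for x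
    unfolding N_def by (rule derivative_eq_intros p de refl)+ (simp add: algebra_simps)
  have dN: "(N has_real_derivative exp (2 * x) * V x * (p x * e x) - 2 * real k * N x) (at x)" for x
    unfolding N_def[abs_def]
    by (rule derivative_eq_intros p p'' de refl)+ (simp add: N_def algebra_simps power2_eq_square)
  have dx: "((\<lambda>\<sigma>. ln \<sigma> / 2) has_real_derivative 1 / (2 * \<sigma>)) (at \<sigma>)" if "\<sigma> > 0" for \<sigma> :: real
    using that by (auto intro!: derivative_eq_intros)
  define W where "W \<sigma> = p (ln \<sigma> / 2) * e (ln \<sigma> / 2)" for \<sigma>
  define W1 where "W1 \<sigma> = N (ln \<sigma> / 2) / (2 * \<sigma>)" for \<sigma>
  define W2 where "W2 \<sigma> = V (ln \<sigma> / 2) * W \<sigma> / (4 * \<sigma>) - (real k + 1) * W1 \<sigma> / \<sigma>" for \<sigma>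
  have dW: "(W has_real_derivative W1 \<sigma>) (at \<sigma>)" if "\<sigma> > 0" for \<sigma>
    unfolding W_def[abs_def] W1_def using DERIV_chain2[OF dpe dx[OF that]] by simp
  have dNs: "((\<lambda>\<sigma>. N (ln \<sigma> / 2)) has_real_derivative
      (\<sigma> * V (ln \<sigma> / 2) * W \<sigma> - 2 * real k * N (ln \<sigma> / 2)) * (1 / (2 * \<sigma>))) (at \<sigma>)" if "\<sigma> > 0" for \<sigma>
    using DERIV_chain2[OF dN dx[OF that]] that by (simp add: W_def)
  have dW1: "(W1 has_real_derivative W2 \<sigma>) (at \<sigma>)" if s: "\<sigma> > 0" for \<sigma>
  proof -
    have "(W1 has_real_derivative ((\<sigma> * V (ln \<sigma> / 2) * W \<sigma> - 2 * real k * N (ln \<sigma> / 2)) * (1 / (2 * \<sigma>)) * (2 * \<sigma>)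
        - N (ln \<sigma> / 2) * (2 * 1)) / (2 * \<sigma> * (2 * \<sigma>))) (at \<sigma>)"
      unfolding W1_def[abs_def] using s by (intro DERIV_divide dNs DERIV_cmult DERIV_ident) auto
    moreover have "((\<sigma> * V (ln \<sigma> / 2) * W \<sigma> - 2 * real k * N (ln \<sigma> / 2)) * (1 / (2 * \<sigma>)) * (2 * \<sigma>)
        - N (ln \<sigma> / 2) * (2 * 1)) / (2 * \<sigma> * (2 * \<sigma>)) = W2 \<sigma>"
      using s by (simp add: W2_def W1_def field_simps)
    ultimately show ?thesis by simp
  qed
  have lnb: "filterlim (\<lambda>\<sigma>::real. ln \<sigma> / 2) at_bot (at_right 0)"
    using filterlim_tendsto_pos_mult_at_bot[OF tendsto_const[of "1 / 2"] _ ln_at_0] by (simp add: field_simps)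
  have W0: "(W \<longlongrightarrow> coeff0) (at_right 0)"
    unfolding W_def e_def by (rule filterlim_compose[OF coeff0(2) lnb])
  have N0: "(N \<longlongrightarrow> 0) at_bot"
  proof -
    obtain D X where D: "\<And>x. x \<le> X \<Longrightarrow> \<bar>p' x / p x - real k\<bar> \<le> D * exp (2 * x)"
      using log_derivative by blast
    have "((\<lambda>x. D * exp (2 * x)) \<longlongrightarrow> D * 0) at_bot"
      by (intro tendsto_intros filterlim_compose[OF exp_at_bot] filterlim_tendsto_pos_mult_at_bot[OF tendsto_const] filterlim_ident) simp
    then have e: "((\<lambda>x. D * exp (2 * x)) \<longlongrightarrow> 0) at_bot" by simp
    have "((\<lambda>x. p' x / p x - real k) \<longlongrightarrow> 0) at_bot"
    proof (rule Lim_null_comparison[OF _ e])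
      show "\<forall>\<^sub>F x in at_bot. norm (p' x / p x - real k) \<le> D * exp (2 * x)"
        unfolding eventually_at_bot_linorder real_norm_def using D by blast
    qed
    from tendsto_mult[OF this coeff0(2)]
    have "((\<lambda>x. (p' x / p x - real k) * (p x * exp (- (real k * x)))) \<longlongrightarrow> 0) at_bot" by simp
    moreover have "(p' x / p x - real k) * (p x * exp (- (real k * x))) = N x" for x
      using pos(1)[of x] by (simp add: N_def e_def field_simps)
    ultimately show ?thesis by simp
  qed
  define V0 where "V0 = A * (p0\<^sup>2 - s\<^sup>2) + B * (sw.p0\<^sup>2 - t\<^sup>2)"
  have VV: "((\<lambda>\<sigma>. V (ln \<sigma> / 2)) \<longlongrightarrow> V0) (at_right 0)"
  proof (rule filterlim_compose[OF _ lnb])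
    show "(V \<longlongrightarrow> V0) at_bot" unfolding V_def[abs_def] V0_def by (intro tendsto_intros p_at_bot sw.p_at_bot)
  qed
  have dpow: "((\<lambda>\<sigma>::real. \<sigma> ^ Suc k) has_real_derivative real (Suc k) * \<sigma> ^ k) (at \<sigma>)" for \<sigma>
    using DERIV_pow[of "Suc k" \<sigma>] by simp
  \<comment> \<open>The value forced on the limit of \<open>W1\<close> by 4 \<sigma> W2 + 4 (k + 1)
    W1 = V W when \<sigma> W2 tends to 0.\<close>
  define c1 where "c1 = V0 * coeff0 / (4 * (real k + 1))"
  have pos0: "\<forall>\<^sub>F \<sigma> in at_right 0. \<sigma> > (0::real)" by (rule eventually_at_right_less)
  \<comment> \<open>The equation says that \<sigma>^(k+1) W1 has derivative \<sigma>^k V W / 4.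
    Expanding by this power makes \<open>W1\<close> a quotient to which l'Hopital's rule applies;
    the limit of \<sigma> W2 then follows from the equation.\<close>
  have "((\<lambda>\<sigma>. \<sigma> ^ Suc k * W1 \<sigma> / \<sigma> ^ Suc k) \<longlongrightarrow> c1) (at_right 0)"
  proof (rule lhopital_right_0[where f'="\<lambda>\<sigma>. \<sigma> ^ k * V (ln \<sigma> / 2) * W \<sigma> / 4" and g'="\<lambda>\<sigma>. real (Suc k) * \<sigma> ^ k"])
    have "((\<lambda>\<sigma>. \<sigma> ^ k * (N (ln \<sigma> / 2) / 2)) \<longlongrightarrow> 0 ^ k * (0 / 2)) (at_right 0)"
      by (intro tendsto_intros filterlim_compose[OF N0 lnb])  auto
    moreover have "\<forall>\<^sub>F \<sigma> in at_right 0. \<sigma> ^ k * (N (ln \<sigma> / 2) / 2) = \<sigma> ^ Suc k * W1 \<sigma>"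
      using pos0 by eventually_elim (simp add: W1_def)
    ultimately have "((\<lambda>\<sigma>. \<sigma> ^ Suc k * W1 \<sigma>) \<longlongrightarrow> 0 ^ k * (0 / 2)) (at_right 0)" by (rule Lim_transform_eventually)
    then show "((\<lambda>\<sigma>. \<sigma> ^ Suc k * W1 \<sigma>) \<longlongrightarrow> 0) (at_right 0)" by simp
    have "((\<lambda>\<sigma>::real. \<sigma> ^ Suc k) \<longlongrightarrow> 0 ^ Suc k) (at_right 0)" by (intro tendsto_intros)
    then show "((\<lambda>\<sigma>::real. \<sigma> ^ Suc k) \<longlongrightarrow> 0) (at_right 0)" by simp
    show "\<forall>\<^sub>F \<sigma> in at_right 0. \<sigma> ^ Suc k \<noteq> (0::real)" "\<forall>\<^sub>F \<sigma> in at_right 0. real (Suc k) * \<sigma> ^ k \<noteq> (0::real)"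
      using pos0 by (eventually_elim, simp)+
    show "\<forall>\<^sub>F \<sigma> in at_right 0. ((\<lambda>\<sigma>::real. \<sigma> ^ Suc k) has_real_derivative real (Suc k) * \<sigma> ^ k) (at \<sigma>)"
      by (intro always_eventually allI dpow)
    show "\<forall>\<^sub>F \<sigma> in at_right 0. ((\<lambda>\<sigma>. \<sigma> ^ Suc k * W1 \<sigma>) has_real_derivative \<sigma> ^ k * V (ln \<sigma> / 2) * W \<sigma> / 4) (at \<sigma>)"
      using pos0
    proof eventually_elim
      case (elim \<sigma>)
      have "((\<lambda>\<sigma>. \<sigma> ^ Suc k * W1 \<sigma>) has_real_derivative (real (Suc k) * \<sigma> ^ k) * W1 \<sigma> + W2 \<sigma> * \<sigma> ^ Suc k) (at \<sigma>)"
        by (rule DERIV_mult[OF dpow dW1[OF elim]])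
      moreover have "(real (Suc k) * \<sigma> ^ k) * W1 \<sigma> + W2 \<sigma> * \<sigma> ^ Suc k = \<sigma> ^ k * V (ln \<sigma> / 2) * W \<sigma> / 4"
        using elim by (simp add: W2_def field_simps)
      ultimately show ?case by (rule DERIV_cong)
    qed
    have "((\<lambda>\<sigma>. V (ln \<sigma> / 2) * W \<sigma> / (4 * (real k + 1))) \<longlongrightarrow> c1) (at_right 0)"
      unfolding c1_def by (intro tendsto_intros VV W0) auto
    moreover have "\<forall>\<^sub>F \<sigma> in at_right 0. V (ln \<sigma> / 2) * W \<sigma> / (4 * (real k + 1)) = \<sigma> ^ k * V (ln \<sigma> / 2) * W \<sigma> / 4 / (real (Suc k) * \<sigma> ^ k)"
      using pos0
    proof eventually_elim
      case (elim \<sigma>)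
      have "a * v * w / 4 / (c * a) = v * w / (4 * c)" if "a \<noteq> 0" for a v w c :: real using that by simp
      from this[of "\<sigma> ^ k" "V (ln \<sigma> / 2)" "W \<sigma>" "real (Suc k)"] elim
      show ?case by (simp add: add.commute)
    qed
    ultimately show "((\<lambda>\<sigma>. \<sigma> ^ k * V (ln \<sigma> / 2) * W \<sigma> / 4 / (real (Suc k) * \<sigma> ^ k)) \<longlongrightarrow> c1) (at_right 0)"
      by (rule Lim_transform_eventually)
  qed
  moreover have "\<forall>\<^sub>F \<sigma> in at_right 0. \<sigma> ^ Suc k * W1 \<sigma> / \<sigma> ^ Suc k = W1 \<sigma>"
    using pos0 by eventually_elim simp
  ultimately have W10: "(W1 \<longlongrightarrow> c1) (at_right 0)" by (rule Lim_transform_eventually)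
  have "((\<lambda>\<sigma>. V (ln \<sigma> / 2) * W \<sigma> / 4 - (real k + 1) * W1 \<sigma>) \<longlongrightarrow> V0 * coeff0 / 4 - (real k + 1) * c1) (at_right 0)"
    by (intro tendsto_intros VV W0 W10) auto
  moreover have "V0 * coeff0 / 4 - (real k + 1) * c1 = 0"
    unfolding c1_def by (simp add: field_simps)
  moreover have "\<forall>\<^sub>F \<sigma> in at_right 0. V (ln \<sigma> / 2) * W \<sigma> / 4 - (real k + 1) * W1 \<sigma> = \<sigma> * W2 \<sigma>"
    using pos0 by eventually_elim (simp add: W2_def field_simps)
  ultimately have W20: "((\<lambda>\<sigma>. \<sigma> * W2 \<sigma>) \<longlongrightarrow> 0) (at_right 0)"
    using Lim_transform_eventually by fastforce
  have cW: "continuous_on {0<..} W" "continuous_on {0<..} W1"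
    using dW dW1 by (auto intro!: continuous_at_imp_continuous_on DERIV_isCont)
  have cW2: "continuous_on {0<..} W2"
    unfolding W2_def V_def
    by (intro continuous_intros cW continuous_on_compose2[OF continuous_p] continuous_on_compose2[OF continuous_q]
        continuous_on_ln_pos) auto
  have fW: "f r = r ^ k * W (r\<^sup>2)" if r: "r > 0" for r
  proof -
    have "exp (real k * ln r) = r ^ k" using r by (simp add: exp_of_nat_mult)
    then have "r ^ k * e (ln r) = 1" using r by (simp add: e_def exp_minus)
    moreover have "ln (r\<^sup>2) / 2 = ln r" using r by (simp add: ln_realpow)
    ultimately show ?thesis using r by (simp add: W_def f_def)
  qed
  have eq: "4 * \<sigma> * W2 \<sigma> + 4 * (real k + 1) * W1 \<sigma> = V (ln \<sigma> / 2) * W \<sigma>" if "\<sigma> > 0" for \<sigma>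
    using that by (simp add: W2_def field_simps)
  have f0: "k = 0 \<longrightarrow> f 0 = coeff0" unfolding f_0 p0_def by (rule impI) (rule if_P)
  show ?thesis
    by (intro exI[of _ W] exI[of _ W1] exI[of _ W2] exI[of _ coeff0] exI[of _ c1] conjI)
      (use dW dW1 cW2 W0 W10 W20 fW f0 eq in auto)
qed

end

section \<open>Vortex fields on the plane\<close>

lemma vec2_expand: "(h :: real^2) = h $ 1 *\<^sub>R axis 1 1 + h $ 2 *\<^sub>R axis 2 1"
  by (simp add: vec_eq_iff forall_2 axis_def)

lemma linear_vec2:
  fixes D :: "real^2 \<Rightarrow> complex"
  assumes "bounded_linear D"
  shows "D h = h $ 1 *\<^sub>R D (axis 1 1) + h $ 2 *\<^sub>R D (axis 2 1)"
proof -
  interpret bounded_linear D by fact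
  have "D h = D (h $ 1 *\<^sub>R axis 1 1 + h $ 2 *\<^sub>R axis 2 1)" using vec2_expand[of h] by simp
  then show ?thesis by (simp add: add scaleR)
qed

text \<open>The mean value inequality is applied on the segment from 0 to y to u minus the candidate
  derivative \<open>T\<close>. Only derivatives at points of the open segment enter, and these are
  close to \<open>T\<close> because their two columns converge.\<close>

lemma removable_derivative:
  fixes u :: "real^2 \<Rightarrow> complex"
  assumes u0: "continuous_on UNIV u"
    and D: "\<And>x. x \<noteq> 0 \<Longrightarrow> (u has_derivative D x) (at x)"
    and lim: "\<And>i. ((\<lambda>x. D x (axis i 1)) \<longlongrightarrow> L i) (at 0)"
  shows "(u has_derivative (\<lambda>h. h $ 1 *\<^sub>R L 1 + h $ 2 *\<^sub>R L 2)) (at 0)"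
proof -
  define T where "T h = h $ 1 *\<^sub>R L 1 + h $ 2 *\<^sub>R L 2" for h :: "real^2"
  have blT: "bounded_linear T"
    unfolding T_def[abs_def]
    by (intro bounded_linear_add bounded_linear_compose[OF bounded_linear_scaleR_left] bounded_linear_vec_nth)
  have est: "\<exists>d>0. \<forall>y. norm (y - 0) < d \<longrightarrow> norm (u y - u 0 - T (y - 0)) \<le> e * norm (y - 0)"
    if e: "e > 0" for e
  proof -
    have "\<forall>\<^sub>F x in at 0. dist (D x (axis 1 1)) (L 1) < e / 2" "\<forall>\<^sub>F x in at 0. dist (D x (axis 2 1)) (L 2) < e / 2"
      using e by (intro tendstoD[OF lim]; simp)+
    then have "\<forall>\<^sub>F x in at 0. dist (D x (axis 1 1)) (L 1) < e / 2 \<and> dist (D x (axis 2 1)) (L 2) < e / 2"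
      by eventually_elim auto
    then obtain d where d: "d > 0" "\<And>x. x \<noteq> 0 \<Longrightarrow> norm x < d \<Longrightarrow>
        norm (D x (axis 1 1) - L 1) < e / 2 \<and> norm (D x (axis 2 1) - L 2) < e / 2"
      unfolding eventually_at dist_norm by auto
    have "norm (u y - u 0 - T y) \<le> e * norm y" if y: "y \<noteq> 0" "norm y < d" for y
    proof -
      define v where "v r = u (r *\<^sub>R y) - T (r *\<^sub>R y)" for r :: real
      have "continuous_on {0..1} v"
        unfolding v_def
        by (intro continuous_intros continuous_on_compose2[OF u0] linear_continuous_on_compose[OF _ bounded_linear.linear[OF blT]]) auto
      moreover have "(v has_derivative (\<lambda>h. D (r *\<^sub>R y) (h *\<^sub>R y) - T (h *\<^sub>R y))) (at r)" if "0 < r" "r < 1" for r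
      proof -
        have "r *\<^sub>R y \<noteq> 0" using that y by simp
        then have "((\<lambda>r. u (r *\<^sub>R y)) has_derivative (\<lambda>h. D (r *\<^sub>R y) (h *\<^sub>R y))) (at r)"
          by (intro has_derivative_compose[OF _ D, of "\<lambda>r. r *\<^sub>R y"] derivative_intros)
        moreover have "((\<lambda>r. T (r *\<^sub>R y)) has_derivative (\<lambda>h. T (h *\<^sub>R y))) (at r)"
          by (intro bounded_linear.has_derivative[OF blT] derivative_intros)
        ultimately show ?thesis unfolding v_def by (rule has_derivative_diff)
      qed
      ultimately obtain r where r: "r \<in> {0<..<1}" "norm (v 1 - v 0) \<le> norm (D (r *\<^sub>R y) ((1 - 0) *\<^sub>R y) - T ((1 - 0) *\<^sub>R y))"
        using mvt_general[of 0 1 v "\<lambda>r h. D (r *\<^sub>R y) (h *\<^sub>R y) - T (h *\<^sub>R y)"] by auto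
      have ry: "r *\<^sub>R y \<noteq> 0" "norm (r *\<^sub>R y) < d"
      proof -
        show "r *\<^sub>R y \<noteq> 0" using r y by simp
        have "\<bar>r\<bar> * norm y \<le> 1 * norm y" using r by (intro mult_right_mono) auto
        moreover have "norm (r *\<^sub>R y) = \<bar>r\<bar> * norm y" by (rule norm_scaleR)
        ultimately show "norm (r *\<^sub>R y) < d" using y by linarith
      qed
      have "D (r *\<^sub>R y) y - T y = y $ 1 *\<^sub>R (D (r *\<^sub>R y) (axis 1 1) - L 1) + y $ 2 *\<^sub>R (D (r *\<^sub>R y) (axis 2 1) - L 2)"
        using linear_vec2[OF has_derivative_bounded_linear[OF D[OF ry(1)]], of y]
        by (simp add: T_def scaleR_diff_right)
      then have "norm (D (r *\<^sub>R y) y - T y) \<le> \<bar>y $ 1\<bar> * norm (D (r *\<^sub>R y) (axis 1 1) - L 1) + \<bar>y $ 2\<bar> * norm (D (r *\<^sub>R y) (axis 2 1) - L 2)"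
        using norm_triangle_ineq by (metis norm_scaleR)
      also have "\<dots> \<le> norm y * (e / 2) + norm y * (e / 2)"
        using d(2)[OF ry] component_le_norm_cart[of y] by (intro add_mono mult_mono) auto
      finally have "norm (D (r *\<^sub>R y) y - T y) \<le> e * norm y" by simp
      moreover have "T 0 = 0" by (simp add: T_def)
      ultimately show ?thesis using r(2) by (simp add: v_def algebra_simps)
    qed
    moreover have "T 0 = 0" by (simp add: T_def)
    ultimately have "norm (u y - u 0 - T (y - 0)) \<le> e * norm (y - 0)" if "norm (y - 0) < d" for y
      using that by (cases "y = 0") auto
    then show ?thesis using d(1) by blast
  qed
  show ?thesis
    unfolding T_def[symmetric] has_derivative_at_alt using blT est by blast
qed

text \<open>To be applied twice, to u and to its first partial derivatives; therefore the partial
  derivative is also returned as an explicit piecewise function.\<close>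

lemma C1_plane_removable:
  fixes u :: "real^2 \<Rightarrow> complex"
  assumes u0: "continuous_on UNIV u"
    and D: "\<And>x. x \<noteq> 0 \<Longrightarrow> (u has_derivative D x) (at x)"
    and lim: "\<And>i. ((\<lambda>x. D x (axis i 1)) \<longlongrightarrow> L i) (at 0)"
    and cont: "\<And>i. continuous_on (- {0}) (\<lambda>x. D x (axis i 1))"
  shows "C1_plane u" and "partial_deriv i u = (\<lambda>x. if x = 0 then L i else D x (axis i 1))"
proof -
  have D0: "(u has_derivative (\<lambda>h. h $ 1 *\<^sub>R L 1 + h $ 2 *\<^sub>R L 2)) (at 0)"
    by (rule removable_derivative[OF u0 D lim])
  show pd: "partial_deriv i u = (\<lambda>x. if x = 0 then L i else D x (axis i 1))" for i
  proof
    fix x :: "real^2"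
    show "partial_deriv i u x = (if x = 0 then L i else D x (axis i 1))"
    proof (cases "x = 0")
      case True
      have "i = 1 \<or> i = 2" by (rule exhaust_2)
      then show ?thesis
        unfolding True partial_deriv_def frechet_derivative_at[OF D0, symmetric] by (auto simp: axis_def)
    next
      case False
      then show ?thesis
        unfolding partial_deriv_def frechet_derivative_at[OF D[OF False], symmetric] by simp
    qed
  qed
  have "isCont (\<lambda>x. if x = 0 then L i else D x (axis i 1)) x" for i x
  proof (cases "x = 0")
    case True
    have "((\<lambda>x. if x = 0 then L i else D x (axis i 1)) \<longlongrightarrow> L i) (at 0)"
      by (rule Lim_transform_eventually[OF lim]) (auto simp: eventually_at_filter)
    then show ?thesis using True by (simp add: isCont_def)
  next
    case False
    then have "isCont (\<lambda>x. D x (axis i 1)) x"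
      using continuous_on_eq_continuous_at[THEN iffD1, OF _ cont[of i]] by (simp add: open_Compl)
    moreover have "\<forall>\<^sub>F y in nhds x. D y (axis i 1) = (if y = 0 then L i else D y (axis i 1))"
      using t1_space_nhds[OF False] by eventually_elim auto
    ultimately show ?thesis using isCont_cong by fast
  qed
  then show "C1_plane u"
    unfolding C1_plane_def pd using D0 D
    by (auto simp: differentiable_def continuous_on_eq_continuous_at) (metis D D0)
qed

text \<open>The complex coordinate for \<tau> = 1 and its conjugate for \<tau> = -1, so that degrees
  of both signs share one computation.\<close>

definition planar :: "real \<Rightarrow> real^2 \<Rightarrow> complex" where
  "planar \<tau> x = of_real (x $ 1) + \<i> * of_real (\<tau> * x $ 2)"

lemma bounded_linear_planar: "bounded_linear (planar \<tau>)"
  unfolding linear_conv_bounded_linear[symmetric]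
  by (rule linearI) (simp_all add: planar_def algebra_simps scaleR_conv_of_real[where 'a=complex])

lemma planar_has_derivative: "(planar \<tau> has_derivative planar \<tau>) (at x)"
  by (rule bounded_linear_imp_has_derivative[OF bounded_linear_planar])

definition sqn :: "real^2 \<Rightarrow> real" where "sqn x = (x $ 1)\<^sup>2 + (x $ 2)\<^sup>2"

lemma sqn_norm: "sqn x = (norm x)\<^sup>2"
  by (simp add: sqn_def norm_vec_def L2_set_def sum_2)

lemma sqn_pos [simp]: "0 < sqn x \<longleftrightarrow> x \<noteq> 0"
  by (simp add: sqn_norm)

lemma sqn_has_derivative: "(sqn has_derivative (\<lambda>h. 2 * (x $ 1 * h $ 1 + x $ 2 * h $ 2))) (at x)"
proof -
  have c: "((\<lambda>x. x $ i) has_derivative (\<lambda>h. h $ i)) (at x)" for i :: 2 and x :: "real^2"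
    by (rule bounded_linear_imp_has_derivative[OF bounded_linear_vec_nth])
  show ?thesis unfolding sqn_def[abs_def] by (rule derivative_eq_intros c refl)+ (auto simp: algebra_simps)
qed

text \<open>Cartesian form of f(r) e^(i n \<theta>) with w(r^2) = f(r) / r^k. No angle occurs, which
  makes it tractable near the origin.\<close>

definition vortex_field :: "(real \<Rightarrow> real) \<Rightarrow> real \<Rightarrow> nat \<Rightarrow> real^2 \<Rightarrow> complex" where
  "vortex_field w \<tau> k x = of_real (w (sqn x)) * planar \<tau> x ^ k"

text \<open>Written in terms of vortex fields again, so that the differentiation rule can be applied
  to the result. For k = 0 the truncated exponent \<open>k - 1\<close> is harmless because of the
  factor k.\<close>

definition vortex_deriv :: "(real \<Rightarrow> real) \<Rightarrow> (real \<Rightarrow> real) \<Rightarrow> real \<Rightarrow> nat \<Rightarrow> real^2 \<Rightarrow> real^2 \<Rightarrow> complex" where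
  "vortex_deriv w w1 \<tau> k x h =
     of_real (2 * (x $ 1 * h $ 1 + x $ 2 * h $ 2)) * vortex_field w1 \<tau> k x
     + of_nat k * planar \<tau> h * vortex_field w \<tau> (k - 1) x"

lemma vortex_field_has_derivative:
  assumes x: "x \<noteq> 0" and w: "(w has_real_derivative w1 (sqn x)) (at (sqn x))"
  shows "(vortex_field w \<tau> k has_derivative vortex_deriv w w1 \<tau> k x) (at x)"
proof -
  have 1: "((\<lambda>x. w (sqn x)) has_derivative (\<lambda>h. w1 (sqn x) * (2 * (x $ 1 * h $ 1 + x $ 2 * h $ 2)))) (at x)"
    by (rule has_derivative_compose[OF sqn_has_derivative w[unfolded has_field_derivative_def]])
  have 2: "((\<lambda>x. of_real (w (sqn x)) :: complex) has_derivative (\<lambda>h. of_real (w1 (sqn x) * (2 * (x $ 1 * h $ 1 + x $ 2 * h $ 2))))) (at x)"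
    by (rule bounded_linear.has_derivative[OF bounded_linear_of_real 1])
  have 3: "((\<lambda>x. planar \<tau> x ^ k) has_derivative (\<lambda>h. of_nat k * planar \<tau> h * planar \<tau> x ^ (k - 1))) (at x)"
    by (rule has_derivative_power[OF planar_has_derivative])
  show ?thesis
    unfolding vortex_field_def[abs_def]
    by (rule has_derivative_eq_rhs[OF has_derivative_mult[OF 2 3]])
      (auto simp: vortex_deriv_def vortex_field_def algebra_simps)
qed

lemma sqn_at_0: "filterlim sqn (at_right 0) (at 0)"
proof -
  have "(sqn \<longlongrightarrow> ((0 :: real^2) $ 1)\<^sup>2 + ((0 :: real^2) $ 2)\<^sup>2) (at 0)"
    unfolding sqn_def[abs_def] by (intro tendsto_intros tendsto_vec_nth)
  moreover have "\<forall>\<^sub>F x in at 0. sqn x \<in> {0<..} \<and> sqn x \<noteq> 0" by (auto simp: eventually_at_filter sqn_norm)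
  ultimately show ?thesis by (simp add: filterlim_at)
qed

lemma planar_tendsto: "(planar \<tau> \<longlongrightarrow> planar \<tau> a) (at a)"
  using linear_continuous_at[OF bounded_linear_planar] by (simp add: isCont_def)

lemma vortex_field_tendsto:
  assumes "(w \<longlongrightarrow> c) (at_right 0)"
  shows "(vortex_field w \<tau> k \<longlongrightarrow> of_real c * 0 ^ k) (at 0)"
proof -
  have "(planar \<tau> \<longlongrightarrow> 0) (at 0)" using planar_tendsto[of \<tau> 0] by (simp add: planar_def)
  then show ?thesis
    unfolding vortex_field_def[abs_def]
    by (intro tendsto_intros filterlim_compose[OF assms sqn_at_0])
qed

lemma continuous_on_sqn: "continuous_on S sqn"
  unfolding sqn_def[abs_def] by (intro continuous_intros)

lemma vortex_field_continuous:
  assumes "continuous_on {0<..} w"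
  shows "continuous_on (- {0}) (vortex_field w \<tau> k)"
  unfolding vortex_field_def[abs_def]
  by (intro continuous_intros continuous_on_compose2[OF assms continuous_on_sqn]
      linear_continuous_on[OF bounded_linear_planar]) (auto simp: sqn_pos)

lemma planar_axis: "planar \<tau> (axis 1 1) = 1" "planar \<tau> (axis 2 1) = \<i> * of_real \<tau>"
  by (simp_all add: planar_def axis_def)

text \<open>The left side adds the second derivatives in the two coordinate directions. T^2 = -1
  cancels the terms with \<open>w\<close> alone, as z^k is harmonic, and a + T b = e collapses the
  mixed terms to 4 k w1 e^k, which is Euler's relation.\<close>

lemma laplacian_algebra:
  fixes a b w w1 w2 T e :: complex and k :: nat
  assumes T: "T * T = -1" and e: "e = a + T * b"
  shows "(2 * w1 * e ^ k + 2 * a * (2 * a * (w2 * e ^ k) + of_nat k * (w1 * e ^ (k - 1)))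
       + of_nat k * (2 * a * (w1 * e ^ (k - 1)) + of_nat (k - 1) * (w * e ^ (k - 1 - 1))))
     + (2 * w1 * e ^ k + 2 * b * (2 * b * (w2 * e ^ k) + of_nat k * T * (w1 * e ^ (k - 1)))
       + of_nat k * T * (2 * b * (w1 * e ^ (k - 1)) + of_nat (k - 1) * T * (w * e ^ (k - 1 - 1))))
     = (4 * (a\<^sup>2 + b\<^sup>2) * w2 + 4 * (of_nat k + 1) * w1) * e ^ k"
proof (cases k)
  case 0
  then show ?thesis by (simp add: algebra_simps power2_eq_square)
next
  case (Suc j)
  have key: "?thesis \<longleftrightarrow> of_nat k * of_nat j * (1 + T * T) * (w * e ^ (j - 1)) + 4 * of_nat k * w1 * e ^ j * (a + T * b)
      = 4 * of_nat k * w1 * e ^ Suc j"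
    unfolding Suc by (simp add: algebra_simps power2_eq_square)
  show ?thesis by (rule iffD2[OF key]) (simp add: T flip: e)
qed

text \<open>\<open>W2\<close> itself may be unbounded at 0. It enters the second derivatives only
  with a factor x_i x_j, which is at most \<sigma> = |x|^2 in modulus, so the limit of \<sigma> W2
  is enough for them to extend continuously.\<close>

lemma vortex_field_C2:
  fixes u :: "real^2 \<Rightarrow> complex"
  assumes W: "\<And>\<sigma>. \<sigma> > 0 \<Longrightarrow> (W has_real_derivative W1 \<sigma>) (at \<sigma>)"
    and W1: "\<And>\<sigma>. \<sigma> > 0 \<Longrightarrow> (W1 has_real_derivative W2 \<sigma>) (at \<sigma>)"
    and cW2: "continuous_on {0<..} W2"
    and c: "(W \<longlongrightarrow> c) (at_right 0)" and c1: "(W1 \<longlongrightarrow> c1) (at_right 0)"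
    and c2: "((\<lambda>\<sigma>. \<sigma> * W2 \<sigma>) \<longlongrightarrow> 0) (at_right 0)"
    and u: "\<And>x. x \<noteq> 0 \<Longrightarrow> u x = vortex_field W \<tau> k x" and u0: "u 0 = of_real c * 0 ^ k"
    and \<tau>: "\<tau>\<^sup>2 = 1"
  shows "C2_plane u"
    and "x \<noteq> 0 \<Longrightarrow> laplacian u x = of_real (4 * sqn x * W2 (sqn x) + 4 * (real k + 1) * W1 (sqn x)) * planar \<tau> x ^ k"
proof -
  let ?F = "\<lambda>w k. vortex_field w \<tau> k" and ?e = "\<lambda>i::2. planar \<tau> (axis i 1)"
  define D where "D x h = vortex_deriv W W1 \<tau> k x h" for x h
  define D2 where "D2 i x h = of_real (2 * h $ i) * ?F W1 k x + of_real (2 * x $ i) * vortex_deriv W1 W2 \<tau> k x h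
    + of_nat k * ?e i * vortex_deriv W W1 \<tau> (k - 1) x h" for i :: 2 and x h :: "real^2"
  have ax: "x $ 1 * axis i 1 $ 1 + x $ 2 * axis i 1 $ 2 = x $ i" for x :: "real^2" and i :: 2
    using exhaust_2[of i] by (auto simp: axis_def)
  have Di: "D x (axis i 1) = of_real (2 * x $ i) * ?F W1 k x + of_nat k * ?e i * ?F W (k - 1) x" for x i
    by (simp add: D_def vortex_deriv_def ax)
  have cW: "continuous_on {0<..} W" "continuous_on {0<..} W1"
    using W W1 by (auto intro!: continuous_at_imp_continuous_on DERIV_isCont)
  have op: "open (- {0 :: real^2})" by (simp add: open_Compl)
  have comp: "((\<lambda>x :: real^2. x $ i) \<longlongrightarrow> 0) (at 0)" for i :: 2
    using tendsto_vec_nth[OF tendsto_ident_at, of i "0 :: real^2" UNIV] by simp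
  have ccomp: "continuous_on S (\<lambda>x :: real^2. x $ i)" for i :: 2 and S :: "(real^2) set"
    by (intro continuous_intros)
  have dcomp: "((\<lambda>x :: real^2. x $ i) has_derivative (\<lambda>h. h $ i)) (at x)" for i :: 2 and x :: "real^2"
    by (rule bounded_linear_imp_has_derivative[OF bounded_linear_vec_nth])
  have du: "(u has_derivative D x) (at x)" if x: "x \<noteq> 0" for x
  proof (rule has_derivative_transform_within_open[OF _ op])
    show "(?F W k has_derivative D x) (at x)"
      unfolding D_def by (rule vortex_field_has_derivative[of x W W1, OF x W[OF iffD2[OF sqn_pos x]]])
  qed (use x u in auto)
  have ulim: "(u \<longlongrightarrow> u 0) (at 0)"
    unfolding u0 by (rule Lim_transform_eventually[OF vortex_field_tendsto[OF c, where \<tau>=\<tau>]]) (auto simp: eventually_at_filter u)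
  have cu: "continuous_on UNIV u"
  proof -
    have "isCont u x" for x
    proof (cases "x = 0")
      case True
      then show ?thesis using ulim by (simp add: isCont_def)
    next
      case False
      then show ?thesis using du has_derivative_continuous by blast
    qed
    then show ?thesis by (simp add: continuous_on_eq_continuous_at)
  qed
  \<comment> \<open>The limits repeat the expression in \<open>Di\<close> term by term. Since 0 ^ 0
    = 1, the term with \<open>c\<close> survives exactly for k = 1.\<close>
  define L where "L i = of_real (2 * 0) * (of_real c1 * 0 ^ k) + of_nat k * ?e i * (of_real c * 0 ^ (k - 1))" for i
  have lim1: "((\<lambda>x. D x (axis i 1)) \<longlongrightarrow> L i) (at 0)" for i
    unfolding Di L_def by (intro tendsto_intros comp vortex_field_tendsto c c1)
  have cont1: "continuous_on (- {0}) (\<lambda>x. D x (axis i 1))" for i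
    unfolding Di by (intro continuous_intros ccomp vortex_field_continuous cW)
  note C1 = C1_plane_removable[OF cu du lim1 cont1]
  have pd: "partial_deriv i u = (\<lambda>x. if x = 0 then L i else D x (axis i 1))" for i by (rule C1(2))
  have cpd: "continuous_on UNIV (partial_deriv i u)" for i using C1(1) by (simp add: C1_plane_def)
  have d2: "(partial_deriv i u has_derivative D2 i x) (at x)" if x: "x \<noteq> 0" for i x
  proof (rule has_derivative_transform_within_open[OF _ op])
    have 1: "((\<lambda>x. of_real (2 * x $ i) :: complex) has_derivative (\<lambda>h. of_real (2 * h $ i))) (at x)"
      by (rule bounded_linear.has_derivative[OF bounded_linear_of_real has_derivative_mult_right[OF dcomp]])
    have 2: "(?F W1 k has_derivative vortex_deriv W1 W2 \<tau> k x) (at x)"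
      by (rule vortex_field_has_derivative[of x W1 W2, OF x W1[OF iffD2[OF sqn_pos x]]])
    have 3: "(?F W (k - 1) has_derivative vortex_deriv W W1 \<tau> (k - 1) x) (at x)"
      by (rule vortex_field_has_derivative[of x W W1, OF x W[OF iffD2[OF sqn_pos x]]])
    show "((\<lambda>x. of_real (2 * x $ i) * ?F W1 k x + of_nat k * ?e i * ?F W (k - 1) x) has_derivative D2 i x) (at x)"
      by (rule has_derivative_eq_rhs[OF has_derivative_add[OF has_derivative_mult[OF 1 2] has_derivative_mult_right[OF 3]]])
        (auto simp: D2_def algebra_simps)
  qed (use x in \<open>auto simp: pd Di\<close>)
  have D2i: "D2 i x (axis j 1) = of_real (2 * axis j 1 $ i) * ?F W1 k x
      + (of_real (4 * (x $ i * x $ j)) * ?F W2 k x + of_real (2 * x $ i) * (of_nat k * ?e j * ?F W1 (k - 1) x))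
      + of_nat k * ?e i * (of_real (2 * x $ j) * ?F W1 (k - 1) x + of_nat (k - 1) * ?e j * ?F W (k - 1 - 1) x)" for i j x
    unfolding D2_def vortex_deriv_def ax by (simp add: algebra_simps)
  have quad: "((\<lambda>x. of_real (4 * (x $ i * x $ j)) * ?F W2 k x) \<longlongrightarrow> 0) (at 0)" for i j :: 2
  proof -
    have "((\<lambda>x. x $ i * x $ j * W2 (sqn x)) \<longlongrightarrow> 0) (at 0)"
    proof (rule Lim_null_comparison)
      show "((\<lambda>x. \<bar>sqn x * W2 (sqn x)\<bar>) \<longlongrightarrow> 0) (at 0)"
        using filterlim_compose[OF c2 sqn_at_0] by (rule tendsto_rabs_zero)
      have "\<bar>x $ i\<bar> * \<bar>x $ j\<bar> \<le> sqn x" for x :: "real^2"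
      proof -
        have "\<bar>x $ i\<bar> * \<bar>x $ j\<bar> \<le> norm x * norm x" by (intro mult_mono component_le_norm_cart) auto
        then show ?thesis by (simp add: sqn_norm power2_eq_square)
      qed
      then have "norm (x $ i * x $ j * W2 (sqn x)) \<le> \<bar>sqn x * W2 (sqn x)\<bar>" for x :: "real^2"
        by (auto simp: abs_mult sqn_norm intro!: mult_right_mono)
      then show "\<forall>\<^sub>F x in at 0. norm (x $ i * x $ j * W2 (sqn x)) \<le> \<bar>sqn x * W2 (sqn x)\<bar>" by simp
    qed
    then have "((\<lambda>x. of_real (4 * (x $ i * x $ j * W2 (sqn x))) * planar \<tau> x ^ k) \<longlongrightarrow> of_real (4 * 0) * planar \<tau> 0 ^ k) (at 0)"
      by (intro tendsto_intros planar_tendsto)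
    then show ?thesis by (simp add: vortex_field_def mult_ac)
  qed
  define L2 where "L2 i j = of_real (2 * axis j 1 $ i) * (of_real c1 * 0 ^ k)
      + (0 + of_real (2 * 0) * (of_nat k * ?e j * (of_real c1 * 0 ^ (k - 1))))
      + of_nat k * ?e i * (of_real (2 * 0) * (of_real c1 * 0 ^ (k - 1)) + of_nat (k - 1) * ?e j * (of_real c * 0 ^ (k - 1 - 1)))" for i j
  have lim2: "((\<lambda>x. D2 i x (axis j 1)) \<longlongrightarrow> L2 i j) (at 0)" for i j
    unfolding D2i L2_def by (intro tendsto_add tendsto_mult tendsto_const tendsto_of_real comp quad vortex_field_tendsto c c1)
  have cont2: "continuous_on (- {0}) (\<lambda>x. D2 i x (axis j 1))" for i j
    unfolding D2i by (intro continuous_intros ccomp vortex_field_continuous cW cW2)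
  note C2 = C1_plane_removable[OF cpd d2 lim2 cont2]
  show "C2_plane u" unfolding C2_plane_def using C1(1) C2(1) by blast
  assume x: "x \<noteq> 0"
  have pd2: "partial_deriv i (partial_deriv i u) x = D2 i x (axis i 1)" for i
    using C2(2)[of i i] x by simp
  have T: "(\<i> * of_real \<tau>) * (\<i> * of_real \<tau>) = (-1 :: complex)"
  proof -
    have "(of_real \<tau> :: complex) * of_real \<tau> = of_real (\<tau>\<^sup>2)" by (simp add: power2_eq_square)
    then show ?thesis using \<tau> by (simp add: algebra_simps)
  qed
  have pl: "planar \<tau> x = of_real (x $ 1) + (\<i> * of_real \<tau>) * of_real (x $ 2)" by (simp add: planar_def)
  have "laplacian u x = D2 1 x (axis 1 1) + D2 2 x (axis 2 1)" by (simp add: laplacian_def sum_2 pd2)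
  also have "\<dots> = (4 * ((of_real (x $ 1))\<^sup>2 + (of_real (x $ 2))\<^sup>2) * of_real (W2 (sqn x))
      + 4 * (of_nat k + 1) * of_real (W1 (sqn x))) * planar \<tau> x ^ k"
    unfolding laplacian_algebra[OF T pl, where w="of_real (W (sqn x))", symmetric] D2i planar_axis vortex_field_def
    by (simp add: algebra_simps axis_def)
  also have "\<dots> = of_real (4 * sqn x * W2 (sqn x) + 4 * (real k + 1) * W1 (sqn x)) * planar \<tau> x ^ k"
    by (simp add: sqn_def)
  finally show "laplacian u x = of_real (4 * sqn x * W2 (sqn x) + 4 * (real k + 1) * W1 (sqn x)) * planar \<tau> x ^ k" .
qed

text \<open>With z = r cis \<theta> and k = |n|, the factor r^k e^(i n \<theta>) is z^k for n >= 0
  and the k-th power of the conjugate for n < 0, since the inverse of a unit number is its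
  conjugate.\<close>

lemma polar_field_planar:
  assumes x: "x \<noteq> 0"
  shows "polar_field f n x = of_real (f (norm x) / norm x ^ nat \<bar>n\<bar>) * planar (if n \<ge> 0 then 1 else -1) x ^ nat \<bar>n\<bar>"
    and "cmod (polar_field f n x) = \<bar>f (norm x)\<bar>"
proof -
  define z where "z = Complex (x $ 1) (x $ 2)"
  define k where "k = nat \<bar>n\<bar>"
  have nz: "cmod z = norm x" by (simp add: z_def complex_norm norm_vec_def L2_set_def sum_2)
  then have r: "norm x > 0" using x by simp
  have e: "exp (\<i> * of_int n * of_real a) = cis a powi n" for a
    by (simp only: cis_power_int) (simp add: cis_conv_exp mult_ac)
  have z1: "z = of_real (norm x) * cis (Arg z)" using rcis_cmod_Arg[of z] by (simp add: rcis_def nz)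
  have z2: "cnj z = of_real (norm x) * cnj (cis (Arg z))" by (subst z1) simp
  have "of_real (norm x) ^ k * (cis (Arg z) powi n) = planar (if n \<ge> 0 then 1 else -1) x ^ k"
  proof (cases "n \<ge> 0")
    case True
    then have "cis (Arg z) powi n = cis (Arg z) ^ k" by (simp add: power_int_def k_def)
    moreover have "planar 1 x = z" by (simp add: planar_def z_def complex_eq_iff)
    ultimately show ?thesis using True trans[OF arg_cong[OF z1, of "\<lambda>w. w ^ k"] power_mult_distrib] by simp
  next
    case False
    have "cis (Arg z) powi n = inverse (cis (Arg z)) ^ nat (- n)" using False by (simp only: power_int_def if_False)
    moreover have "nat (- n) = k" using False by (simp add: k_def)
    moreover have "inverse (cis (Arg z)) = cnj (cis (Arg z))" by (simp only: cis_inverse cis_cnj)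
    ultimately have "cis (Arg z) powi n = cnj (cis (Arg z)) ^ k" by simp
    moreover have "planar (-1) x = cnj z" by (simp add: planar_def z_def complex_eq_iff)
    ultimately show ?thesis using False trans[OF arg_cong[OF z2, of "\<lambda>w. w ^ k"] power_mult_distrib] by simp
  qed
  then have "cis (Arg z) powi n = planar (if n \<ge> 0 then 1 else -1) x ^ k / of_real (norm x) ^ k"
    using r by (simp add: field_simps)
  then show "polar_field f n x = of_real (f (norm x) / norm x ^ nat \<bar>n\<bar>) * planar (if n \<ge> 0 then 1 else -1) x ^ nat \<bar>n\<bar>"
    unfolding polar_field_def e z_def[symmetric] k_def[symmetric] by simp
  have "cmod (cis (Arg z) powi n) = 1" by (simp add: norm_power_int)
  then show "cmod (polar_field f n x) = \<bar>f (norm x)\<bar>"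
    unfolding polar_field_def e z_def[symmetric] by (simp add: norm_mult)
qed

context radial_profile
begin

lemma polar_field_C2:
  assumes k: "k = nat \<bar>n\<bar>"
  shows "C2_plane (polar_field f n)"
    and "x \<noteq> 0 \<Longrightarrow> laplacian (polar_field f n) x
       = of_real (A * ((f (norm x))\<^sup>2 - s\<^sup>2) + B * ((g (norm x))\<^sup>2 - t\<^sup>2)) * polar_field f n x"
proof -
  obtain W W1 W2 c c1 where W: "\<And>\<sigma>. \<sigma> > 0 \<Longrightarrow> (W has_real_derivative W1 \<sigma>) (at \<sigma>)"
    "\<And>\<sigma>. \<sigma> > 0 \<Longrightarrow> (W1 has_real_derivative W2 \<sigma>) (at \<sigma>)" "continuous_on {0<..} W2"
    "(W \<longlongrightarrow> c) (at_right 0)" "(W1 \<longlongrightarrow> c1) (at_right 0)" "((\<lambda>\<sigma>. \<sigma> * W2 \<sigma>) \<longlongrightarrow> 0) (at_right 0)"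
    and fW: "\<And>r. r > 0 \<Longrightarrow> f r = r ^ k * W (r\<^sup>2)" and f0c: "k = 0 \<longrightarrow> f 0 = c"
    and eq: "\<And>\<sigma>. \<sigma> > 0 \<Longrightarrow> 4 * \<sigma> * W2 \<sigma> + 4 * (real k + 1) * W1 \<sigma> = V (ln \<sigma> / 2) * W \<sigma>"
    using planar_factor by blast
  define \<tau> where "\<tau> = (if n \<ge> 0 then 1 else -1 :: real)"
  have \<tau>: "\<tau>\<^sup>2 = 1" by (simp add: \<tau>_def)
  have u: "polar_field f n x = vortex_field W \<tau> k x" if x: "x \<noteq> 0" for x
    unfolding polar_field_planar(1)[OF x] k[symmetric] \<tau>_def[symmetric] vortex_field_def
    using x fW[of "norm x"] by (simp add: sqn_norm)
  have u0: "polar_field f n 0 = of_real c * 0 ^ k"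
  proof (cases "k = 0")
    case True
    then have "n = 0" using k by simp
    then show ?thesis using f0c True by (simp add: polar_field_def)
  next
    case False
    then have "f 0 = 0" unfolding f_0 p0_def by (rule if_not_P)
    then show ?thesis using False by (simp add: polar_field_def)
  qed
  show "C2_plane (polar_field f n)" by (rule vortex_field_C2(1)[OF W u u0 \<tau>])
  assume x: "x \<noteq> 0"
  have lap: "laplacian (polar_field f n) x
      = of_real (4 * sqn x * W2 (sqn x) + 4 * (real k + 1) * W1 (sqn x)) * planar \<tau> x ^ k"
    by (rule vortex_field_C2(2)[OF W u u0 \<tau> x])
  have "ln (sqn x) / 2 = ln (norm x)" using x by (simp add: sqn_norm ln_realpow)
  then have "V (ln (sqn x) / 2) = A * ((f (norm x))\<^sup>2 - s\<^sup>2) + B * ((g (norm x))\<^sup>2 - t\<^sup>2)"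
    using V_ln[of "norm x"] x by simp
  then show "laplacian (polar_field f n) x
       = of_real (A * ((f (norm x))\<^sup>2 - s\<^sup>2) + B * ((g (norm x))\<^sup>2 - t\<^sup>2)) * polar_field f n x"
    unfolding lap eq[OF iffD2[OF sqn_pos x]] u[OF x] vortex_field_def by simp
qed

end

section \<open>The system on the whole plane, the origin included\<close>

lemma C2_plane_continuous:
  assumes "C2_plane u"
  shows "continuous_on UNIV u" "continuous_on UNIV (laplacian u)"
proof -
  have d: "u differentiable (at x)" for x using assms by (simp add: C2_plane_def C1_plane_def)
  then show "continuous_on UNIV u"
    by (intro continuous_at_imp_continuous_on ballI differentiable_imp_continuous_within)
  show "continuous_on UNIV (laplacian u)"
    using assms unfolding laplacian_def[abs_def] C2_plane_def C1_plane_def by (auto intro!: continuous_on_sum)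
qed

text \<open>Both sides are continuous by C^2 regularity, so the equation off the origin passes to
  the limit at 0.\<close>

lemma equation_at_origin:
  fixes u v :: "real^2 \<Rightarrow> complex"
  assumes C2: "C2_plane u" "C2_plane v"
    and eq: "\<And>x. x \<noteq> 0 \<Longrightarrow> laplacian u x = of_real (A * ((cmod (u x))\<^sup>2 - s\<^sup>2) + B * ((cmod (v x))\<^sup>2 - t\<^sup>2)) * u x"
  shows "- laplacian u x + of_real (A * ((cmod (u x))\<^sup>2 - s\<^sup>2) + B * ((cmod (v x))\<^sup>2 - t\<^sup>2)) * u x = 0"
proof -
  define E where "E x = - laplacian u x + of_real (A * ((cmod (u x))\<^sup>2 - s\<^sup>2) + B * ((cmod (v x))\<^sup>2 - t\<^sup>2)) * u x" for x
  have "continuous_on UNIV E"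
    unfolding E_def by (intro continuous_intros C2_plane_continuous C2)
  then have "(E \<longlongrightarrow> E 0) (at 0)" by (simp add: continuous_on_def)
  moreover have "(E \<longlongrightarrow> 0) (at 0)"
    by (rule Lim_transform_eventually[OF tendsto_const]) (auto simp: eventually_at_filter E_def eq)
  ultimately have "E 0 = 0" using LIM_unique by blast
  then have "E x = 0" by (cases "x = 0") (simp_all add: E_def eq)
  then show ?thesis by (simp add: E_def)
qed

lemma (in radial_profile) entire:
  assumes "k = nat \<bar>n\<bar>" "l = nat \<bar>n'\<bar>"
  shows "entire_solution A A' B s t (\<lambda>x. (polar_field f n x, polar_field g n' x))"
proof -
  interpret sw: radial_profile A' A B t s l k q p q' p' by (rule swap)
  note u = polar_field_C2[OF assms(1)] and v = sw.polar_field_C2[OF assms(2)]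
  have eu: "laplacian (polar_field f n) x = of_real (A * ((cmod (polar_field f n x))\<^sup>2 - s\<^sup>2)
      + B * ((cmod (polar_field g n' x))\<^sup>2 - t\<^sup>2)) * polar_field f n x" if "x \<noteq> 0" for x
    using u(2)[OF that] by (simp add: polar_field_planar(2)[OF that])
  have ev: "laplacian (polar_field g n') x = of_real (A' * ((cmod (polar_field g n' x))\<^sup>2 - t\<^sup>2)
      + B * ((cmod (polar_field f n x))\<^sup>2 - s\<^sup>2)) * polar_field g n' x" if "x \<noteq> 0" for x
    using v(2)[OF that] by (simp add: polar_field_planar(2)[OF that])
  show ?thesis
    unfolding entire_solution_def Let_def fst_conv snd_conv
    using u(1) v(1) equation_at_origin[OF u(1) v(1) eu] equation_at_origin[OF v(1) u(1) ev] by blast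
qed

text \<open>Gronwall for the energy p^2 + p'^2: its derivative 2 p p' (1 + c) is at most (1 + M)
  times the energy where |c| <= M.\<close>

lemma zero_propagates:
  fixes p p' c :: "real \<Rightarrow> real"
  assumes p: "\<And>x. (p has_real_derivative p' x) (at x)"
    and p': "\<And>x. (p' has_real_derivative c x * p x) (at x)"
    and c: "continuous_on UNIV c" and z: "p a = 0" "p' a = 0" and b: "a \<le> b"
  shows "p b = 0"
proof -
  have "compact (c ` {a..b})" by (intro compact_continuous_image continuous_on_subset[OF c]) auto
  then obtain M where M: "\<And>x. x \<in> {a..b} \<Longrightarrow> \<bar>c x\<bar> \<le> M" using compact_imp_bounded by (force simp: bounded_iff)
  define E where "E x = ((p x)\<^sup>2 + (p' x)\<^sup>2) * exp (- (1 + M) * x)" for x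
  have "E b \<le> E a"
  proof (rule DERIV_nonpos_imp_nonincreasing[OF b])
    fix x assume x: "a \<le> x" "x \<le> b"
    have "(E has_real_derivative (2 * p x * p' x * (1 + c x) - (1 + M) * ((p x)\<^sup>2 + (p' x)\<^sup>2)) * exp (- (1 + M) * x)) (at x)"
      unfolding E_def[abs_def] by (auto intro!: derivative_eq_intros p p' simp: algebra_simps power2_eq_square)
    moreover have "2 * p x * p' x * (1 + c x) \<le> (1 + M) * ((p x)\<^sup>2 + (p' x)\<^sup>2)"
    proof -
      have "2 * p x * p' x * (1 + c x) \<le> \<bar>1 + c x\<bar> * \<bar>2 * p x * p' x\<bar>"
        by (metis abs_ge_self abs_mult mult.commute)
      also have "\<dots> \<le> (1 + M) * ((p x)\<^sup>2 + (p' x)\<^sup>2)"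
      proof (rule mult_mono)
        show "\<bar>1 + c x\<bar> \<le> 1 + M" "0 \<le> 1 + M" using M[of x] x by auto
        show "\<bar>2 * p x * p' x\<bar> \<le> (p x)\<^sup>2 + (p' x)\<^sup>2"
          using sum_squares_bound[of "p x" "p' x"] sum_squares_bound[of "- p x" "p' x"] by (auto simp: abs_le_iff)
      qed simp
      finally show ?thesis .
    qed
    ultimately show "\<exists>y. (E has_real_derivative y) (at x) \<and> y \<le> 0"
      by (intro exI conjI) (assumption, simp add: mult_nonpos_nonneg)
  qed
  then have "((p b)\<^sup>2 + (p' b)\<^sup>2) * exp (- (1 + M) * b) \<le> 0" by (simp add: E_def z)
  then show ?thesis by (simp add: mult_le_0_iff sum_power2_le_zero_iff)
qed

section \<open>Arbitrary radial solutions in the logarithmic variable\<close>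

lemma radial_component_log:
  assumes "radial_component A B s t n f g"
  shows "has_second_deriv (\<lambda>x. f (exp x)) (\<lambda>x. reaction A B s t (real (nat \<bar>n\<bar>)) x (f (exp x)) (g (exp x))) UNIV"
proof -
  have d: "(f has_real_derivative deriv f r) (at r)" "(deriv f has_real_derivative deriv (deriv f) r) (at r)" if "r > 0" for r
    using assms that DERIV_deriv_iff_real_differentiable by (auto simp: radial_component_def C2_pos_def)
  have ode: "- deriv (deriv f) r - 1 / r * deriv f r + (of_int n)\<^sup>2 / r\<^sup>2 * f r
            + (A * ((f r)\<^sup>2 - s\<^sup>2) + B * ((g r)\<^sup>2 - t\<^sup>2)) * f r = 0" if "r > 0" for r
    using assms that by (auto simp: radial_component_def)
  have kn: "(real_of_int n)\<^sup>2 = (real (nat \<bar>n\<bar>))\<^sup>2" by (simp add: power2_eq_square abs_mult_self_eq flip: of_int_mult)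
  show ?thesis
  proof (rule has_second_derivI[where w'="\<lambda>x. deriv f (exp x) * exp x"])
    fix x :: real
    show "((\<lambda>x. f (exp x)) has_real_derivative deriv f (exp x) * exp x) (at x)"
      by (rule DERIV_chain2[OF d(1)]) auto
    have "((\<lambda>x. deriv f (exp x)) has_real_derivative deriv (deriv f) (exp x) * exp x) (at x)"
      by (rule DERIV_chain2[OF d(2)]) auto
    then have "((\<lambda>x. deriv f (exp x) * exp x) has_real_derivative
        deriv (deriv f) (exp x) * exp x * exp x + exp x * deriv f (exp x)) (at x)"
      by (rule DERIV_mult) auto
    moreover have "deriv (deriv f) (exp x) * exp x * exp x + exp x * deriv f (exp x)
       = reaction A B s t (real (nat \<bar>n\<bar>)) x (f (exp x)) (g (exp x))"
    proof -
      define r where "r = exp x"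
      have r: "r > 0" by (simp add: r_def)
      have r2: "exp (2 * x) = r\<^sup>2" by (simp add: r_def exp_double)
      have dd: "deriv (deriv f) r = (of_int n)\<^sup>2 / r\<^sup>2 * f r + (A * ((f r)\<^sup>2 - s\<^sup>2) + B * ((g r)\<^sup>2 - t\<^sup>2)) * f r - 1 / r * deriv f r"
        using ode[OF r] by linarith
      have "deriv (deriv f) r * r * r + r * deriv f r
         = ((of_int n)\<^sup>2 + r\<^sup>2 * (A * ((f r)\<^sup>2 - s\<^sup>2) + B * ((g r)\<^sup>2 - t\<^sup>2))) * f r"
        unfolding dd using r by (simp add: field_simps power2_eq_square)
      then show ?thesis unfolding reaction_def r_def[symmetric] r2 kn .
    qed
    ultimately show "((\<lambda>x. deriv f (exp x) * exp x) has_real_derivative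
        reaction A B s t (real (nat \<bar>n\<bar>)) x (f (exp x)) (g (exp x))) (at x)" by simp
  qed
qed

text \<open>A zero at r > 0 is a minimum of a nonnegative function, so the derivative vanishes too.
  Read in x = ln r as a linear equation for this component with a continuous coefficient, the
  equation would keep it 0 from there on, against its limit s > 0.\<close>

lemma radial_component_range:
  assumes f: "radial_component A B s t n f g" and g: "radial_component A' B t s n' g f" and s: "s > 0"
  shows "\<And>r. r > 0 \<Longrightarrow> f r > 0" "\<exists>C. \<forall>r\<ge>0. f r \<le> C" "\<forall>\<^sub>F x in at_top. s / 2 \<le> f (exp x)"
proof -
  have lim: "(f \<longlongrightarrow> s) at_top" and nn: "\<And>r. r \<ge> 0 \<Longrightarrow> f r \<ge> 0" and cf: "continuous_on {0..} f"
    using f by (auto simp: radial_component_def)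
  have "((\<lambda>x. f (exp x)) \<longlongrightarrow> s) at_top" by (rule filterlim_compose[OF lim exp_at_top])
  then have ev: "\<forall>\<^sub>F x in at_top. s / 2 < f (exp x)" by (rule order_tendstoD(1)) (use s in simp)
  then show "\<forall>\<^sub>F x in at_top. s / 2 \<le> f (exp x)" by eventually_elim simp
  have "\<forall>\<^sub>F r in at_top. f r < s + 1" by (rule order_tendstoD(2)[OF lim]) simp
  then obtain R where R: "\<And>r. r \<ge> R \<Longrightarrow> f r < s + 1" by (auto simp: eventually_at_top_linorder)
  have "compact (f ` {0..R})" by (intro compact_continuous_image continuous_on_subset[OF cf]) auto
  then obtain M where M: "\<And>r. r \<in> {0..R} \<Longrightarrow> \<bar>f r\<bar> \<le> M" using compact_imp_bounded by (force simp: bounded_iff)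
  have "f r \<le> max M (s + 1)" if "r \<ge> 0" for r
    using M[of r] R[of r] that by (cases "r \<le> R") auto
  then show "\<exists>C. \<forall>r\<ge>0. f r \<le> C" by blast
  fix r :: real assume r: "r > 0"
  show "f r > 0"
  proof (rule ccontr)
    assume "\<not> f r > 0"
    then have z: "f (exp (ln r)) = 0" using nn[of r] r by simp
    define c where "c x = (real (nat \<bar>n\<bar>))\<^sup>2 + exp (2 * x) * (A * ((f (exp x))\<^sup>2 - s\<^sup>2) + B * ((g (exp x))\<^sup>2 - t\<^sup>2))" for x
    obtain p' where p': "\<And>x. ((\<lambda>x. f (exp x)) has_real_derivative p' x) (at x)"
      "\<And>x. (p' has_real_derivative c x * f (exp x)) (at x)"
      using radial_component_log[OF f] unfolding has_second_deriv_def reaction_def c_def by blast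
    have "continuous_on UNIV (\<lambda>x. f (exp x))" "continuous_on UNIV (\<lambda>x. g (exp x))"
      using has_second_deriv_continuous[OF radial_component_log[OF f]] has_second_deriv_continuous[OF radial_component_log[OF g]] by auto
    then have cc: "continuous_on UNIV c" unfolding c_def by (intro continuous_intros)
    have "p' (ln r) = 0"
      by (rule DERIV_local_min[OF p'(1) zero_less_one]) (use z nn in auto)
    then have zero: "f (exp x) = 0" if "x \<ge> ln r" for x
      using zero_propagates[OF p' cc z _ that] by simp
    have "\<forall>\<^sub>F x in at_top. f (exp x) = 0"
      using eventually_ge_at_top[of "ln r"] by eventually_elim (rule zero)
    with ev have "\<forall>\<^sub>F x::real in at_top. False" by eventually_elim (use s in simp)
    then show False by simp
  qed
qed

lemma radial_solution_profile_pair: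
  assumes sol: "radial_solution A A' B s t n n' f g" and st: "s > 0" "t > 0"
  shows "profile_pair A A' B s t (real (nat \<bar>n\<bar>)) (real (nat \<bar>n'\<bar>)) (\<lambda>x. f (exp x)) (\<lambda>x. g (exp x))"
proof -
  have f: "radial_component A B s t n f g" and g: "radial_component A' B t s n' g f"
    using sol by (auto simp: radial_solution_def)
  note rf = radial_component_range[OF f g st(1)] and rg = radial_component_range[OF g f st(2)]
  obtain C C' where C: "\<And>r. r \<ge> 0 \<Longrightarrow> f r \<le> C" "\<And>r. r \<ge> 0 \<Longrightarrow> g r \<le> C'" using rf(2) rg(2) by blast
  have "\<forall>x. f (exp x) \<le> max C C' \<and> g (exp x) \<le> max C C'"
    using C by (auto simp: le_max_iff_disj)
  moreover have "\<forall>\<^sub>F x in at_top. min (s / 2) (t / 2) \<le> f (exp x) \<and> min (s / 2) (t / 2) \<le> g (exp x)"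
    using rf(3) rg(3) by eventually_elim (auto simp: min_le_iff_disj)
  moreover have "min (s / 2) (t / 2) > 0" using st by simp
  ultimately show ?thesis
    unfolding profile_pair_def using radial_component_log[OF f] radial_component_log[OF g] rf(1) rg(1)
    by (intro conjI allI) (auto intro: exI[of _ "max C C'"] exI[of _ "min (s / 2) (t / 2)"])
qed

theorem proposition1p1:
  fixes Ap Am B tp tm :: real and np nm :: int
  assumes "Ap > 0" "Am > 0" "tp > 0" "tm > 0" and "Ap * Am - B\<^sup>2 > 0"
  shows "\<exists>fp fm.
    radial_solution Ap Am B tp tm np nm fp fm \<and>
    (\<forall>gp gm. radial_solution Ap Am B tp tm np nm gp gm \<longrightarrow>
        (\<forall>r\<ge>0. gp r = fp r \<and> gm r = fm r)) \<and>
    smooth_pos fp \<and> smooth_pos fm \<and>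
    (\<forall>r>0. fp r > 0 \<and> fm r > 0) \<and>
    vanishes_to_order fp (nat \<bar>np\<bar>) \<and> vanishes_to_order fm (nat \<bar>nm\<bar>) \<and>
    set_integrable lborel {0<..} (\<lambda>r. (deriv fp r)\<^sup>2 * r) \<and>
    set_integrable lborel {0<..} (\<lambda>r. (deriv fm r)\<^sup>2 * r) \<and>
    set_integrable lborel {0<..} (\<lambda>r.
        (Ap * ((fp r)\<^sup>2 - tp\<^sup>2)\<^sup>2 + 2 * B * ((fp r)\<^sup>2 - tp\<^sup>2) * ((fm r)\<^sup>2 - tm\<^sup>2)
          + Am * ((fm r)\<^sup>2 - tm\<^sup>2)\<^sup>2) * r) \<and>
    (LINT r:{0<..}|lborel.
        (Ap * ((fp r)\<^sup>2 - tp\<^sup>2)\<^sup>2 + 2 * B * ((fp r)\<^sup>2 - tp\<^sup>2) * ((fm r)\<^sup>2 - tm\<^sup>2)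
          + Am * ((fm r)\<^sup>2 - tm\<^sup>2)\<^sup>2) * r)
      = (of_int np)\<^sup>2 * tp\<^sup>2 + (of_int nm)\<^sup>2 * tm\<^sup>2 \<and>
    entire_solution Ap Am B tp tm (\<lambda>x. (polar_field fp np x, polar_field fm nm x))"
proof -
  define k where "k = nat \<bar>np\<bar>"
  define l where "l = nat \<bar>nm\<bar>"
  obtain p q where pq: "profile_pair Ap Am B tp tm (real k) (real l) p q"
    using exists_profile_pair[OF assms, of "real k" "real l"] by auto
  obtain p' q' where d: "\<And>x. (p has_real_derivative p' x) (at x)"
      "\<And>x. (p' has_real_derivative reaction Ap B tp tm (real k) x (p x) (q x)) (at x)"
      "\<And>x. (q has_real_derivative q' x) (at x)"
      "\<And>x. (q' has_real_derivative reaction Am B tm tp (real l) x (q x) (p x)) (at x)"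
    using pq unfolding profile_pair_def has_second_deriv_def by blast
  interpret radial_profile Ap Am B tp tm k l p q p' q'
    by unfold_locales (use assms d pq in \<open>auto simp: profile_pair_def\<close>)
  interpret sw: radial_profile Am Ap B tm tp l k q p q' p' by (rule swap)
  have sol: "radial_solution Ap Am B tp tm np nm f g"
    unfolding radial_solution_def
    using f_radial_component[OF k_def] sw.f_radial_component[OF l_def] by simp
  \<comment> \<open>Uniqueness in the variable x = ln r covers r > 0 only; at r = 0 continuity
    decides.\<close>
  have ext: "h 0 = f 0" if "continuous_on {0..} h" "continuous_on {0..} f" "\<And>r. r > 0 \<Longrightarrow> h r = f r"
    for h f :: "real \<Rightarrow> real"
  proof -
    have "(h \<longlongrightarrow> h 0) (at_right 0)" "(f \<longlongrightarrow> f 0) (at_right 0)"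
      using bspec[OF that(1)[unfolded continuous_on_def], of 0] bspec[OF that(2)[unfolded continuous_on_def], of 0]
      by (simp_all add: at_within_Ici_at_right)
    moreover have "\<forall>\<^sub>F r in at_right 0. h r = f r"
      using eventually_at_right_less[of 0] by eventually_elim (use that(3) in simp)
    ultimately have "(f \<longlongrightarrow> h 0) (at_right 0)" "(f \<longlongrightarrow> f 0) (at_right 0)"
      by (auto intro: Lim_transform_eventually)
    then show ?thesis using tendsto_unique[OF trivial_limit_at_right_real] by blast
  qed
  have uniq: "gp r = f r \<and> gm r = g r" if G: "radial_solution Ap Am B tp tm np nm gp gm" and r: "r \<ge> 0" for gp gm r
  proof -
    have "profile_pair Ap Am B tp tm (real k) (real l) (\<lambda>x. gp (exp x)) (\<lambda>x. gm (exp x))"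
      unfolding k_def l_def by (rule radial_solution_profile_pair[OF G assms(3,4)])
    from profile_pair_unique[OF assms(1,2,5) _ _ this pq]
    have e: "(\<lambda>x. gp (exp x)) = p" "(\<lambda>x. gm (exp x)) = q" by auto
    have pos: "gp r = f r" "gm r = g r" if "r > 0" for r
      using fun_cong[OF e(1), of "ln r"] fun_cong[OF e(2), of "ln r"] that by (auto simp: f_def sw.f_def)
    have c: "continuous_on {0..} gp" "continuous_on {0..} gm"
      using G by (simp_all add: radial_solution_def radial_component_def)
    have "gp 0 = f 0" by (rule ext[OF c(1) f_continuous pos(1)])
    moreover have "gm 0 = g 0" by (rule ext[OF c(2) sw.f_continuous pos(2)])
    ultimately show ?thesis using pos[of r] r by (cases "r = 0") auto
  qed
  have sq: "(real_of_int np)\<^sup>2 = (real k)\<^sup>2" "(real_of_int nm)\<^sup>2 = (real l)\<^sup>2"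
    by (simp_all add: k_def l_def power2_eq_square abs_mult_self_eq flip: of_int_mult)
  show ?thesis
    unfolding sq
  proof (rule exI[of _ f], rule exI[of _ g], intro conjI)
    show "\<forall>gp gm. radial_solution Ap Am B tp tm np nm gp gm \<longrightarrow> (\<forall>r\<ge>0. gp r = f r \<and> gm r = g r)"
      using uniq by blast
    show "\<forall>r>0. f r > 0 \<and> g r > 0" using f_pos sw.f_pos by blast
    show "vanishes_to_order f (nat \<bar>np\<bar>)" unfolding k_def[symmetric] by (rule f_vanishes)
    show "vanishes_to_order g (nat \<bar>nm\<bar>)" unfolding l_def[symmetric] by (rule sw.f_vanishes)
    show "radial_solution Ap Am B tp tm np nm f g" by (rule sol)
    show "smooth_pos f" by (rule f_smooth)
    show "smooth_pos g" by (rule sw.f_smooth)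
    show "set_integrable lborel {0<..} (\<lambda>r. (deriv f r)\<^sup>2 * r)" by (rule f_gradient_integrable)
    show "set_integrable lborel {0<..} (\<lambda>r. (deriv g r)\<^sup>2 * r)" by (rule sw.f_gradient_integrable)
    show "entire_solution Ap Am B tp tm (\<lambda>x. (polar_field f np x, polar_field g nm x))"
      by (rule entire[OF k_def l_def])
  qed (rule potential_integral)+
qed

end
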